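(* Let $\mathcal F[\sigma]$ be a fragment of logic corresponding to a local variety of finite monoids $\mathbf V$. Let $L$ be a regular language and $s$ its stability index. Then the following statements are equivalent: (1) $L$ belongs to $\mathcal F[\sigma,+1,\mathrm{MOD}]$; (2) $L$ belongs to $\mathcal F[\sigma,+1,\mathrm{MOD}^s]$; (3) the local monoids of the stable semigroup of $L$ belong to $\mathbf V$. Furthermore, if $\mathcal F[\sigma]$ is decidable, then so is $\mathcal F[\sigma,+1,\mathrm{MOD}]$.
   Context: Logic. A word $u$ over a finite alphabet $A$ is a set of positions $0,\dots,|u|-1$ labelled by letters. Formulas are monadic second order formulas over words; a signature $\sigma$ is a set of numerical predicates, and letter predicates $\mathbf a(x)$ (position $x$ carries letter $a$) are always available, for letters of any finite alphabet. A fragment of logic $\mathcal F[\sigma]$ is a set of closed formulas of $\mathrm{MSO}[\sigma]$ that contains the quantifier-free formulas and is closed under conjunction, disjunction and quantifier-free substitution (if $\varphi\in\mathcal F[\sigma]$ and $\psi(x_1,\dots,x_n)$ is a quantifier-free subformula of $\varphi$, then replacing $\psi$ by another quantifier-free formula over $\sigma$ with the same set of free variables gives a formula of $\mathcal F[\sigma]$). For a class of predicates $\sigma'$, the enrichment $\mathcal F[\sigma,\sigma']$ is the closure of $\mathcal F[\sigma]$ under quantifier-free substitutions with predicates ranging over $\sigma\cup\sigma'$. $\mathcal F[\sigma]$ also denotes the class of languages defined by its formulas. The symbol $+1$ denotes the class of descriptive local predicates $\mathbf a(x+k)$, $\mathbf a(\min+k)$, $\mathbf a(\max-k)$ for $k\ge0$,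 holding if the position $x+k$ (resp. the $k$-th position after the first one, the $k$-th position before the last one) is labelled by $a$. For $d\ge 1$, $\mathrm{MOD}^d$ consists of, for $0\le i<d$, the unary predicates $\mathbf{MOD}_i^d(x)$ (position $x$ is congruent to $i$ mod $d$) and the constants $\mathbf D_i^d$ (the length of the word is congruent to $i$ mod $d$); $\mathrm{MOD}=\bigcup_{d\ge1}\mathrm{MOD}^d$. A fragment is decidable if, given a regular language, one can decide whether it is definable by a formula of the fragment. Algebra. A variety of monoids is a nonempty class of finite monoids closed under division (quotients of submonoids) and finite direct products. $\mathcal F[\sigma]$ corresponds to $\mathbf V$ if the languages definable in $\mathcal F[\sigma]$ are exactly those recognized by a monoid of $\mathbf V$. For a morphism $\varphi:A^*\to M$ to a finite monoid, the stability index is the least positive integer $s$ with $\varphi(A^s)=\varphi(A^{2s})$, and the stable semigroup is the semigroup $\varphi(A^s)$. The stability index and stable semigroup of a regular language are those of its syntactic morphism. A local monoid of a semigroup $T$ is a monoid $eTe$ with $e$ an idempotent of $T$. Categories. Categories are finite; a monoid is a one-object category. A division of categories $\tau:C\to D$ is a map on objects together with, for each pair of objects $e,f$ of $C$, a relation $\tau:C(e,f)\to D(\tau(e),\tau(f))$ such that $\tau(x)\tau(y)\subseteq\tau(xy)$ for consecutive arrows $x,y$; $\tau(x)\ne\emptyset$ for every arrow $x$; $1_{\tau(e)}\in\tau(1_e)$ for every object $e$; and $\tau(x)\cap\tau(y)=\emptyset$ for distinct coterminal arrows $x,y$. $\mathbf{gV}$ is the class of all categories dividing a monoid of $\mathbf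 V$. $\ell\mathbf V$ is the class of all categories whose local monoids (the monoids $C(x,x)$, $x$ an object) are all in $\mathbf V$. $\mathbf V$ is local if $\mathbf{gV}=\ell\mathbf V$. *)

theory Defs
  imports "HOL-Algebra.Group" "HOL-Library.Nat_Bijection"
begin

section \<open>Monadic second order logic over words\<close>

text \<open>
  Letters are natural numbers and alphabets are finite sets of letters, so that a single set of
  formulas can speak about words over every finite alphabet. First-order and set variables live in
  separate name spaces, both indexed by natural numbers.
\<close>

type_synonym letter = nat
type_synonym word = "letter list"

text \<open>
  \<open>Numerical k R\<close> is a numerical predicate of arity \<open>k\<close>; it holds of positions \<open>ps\<close> in a word of
  length \<open>n\<close> iff \<open>R n ps\<close>. The other three constructors are the descriptive local predicates
  \<open>a(x + k)\<close>, \<open>a(min + k)\<close> and \<open>a(max - k)\<close>.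
\<close>

datatype predicate =
    Numerical nat "nat \<Rightarrow> nat list \<Rightarrow> bool"
  | Plus_letter letter nat
  | Min_letter letter nat
  | Max_letter letter nat

fun arity :: "predicate \<Rightarrow> nat" where
  "arity (Numerical k R) = k"
| "arity (Plus_letter a k) = 1"
| "arity (Min_letter a k) = 0"
| "arity (Max_letter a k) = 0"

fun pred_holds :: "word \<Rightarrow> predicate \<Rightarrow> nat list \<Rightarrow> bool" where
  "pred_holds w (Numerical k R) ps \<longleftrightarrow> R (length w) ps"
| "pred_holds w (Plus_letter a k) ps \<longleftrightarrow> hd ps + k < length w \<and> w ! (hd ps + k) = a"
| "pred_holds w (Min_letter a k) ps \<longleftrightarrow> k < length w \<and> w ! k = a"
| "pred_holds w (Max_letter a k) ps \<longleftrightarrow> k < length w \<and> w ! (length w - 1 - k) = a"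

definition numerical_signature :: "predicate set \<Rightarrow> bool" where
  "numerical_signature \<sigma> \<longleftrightarrow> (\<forall>P\<in>\<sigma>. \<exists>k R. P = Numerical k R)"

definition local_preds :: "predicate set" where
  "local_preds = {Plus_letter a k | a k. True} \<union> {Min_letter a k | a k. True}
     \<union> {Max_letter a k | a k. True}"

definition MOD_pos :: "nat \<Rightarrow> nat \<Rightarrow> predicate" where
  "MOD_pos d i = Numerical 1 (\<lambda>n ps. hd ps mod d = i)"

definition MOD_len :: "nat \<Rightarrow> nat \<Rightarrow> predicate" where
  "MOD_len d i = Numerical 0 (\<lambda>n ps. n mod d = i)"

definition MOD_preds :: "nat \<Rightarrow> predicate set" where
  "MOD_preds d = {MOD_pos d i | i. i < d} \<union> {MOD_len d i | i. i < d}"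

definition all_MOD_preds :: "predicate set" where
  "all_MOD_preds = (\<Union>d\<in>{1..}. MOD_preds d)"

text \<open>
  Letter predicates \<open>a(x)\<close> are formulas regardless of the signature. Equality and order are
  available only if they belong to the signature, as numerical predicates.
\<close>

datatype form =
    TT
  | FF
  | Letter letter nat
  | Atom predicate "nat list"
  | Mem nat nat  \<comment> \<open>\<open>Mem x X\<close>: position \<open>x\<close> belongs to the set \<open>X\<close>\<close>
  | Neg form
  | Conj form form
  | Disj form form
  | Ex1 nat form
  | All1 nat form
  | Ex2 nat form
  | All2 nat form

primrec sat :: "word \<Rightarrow> (nat \<Rightarrow> nat) \<Rightarrow> (nat \<Rightarrow> nat set) \<Rightarrow> form \<Rightarrow> bool" where
  "sat w v S TT \<longleftrightarrow> True"
| "sat w v S FF \<longleftrightarrow> False"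
| "sat w v S (Letter a x) \<longleftrightarrow> v x < length w \<and> w ! v x = a"
| "sat w v S (Atom P xs) \<longleftrightarrow> pred_holds w P (map v xs)"
| "sat w v S (Mem x X) \<longleftrightarrow> v x \<in> S X"
| "sat w v S (Neg \<phi>) \<longleftrightarrow> \<not> sat w v S \<phi>"
| "sat w v S (Conj \<phi> \<psi>) \<longleftrightarrow> sat w v S \<phi> \<and> sat w v S \<psi>"
| "sat w v S (Disj \<phi> \<psi>) \<longleftrightarrow> sat w v S \<phi> \<or> sat w v S \<psi>"
| "sat w v S (Ex1 x \<phi>) \<longleftrightarrow> (\<exists>p<length w. sat w (v(x := p)) S \<phi>)"
| "sat w v S (All1 x \<phi>) \<longleftrightarrow> (\<forall>p<length w. sat w (v(x := p)) S \<phi>)"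
| "sat w v S (Ex2 X \<phi>) \<longleftrightarrow> (\<exists>Q. Q \<subseteq> {..<length w} \<and> sat w v (S(X := Q)) \<phi>)"
| "sat w v S (All2 X \<phi>) \<longleftrightarrow> (\<forall>Q. Q \<subseteq> {..<length w} \<longrightarrow> sat w v (S(X := Q)) \<phi>)"

primrec fv1 :: "form \<Rightarrow> nat set" where
  "fv1 TT = {}"
| "fv1 FF = {}"
| "fv1 (Letter a x) = {x}"
| "fv1 (Atom P xs) = set xs"
| "fv1 (Mem x X) = {x}"
| "fv1 (Neg \<phi>) = fv1 \<phi>"
| "fv1 (Conj \<phi> \<psi>) = fv1 \<phi> \<union> fv1 \<psi>"
| "fv1 (Disj \<phi> \<psi>) = fv1 \<phi> \<union> fv1 \<psi>"
| "fv1 (Ex1 x \<phi>) = fv1 \<phi> - {x}"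
| "fv1 (All1 x \<phi>) = fv1 \<phi> - {x}"
| "fv1 (Ex2 X \<phi>) = fv1 \<phi>"
| "fv1 (All2 X \<phi>) = fv1 \<phi>"

primrec fv2 :: "form \<Rightarrow> nat set" where
  "fv2 TT = {}"
| "fv2 FF = {}"
| "fv2 (Letter a x) = {}"
| "fv2 (Atom P xs) = {}"
| "fv2 (Mem x X) = {X}"
| "fv2 (Neg \<phi>) = fv2 \<phi>"
| "fv2 (Conj \<phi> \<psi>) = fv2 \<phi> \<union> fv2 \<psi>"
| "fv2 (Disj \<phi> \<psi>) = fv2 \<phi> \<union> fv2 \<psi>"
| "fv2 (Ex1 x \<phi>) = fv2 \<phi>"
| "fv2 (All1 x \<phi>) = fv2 \<phi>"
| "fv2 (Ex2 X \<phi>) = fv2 \<phi> - {X}"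
| "fv2 (All2 X \<phi>) = fv2 \<phi> - {X}"

definition closed_form :: "form \<Rightarrow> bool" where
  "closed_form \<phi> \<longleftrightarrow> fv1 \<phi> = {} \<and> fv2 \<phi> = {}"

primrec quantifier_free :: "form \<Rightarrow> bool" where
  "quantifier_free TT \<longleftrightarrow> True"
| "quantifier_free FF \<longleftrightarrow> True"
| "quantifier_free (Letter a x) \<longleftrightarrow> True"
| "quantifier_free (Atom P xs) \<longleftrightarrow> True"
| "quantifier_free (Mem x X) \<longleftrightarrow> True"
| "quantifier_free (Neg \<phi>) \<longleftrightarrow> quantifier_free \<phi>"
| "quantifier_free (Conj \<phi> \<psi>) \<longleftrightarrow> quantifier_free \<phi> \<and> quantifier_free \<psi>"
| "quantifier_free (Disj \<phi> \<psi>) \<longleftrightarrow> quantifier_free \<phi> \<and> quantifier_free \<psi>"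
| "quantifier_free (Ex1 x \<phi>) \<longleftrightarrow> False"
| "quantifier_free (All1 x \<phi>) \<longleftrightarrow> False"
| "quantifier_free (Ex2 X \<phi>) \<longleftrightarrow> False"
| "quantifier_free (All2 X \<phi>) \<longleftrightarrow> False"

text \<open>\<open>MSO \<sigma>\<close>: the formulas, not necessarily closed, over the signature \<open>\<sigma>\<close>.\<close>

primrec over_sig :: "predicate set \<Rightarrow> form \<Rightarrow> bool" where
  "over_sig \<sigma> TT \<longleftrightarrow> True"
| "over_sig \<sigma> FF \<longleftrightarrow> True"
| "over_sig \<sigma> (Letter a x) \<longleftrightarrow> True"
| "over_sig \<sigma> (Atom P xs) \<longleftrightarrow> P \<in> \<sigma> \<and> length xs = arity P"
| "over_sig \<sigma> (Mem x X) \<longleftrightarrow> True"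
| "over_sig \<sigma> (Neg \<phi>) \<longleftrightarrow> over_sig \<sigma> \<phi>"
| "over_sig \<sigma> (Conj \<phi> \<psi>) \<longleftrightarrow> over_sig \<sigma> \<phi> \<and> over_sig \<sigma> \<psi>"
| "over_sig \<sigma> (Disj \<phi> \<psi>) \<longleftrightarrow> over_sig \<sigma> \<phi> \<and> over_sig \<sigma> \<psi>"
| "over_sig \<sigma> (Ex1 x \<phi>) \<longleftrightarrow> over_sig \<sigma> \<phi>"
| "over_sig \<sigma> (All1 x \<phi>) \<longleftrightarrow> over_sig \<sigma> \<phi>"
| "over_sig \<sigma> (Ex2 X \<phi>) \<longleftrightarrow> over_sig \<sigma> \<phi>"
| "over_sig \<sigma> (All2 X \<phi>) \<longleftrightarrow> over_sig \<sigma> \<phi>"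

definition MSO :: "predicate set \<Rightarrow> form set" where
  "MSO \<sigma> = {\<phi>. over_sig \<sigma> \<phi>}"

text \<open>
  \<open>qf_subst \<tau> \<phi> \<phi>'\<close>: \<open>\<phi>'\<close> arises from \<open>\<phi>\<close> by replacing one occurrence of a quantifier-free subformula
  by a quantifier-free formula over \<open>\<tau>\<close> with the same free variables (of both kinds).
\<close>

inductive qf_subst :: "predicate set \<Rightarrow> form \<Rightarrow> form \<Rightarrow> bool" for \<tau> where
  here: "\<lbrakk>quantifier_free \<psi>; quantifier_free \<psi>'; \<psi>' \<in> MSO \<tau>; fv1 \<psi>' = fv1 \<psi>; fv2 \<psi>' = fv2 \<psi>\<rbrakk>
           \<Longrightarrow> qf_subst \<tau> \<psi> \<psi>'"
| neg: "qf_subst \<tau> \<phi> \<phi>' \<Longrightarrow> qf_subst \<tau> (Neg \<phi>) (Neg \<phi>')"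
| conj1: "qf_subst \<tau> \<phi> \<phi>' \<Longrightarrow> qf_subst \<tau> (Conj \<phi> \<chi>) (Conj \<phi>' \<chi>)"
| conj2: "qf_subst \<tau> \<phi> \<phi>' \<Longrightarrow> qf_subst \<tau> (Conj \<chi> \<phi>) (Conj \<chi> \<phi>')"
| disj1: "qf_subst \<tau> \<phi> \<phi>' \<Longrightarrow> qf_subst \<tau> (Disj \<phi> \<chi>) (Disj \<phi>' \<chi>)"
| disj2: "qf_subst \<tau> \<phi> \<phi>' \<Longrightarrow> qf_subst \<tau> (Disj \<chi> \<phi>) (Disj \<chi> \<phi>')"
| ex1: "qf_subst \<tau> \<phi> \<phi>' \<Longrightarrow> qf_subst \<tau> (Ex1 x \<phi>) (Ex1 x \<phi>')"
| all1: "qf_subst \<tau> \<phi> \<phi>' \<Longrightarrow> qf_subst \<tau> (All1 x \<phi>) (All1 x \<phi>')"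
| ex2: "qf_subst \<tau> \<phi> \<phi>' \<Longrightarrow> qf_subst \<tau> (Ex2 X \<phi>) (Ex2 X \<phi>')"
| all2: "qf_subst \<tau> \<phi> \<phi>' \<Longrightarrow> qf_subst \<tau> (All2 X \<phi>) (All2 X \<phi>')"

definition fragment :: "form set \<Rightarrow> predicate set \<Rightarrow> bool" where
  "fragment F \<sigma> \<longleftrightarrow>
     F \<subseteq> {\<phi> \<in> MSO \<sigma>. closed_form \<phi>} \<and>
     {\<phi> \<in> MSO \<sigma>. closed_form \<phi> \<and> quantifier_free \<phi>} \<subseteq> F \<and>
     (\<forall>\<phi>\<in>F. \<forall>\<psi>\<in>F. Conj \<phi> \<psi> \<in> F \<and> Disj \<phi> \<psi> \<in> F) \<and>
     (\<forall>\<phi>\<in>F. \<forall>\<phi>'. qf_subst \<sigma> \<phi> \<phi>' \<longrightarrow> \<phi>' \<in> F)"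

inductive_set qf_closure :: "form set \<Rightarrow> predicate set \<Rightarrow> form set" for F \<tau> where
  base: "\<phi> \<in> F \<Longrightarrow> \<phi> \<in> qf_closure F \<tau>"
| step: "\<lbrakk>\<phi> \<in> qf_closure F \<tau>; qf_subst \<tau> \<phi> \<phi>'\<rbrakk> \<Longrightarrow> \<phi>' \<in> qf_closure F \<tau>"

definition enrich :: "form set \<Rightarrow> predicate set \<Rightarrow> predicate set \<Rightarrow> form set" where
  "enrich F \<sigma> \<sigma>' = qf_closure F (\<sigma> \<union> \<sigma>')"

text \<open>The valuations are irrelevant for closed formulas. Letters outside \<open>A\<close> never hold.\<close>

definition form_lang :: "letter set \<Rightarrow> form \<Rightarrow> word set" where
  "form_lang A \<phi> = {w \<in> lists A. sat w (\<lambda>_. 0) (\<lambda>_. {}) \<phi>}"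

definition definable :: "form set \<Rightarrow> letter set \<Rightarrow> word set \<Rightarrow> bool" where
  "definable F A L \<longleftrightarrow> (\<exists>\<phi>\<in>F. L = form_lang A \<phi>)"


section \<open>Regular languages\<close>

text \<open>
  States are \<open>0, \<dots>, length (trans D) - 1\<close>; the entry at index \<open>j\<close> of the row of a state is its
  successor under the letter at index \<open>j\<close> of \<open>letters D\<close>.
\<close>

record dfa =
  letters :: "letter list"
  trans :: "nat list list"
  init :: nat
  finals :: "nat list"

definition wf_dfa :: "dfa \<Rightarrow> bool" where
  "wf_dfa D \<longleftrightarrow> distinct (letters D) \<and> init D < length (trans D) \<and>
     set (finals D) \<subseteq> {..<length (trans D)} \<and>
     (\<forall>row\<in>set (trans D). length row = length (letters D) \<and> set row \<subseteq> {..<length (trans D)})"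

definition dfa_step :: "dfa \<Rightarrow> nat \<Rightarrow> letter \<Rightarrow> nat" where
  "dfa_step D q a = the (map_of (zip (letters D) (trans D ! q)) a)"

definition dfa_lang :: "dfa \<Rightarrow> word set" where
  "dfa_lang D = {w \<in> lists (set (letters D)). foldl (dfa_step D) (init D) w \<in> set (finals D)}"

definition regular_lang :: "letter set \<Rightarrow> word set \<Rightarrow> bool" where
  "regular_lang A L \<longleftrightarrow> (\<exists>D. wf_dfa D \<and> set (letters D) = A \<and> dfa_lang D = L)"


section \<open>Decidability\<close>

text \<open>
  \<open>recursive n f\<close>: the restriction of \<open>f\<close> to lists of length \<open>n\<close> is a total recursive function of
  \<open>n\<close> arguments. These are exactly the total computable functions; minimization is applied only to
  functions for which it always succeeds.
\<close>

inductive recursive :: "nat \<Rightarrow> (nat list \<Rightarrow> nat) \<Rightarrow> bool" where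
  zero: "recursive n (\<lambda>xs. 0)"
| succ: "recursive 1 (\<lambda>xs. Suc (hd xs))"
| proj: "i < n \<Longrightarrow> recursive n (\<lambda>xs. xs ! i)"
| comp: "\<lbrakk>recursive (length gs) f; \<forall>g\<in>set gs. recursive n g\<rbrakk>
           \<Longrightarrow> recursive n (\<lambda>xs. f (map (\<lambda>g. g xs) gs))"
| prim: "\<lbrakk>recursive n f; recursive (Suc (Suc n)) g\<rbrakk>
           \<Longrightarrow> recursive (Suc n) (\<lambda>xs. rec_nat (f (tl xs)) (\<lambda>y r. g (y # r # tl xs)) (hd xs))"
| mu: "\<lbrakk>recursive (Suc n) f; \<forall>xs. length xs = n \<longrightarrow> (\<exists>y. f (y # xs) = 0)\<rbrakk>
           \<Longrightarrow> recursive n (\<lambda>xs. LEAST y. f (y # xs) = 0)"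
| ext: "\<lbrakk>recursive n f; \<forall>xs. length xs = n \<longrightarrow> g xs = f xs\<rbrakk> \<Longrightarrow> recursive n g"

definition dfa_code :: "dfa \<Rightarrow> nat" where
  "dfa_code D = list_encode [list_encode (letters D), list_encode (map list_encode (trans D)),
     init D, list_encode (finals D)]"

definition decidable_fragment :: "form set \<Rightarrow> bool" where
  "decidable_fragment F \<longleftrightarrow>
     (\<exists>f. recursive 1 f \<and>
       (\<forall>D. wf_dfa D \<longrightarrow>
          f [dfa_code D] = (if definable F (set (letters D)) (dfa_lang D) then 1 else 0)))"


section \<open>Varieties of monoids\<close>

definition monoid_homs :: "('a, 'm) monoid_scheme \<Rightarrow> ('b, 'n) monoid_scheme \<Rightarrow> ('a \<Rightarrow> 'b) set" where
  "monoid_homs M N = {h \<in> hom M N. h \<one>\<^bsub>M\<^esub> = \<one>\<^bsub>N\<^esub>}"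

definition divides :: "('b, 'n) monoid_scheme \<Rightarrow> ('a, 'm) monoid_scheme \<Rightarrow> bool" where
  "divides N M \<longleftrightarrow>
     (\<exists>S h. submonoid S M \<and> h \<in> monoid_homs (M\<lparr>carrier := S\<rparr>) N \<and> h ` S = carrier N)"

text \<open>
  A class of finite monoids is represented by its members whose elements are natural numbers;
  an arbitrary finite monoid belongs to the class if an isomorphic copy does.
\<close>

definition belongs :: "('a, 'm) monoid_scheme \<Rightarrow> nat monoid set \<Rightarrow> bool" where
  "belongs M V \<longleftrightarrow> (\<exists>N\<in>V. M \<cong> N)"

definition variety :: "nat monoid set \<Rightarrow> bool" where
  "variety V \<longleftrightarrow>
     V \<noteq> {} \<and> (\<forall>M\<in>V. monoid M \<and> finite (carrier M)) \<and>
     (\<forall>M\<in>V. \<forall>N :: nat monoid. monoid N \<and> divides N M \<longrightarrow> N \<in> V) \<and>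
     (\<forall>M\<in>V. \<forall>N\<in>V. belongs (M \<times>\<times> N) V)"

definition free_monoid :: "letter set \<Rightarrow> word monoid" where
  "free_monoid A = \<lparr>carrier = lists A, mult = (@), one = []\<rparr>"

definition recognizes :: "('a, 'm) monoid_scheme \<Rightarrow> letter set \<Rightarrow> word set \<Rightarrow> bool" where
  "recognizes M A L \<longleftrightarrow>
     (\<exists>h\<in>monoid_homs (free_monoid A) M. \<exists>P\<subseteq>carrier M. L = {w \<in> lists A. h w \<in> P})"

definition corresponds :: "form set \<Rightarrow> nat monoid set \<Rightarrow> bool" where
  "corresponds F V \<longleftrightarrow>
     (\<forall>A L. finite A \<and> L \<subseteq> lists A \<longrightarrow> (definable F A L \<longleftrightarrow> (\<exists>M\<in>V. recognizes M A L)))"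


section \<open>Syntactic morphism, stability index and stable semigroup\<close>

definition syn_cong :: "letter set \<Rightarrow> word set \<Rightarrow> (word \<times> word) set" where
  "syn_cong A L = {(u, v). u \<in> lists A \<and> v \<in> lists A \<and>
     (\<forall>x\<in>lists A. \<forall>y\<in>lists A. x @ u @ y \<in> L \<longleftrightarrow> x @ v @ y \<in> L)}"

definition syn_morphism :: "letter set \<Rightarrow> word set \<Rightarrow> word \<Rightarrow> word set" where
  "syn_morphism A L u = syn_cong A L `` {u}"

definition syn_monoid :: "letter set \<Rightarrow> word set \<Rightarrow> word set monoid" where
  "syn_monoid A L = \<lparr>carrier = lists A // syn_cong A L,
     mult = (\<lambda>X Y. \<Union>x\<in>X. \<Union>y\<in>Y. syn_morphism A L (x @ y)),
     one = syn_morphism A L []\<rparr>"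

definition words_of_length :: "letter set \<Rightarrow> nat \<Rightarrow> word set" where
  "words_of_length A n = {w \<in> lists A. length w = n}"

definition stability_index :: "letter set \<Rightarrow> (word \<Rightarrow> 'a) \<Rightarrow> nat" where
  "stability_index A \<phi> =
     (LEAST s. 0 < s \<and> \<phi> ` words_of_length A s = \<phi> ` words_of_length A (2 * s))"

definition stable_set :: "letter set \<Rightarrow> (word \<Rightarrow> 'a) \<Rightarrow> 'a set" where
  "stable_set A \<phi> = \<phi> ` words_of_length A (stability_index A \<phi>)"

text \<open>\<open>local_monoid M T e\<close> is \<open>eTe\<close> for a subsemigroup \<open>T\<close> of \<open>M\<close>; its identity is \<open>e\<close>.\<close>

definition local_monoid :: "('a, 'm) monoid_scheme \<Rightarrow> 'a set \<Rightarrow> 'a \<Rightarrow> 'a monoid" where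
  "local_monoid M T e = \<lparr>carrier = {e \<otimes>\<^bsub>M\<^esub> t \<otimes>\<^bsub>M\<^esub> e | t. t \<in> T}, mult = mult M, one = e\<rparr>"

definition lang_stability_index :: "letter set \<Rightarrow> word set \<Rightarrow> nat" where
  "lang_stability_index A L = stability_index A (syn_morphism A L)"

definition stable_local_monoids_in :: "letter set \<Rightarrow> word set \<Rightarrow> nat monoid set \<Rightarrow> bool" where
  "stable_local_monoids_in A L V \<longleftrightarrow>
     (let M = syn_monoid A L; T = stable_set A (syn_morphism A L)
      in \<forall>e\<in>T. e \<otimes>\<^bsub>M\<^esub> e = e \<longrightarrow> belongs (local_monoid M T e) V)"


section \<open>Finite categories and locality\<close>

text \<open>
  Composition is written in diagrammatic order: for \<open>f \<in> arr C x y\<close> and \<open>g \<in> arr C y z\<close>, the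
  arrow \<open>fg\<close> is \<open>compose C x y z f g\<close>. Hom-sets need not be disjoint.
\<close>

record ('o, 'a) cat =
  obj :: "'o set"
  arr :: "'o \<Rightarrow> 'o \<Rightarrow> 'a set"
  compose :: "'o \<Rightarrow> 'o \<Rightarrow> 'o \<Rightarrow> 'a \<Rightarrow> 'a \<Rightarrow> 'a"
  ident :: "'o \<Rightarrow> 'a"

definition finite_category :: "('o, 'a) cat \<Rightarrow> bool" where
  "finite_category C \<longleftrightarrow>
     finite (obj C) \<and> (\<forall>x\<in>obj C. \<forall>y\<in>obj C. finite (arr C x y)) \<and>
     (\<forall>x\<in>obj C. ident C x \<in> arr C x x) \<and>
     (\<forall>x\<in>obj C. \<forall>y\<in>obj C. \<forall>z\<in>obj C. \<forall>f\<in>arr C x y. \<forall>g\<in>arr C y z.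
        compose C x y z f g \<in> arr C x z) \<and>
     (\<forall>x\<in>obj C. \<forall>y\<in>obj C. \<forall>f\<in>arr C x y.
        compose C x x y (ident C x) f = f \<and> compose C x y y f (ident C y) = f) \<and>
     (\<forall>w\<in>obj C. \<forall>x\<in>obj C. \<forall>y\<in>obj C. \<forall>z\<in>obj C.
        \<forall>f\<in>arr C w x. \<forall>g\<in>arr C x y. \<forall>h\<in>arr C y z.
        compose C w y z (compose C w x y f g) h = compose C w x z f (compose C x y z g h))"

definition monoid_cat :: "('a, 'm) monoid_scheme \<Rightarrow> (unit, 'a) cat" where
  "monoid_cat M = \<lparr>obj = {()}, arr = (\<lambda>_ _. carrier M), compose = (\<lambda>_ _ _. mult M),
     ident = (\<lambda>_. one M)\<rparr>"

definition category_division ::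
  "('o \<Rightarrow> 'p) \<Rightarrow> ('o \<Rightarrow> 'o \<Rightarrow> 'a \<Rightarrow> 'b set) \<Rightarrow> ('o, 'a) cat \<Rightarrow> ('p, 'b) cat \<Rightarrow> bool" where
  "category_division t \<tau> C D \<longleftrightarrow>
     (\<forall>x\<in>obj C. t x \<in> obj D) \<and>
     (\<forall>x\<in>obj C. \<forall>y\<in>obj C. \<forall>f\<in>arr C x y. \<tau> x y f \<subseteq> arr D (t x) (t y) \<and> \<tau> x y f \<noteq> {}) \<and>
     (\<forall>x\<in>obj C. \<forall>y\<in>obj C. \<forall>z\<in>obj C. \<forall>f\<in>arr C x y. \<forall>g\<in>arr C y z.
        \<forall>f'\<in>\<tau> x y f. \<forall>g'\<in>\<tau> y z g.
        compose D (t x) (t y) (t z) f' g' \<in> \<tau> x z (compose C x y z f g)) \<and>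
     (\<forall>x\<in>obj C. ident D (t x) \<in> \<tau> x x (ident C x)) \<and>
     (\<forall>x\<in>obj C. \<forall>y\<in>obj C. \<forall>f\<in>arr C x y. \<forall>g\<in>arr C x y. f \<noteq> g \<longrightarrow> \<tau> x y f \<inter> \<tau> x y g = {})"

definition category_divides :: "('o, 'a) cat \<Rightarrow> ('p, 'b) cat \<Rightarrow> bool" where
  "category_divides C D \<longleftrightarrow> (\<exists>t \<tau>. category_division t \<tau> C D)"

definition cat_local_monoid :: "('o, 'a) cat \<Rightarrow> 'o \<Rightarrow> 'a monoid" where
  "cat_local_monoid C x = \<lparr>carrier = arr C x x, mult = compose C x x x, one = ident C x\<rparr>"

text \<open>
  As for monoids, classes of finite categories are represented by their members whose objects and
  arrows are natural numbers.
\<close>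

definition global_cats :: "nat monoid set \<Rightarrow> (nat, nat) cat set" where
  "global_cats V = {C. finite_category C \<and> (\<exists>M\<in>V. category_divides C (monoid_cat M))}"

definition locally_cats :: "nat monoid set \<Rightarrow> (nat, nat) cat set" where
  "locally_cats V = {C. finite_category C \<and> (\<forall>x\<in>obj C. belongs (cat_local_monoid C x) V)}"

definition local_variety :: "nat monoid set \<Rightarrow> bool" where
  "local_variety V \<longleftrightarrow> variety V \<and> global_cats V = locally_cats V"

end

theory Submission
  imports Defs
begin

text \<open>
  Label each position of a word by its window, that is by the next \<open>K\<close> letters, and by its residue
  modulo \<open>d\<close>. Words that agree on their first and last \<open>K\<close> letters and on their length modulo \<open>d\<close>
  satisfy a formula of the enrichment iff their window words satisfy a formula of \<open>F\<close>, and hence iff these lie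
  in a language recognized by a monoid of \<open>V\<close>.

  If \<open>u\<close> is a long word of length divisible by \<open>d\<close> whose image \<open>e\<close> is idempotent, then the windows
  of the blocks of a word \<open>u x\<^sub>1 u x\<^sub>2 \<dots> u\<close> do not interact. So the products in \<open>eTe\<close> are tested by
  languages recognized by monoids of \<open>V\<close>, and \<open>eTe\<close> belongs to \<open>V\<close>.

  Conversely, the windows at the multiples of \<open>s\<close> determine a factorization of a word into
  consecutive arrows of the category of all \<open>eTf\<close> with idempotents \<open>e\<close> and \<open>f\<close>, which divides a
  monoid of \<open>V\<close> by locality.

  The same block languages give the decision procedure: the enrichment defines \<open>L\<close> iff \<open>F\<close>
  defines finitely many block languages, whose automata have the states of the given one.
\<close>

section \<open>Words and syntactic monoids\<close>

text \<open>Three obstacles shape the proof. A zero-ary predicate such as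
  \<open>Min_letter a k\<close> cannot be traded for a test on window letters, because substitution
  preserves free variables and a closed quantifier-free formula reads no position. It is frozen to a
  truth value instead, so each boundary (prefix, suffix, length modulo \<open>d\<close>) gets its
  own formula of \<open>F\<close>. Next, \<open>K\<close> and \<open>d\<close> come from a formula
  and are unrelated to the stability index; stability allows every word of length \<open>s\<close>
  to be exchanged for one of length \<open>d * s\<close> with the same image, and an idempotent is
  unchanged by powers. Finally, the cuts of a word at multiples of \<open>s\<close> do not sit at
  idempotents; the pigeonhole principle finds an idempotent fewer than |T| + 1 blocks further on,
  which fixes the window length. For decidability, \<open>V\<close> is not given effectively, so
  membership of eTe in \<open>V\<close> has to be phrased as questions about languages, answered by
  the procedure for \<open>F\<close>; a factorial that is stable for every automaton with the given
  number of states stands in for the stability index.\<close>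

lemma factorial_power_idempotent:
  fixes f :: "nat \<Rightarrow> 'a"
  assumes fin: "finite S" and card: "card S \<le> M" and M: "0 < M" and ran: "\<And>i. f i \<in> S"
    and shift: "\<And>i j k. f i = f j \<Longrightarrow> f (i + k) = f (j + k)"
  shows "f (fact M) = f (2 * fact M)"
proof -
  have "\<not> inj_on f {..M}"
  proof
    assume inj: "inj_on f {..M}"
    have "card {..M} \<le> card S"
      by (rule card_inj_on_le[OF inj _ fin]) (use ran in auto)
    then show False using card by simp
  qed
  then obtain i j where ij: "i < j" "j \<le> M" "f i = f j"
    unfolding inj_on_def by (metis atMost_iff nat_neq_iff)
  define p where "p = j - i"
  have p: "0 < p" "p \<le> M" using ij unfolding p_def by auto
  have step: "f (i + k) = f (i + k + p * l)" for k l
  proof (induction l)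
    case (Suc l)
    have "f (i + k + p * l) = f (j + (k + p * l))"
      using shift[OF ij(3), of "k + p * l"] by (simp add: ac_simps)
    also have "j + (k + p * l) = i + k + p * Suc l"
      using ij unfolding p_def by simp
    finally show ?case using Suc by simp
  qed simp
  \<comment> \<open>\<open>M!\<close> is a multiple of every possible period \<open>p\<close> \<le>
    \<open>M\<close> and at least every possible preperiod, so one exponent serves all such
    sequences.\<close>
  have "p dvd (fact M :: nat)" using p by (simp add: dvd_fact)
  then obtain l where l: "(fact M :: nat) = p * l" by blast
  have "i \<le> fact M" using ij fact_ge_self[of M] by linarith
  then have "f (fact M) = f (i + (fact M - i) + p * l)"
    using step[of "fact M - i" l] by simp
  then show ?thesis using \<open>i \<le> fact M\<close> l by (simp add: mult_2)
qed

lemma words_of_length_add: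
  "words_of_length A (i + j) = {u @ v | u v. u \<in> words_of_length A i \<and> v \<in> words_of_length A j}"
proof (intro equalityI subsetI)
  fix w assume w: "w \<in> words_of_length A (i + j)"
  then have "w = take i w @ drop i w" "take i w \<in> words_of_length A i" "drop i w \<in> words_of_length A j"
    unfolding words_of_length_def by (auto simp: in_lists_conv_set dest: in_set_takeD in_set_dropD)
  then show "w \<in> {u @ v | u v. u \<in> words_of_length A i \<and> v \<in> words_of_length A j}" by blast
qed (auto simp: words_of_length_def)

lemma in_words_of_length: "w \<in> words_of_length A n \<longleftrightarrow> w \<in> lists A \<and> length w = n"
  by (simp add: words_of_length_def)

text \<open>Only the kernel of a morphism onto a finite monoid matters here, so no multiplication on
  the values is demanded. The instances are \<open>syn_morphism\<close> and the transition map of an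
  automaton.\<close>

locale word_quotient =
  fixes A :: "letter set" and f :: "word \<Rightarrow> 'a"
  assumes finite_image: "finite (f ` lists A)"
    and append_cong: "\<lbrakk>u \<in> lists A; u' \<in> lists A; v \<in> lists A; v' \<in> lists A; f u = f u'; f v = f v'\<rbrakk>
      \<Longrightarrow> f (u @ v) = f (u' @ v')"
begin

lemma image_words_add:
  assumes "f ` words_of_length A i = f ` words_of_length A j"
  shows "f ` words_of_length A (i + k) = f ` words_of_length A (j + k)"
proof -
  have *: "f ` words_of_length A (i + k) \<subseteq> f ` words_of_length A (j + k)"
    if eq: "f ` words_of_length A i = f ` words_of_length A j" for i j
  proof
    fix x assume "x \<in> f ` words_of_length A (i + k)"
    then obtain u v where uv: "x = f (u @ v)" "u \<in> words_of_length A i" "v \<in> words_of_length A k"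
      unfolding words_of_length_add by blast
    obtain u' where u': "u' \<in> words_of_length A j" "f u = f u'"
      using uv eq by blast
    have "x = f (u' @ v)"
      using uv u' append_cong[of u u' v v] by (auto simp: in_words_of_length)
    then show "x \<in> f ` words_of_length A (j + k)"
      using uv u' unfolding words_of_length_add by blast
  qed
  show ?thesis using *[OF assms] *[OF assms[symmetric]] by blast
qed

text \<open>The images of the sets of words of length \<open>i\<close> are members of the power set
  of the quotient, which has at most \<open>2 ^ m\<close> elements, and their equality propagates by
  \<open>image_words_add\<close>. The exponent depends on the bound \<open>m\<close> alone, so it
  can be computed from the number of states.\<close>

lemma stable_fact:
  assumes "card (f ` lists A) \<le> m"
  shows "f ` words_of_length A (fact (2 ^ m)) = f ` words_of_length A (2 * fact (2 ^ m))"
proof (rule factorial_power_idempotent[where S = "Pow (f ` lists A)"])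
  show "card (Pow (f ` lists A)) \<le> 2 ^ m"
    using assms finite_image by (simp add: card_Pow)
  show "f ` words_of_length A i \<in> Pow (f ` lists A)" for i
    by (auto simp: words_of_length_def)
  show "f ` words_of_length A (i + k) = f ` words_of_length A (j + k)"
    if "f ` words_of_length A i = f ` words_of_length A j" for i j k
    by (rule image_words_add[OF that])
qed (use finite_image in auto)

lemma stable_multiple:
  assumes st: "f ` words_of_length A N = f ` words_of_length A (2 * N)" and k: "0 < k"
  shows "f ` words_of_length A (k * N) = f ` words_of_length A N"
  using k
proof (induction k rule: nat_induct_non_zero)
  case (Suc k)
  have "f ` words_of_length A (Suc k * N) = f ` words_of_length A (k * N + N)"
    by (simp add: add.commute)
  also have "\<dots> = f ` words_of_length A (N + N)"
    by (rule image_words_add[OF Suc.IH])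
  finally show ?case using st by (simp add: mult_2)
qed simp

text \<open>Words of lengths \<open>2 * N + r\<close> and \<open>N + r\<close> have the same images,
  so a long word can be exchanged for one with \<open>N\<close> letters fewer. This bounds the
  contexts that the decision procedure must try.\<close>

lemma short_representative:
  assumes st: "f ` words_of_length A N = f ` words_of_length A (2 * N)" and N: "0 < N"
    and w: "w \<in> lists A"
  shows "\<exists>v\<in>lists A. length v < 2 * N \<and> f v = f w"
  using w
proof (induction "length w" arbitrary: w rule: less_induct)
  case less
  show ?case
  proof (cases "length w < 2 * N")
    case False
    then have "f w \<in> f ` words_of_length A (2 * N + (length w - 2 * N))"
      using less.prems by (auto simp: words_of_length_def)
    then have "f w \<in> f ` words_of_length A (N + (length w - 2 * N))"
      using image_words_add[OF st, of "length w - 2 * N"] by simp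
    then obtain v where v: "v \<in> lists A" "length v = N + (length w - 2 * N)" "f v = f w"
      by (force simp: in_words_of_length)
    then have "length v < length w" using False N by simp
    then show ?thesis using less.hyps[of v] v by auto
  qed (use less.prems in auto)
qed

lemma power_cong:
  assumes u: "u \<in> lists A" and idem: "f (u @ u) = f u" and k: "0 < k"
  shows "f (concat (replicate k u)) = f u"
  using k
proof (induction k rule: nat_induct_non_zero)
  case (Suc k)
  have "f (u @ concat (replicate k u)) = f (u @ u)"
    by (rule append_cong) (use u Suc in \<open>auto simp: in_lists_conv_set\<close>)
  then show ?case using idem by simp
qed simp

lemma idempotent_power:
  assumes u: "u \<in> lists A"
  shows "\<exists>k>0. f (concat (replicate k u)) = f (concat (replicate k u) @ concat (replicate k u))"
proof -
  let ?g = "\<lambda>i. f (concat (replicate i u))" and ?m = "Suc (card (f ` lists A))"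
  have l: "concat (replicate i u) \<in> lists A" for i using u by (auto simp: in_lists_conv_set)
  have "?g (fact ?m) = ?g (2 * fact ?m)"
  proof (rule factorial_power_idempotent[OF finite_image])
    show "?g (i + k) = ?g (j + k)" if "?g i = ?g j" for i j k
      using append_cong[OF l l l l that refl, of k] by (simp add: replicate_add)
  qed (use l in auto)
  then show ?thesis
    by (intro exI[of _ "fact ?m"]) (simp only: mult_2 replicate_add concat_append fact_gt_zero simp_thms)
qed

end

section \<open>The quotient of words by equality in all contexts of the language\<close>

lemma syn_morphism_eq_iff:
  assumes "u \<in> lists A" "v \<in> lists A"
  shows "syn_morphism A L u = syn_morphism A L v \<longleftrightarrow>
    (\<forall>x\<in>lists A. \<forall>y\<in>lists A. x @ u @ y \<in> L \<longleftrightarrow> x @ v @ y \<in> L)" (is "_ = ?R")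
proof
  assume "syn_morphism A L u = syn_morphism A L v"
  moreover have "v \<in> syn_morphism A L v" using assms by (auto simp: syn_morphism_def syn_cong_def)
  ultimately have "v \<in> syn_morphism A L u" by simp
  then show ?R by (simp add: syn_morphism_def syn_cong_def)
next
  assume ?R
  then show "syn_morphism A L u = syn_morphism A L v"
    using assms unfolding syn_morphism_def syn_cong_def by auto
qed

lemma syn_morphism_append_cong:
  assumes "u \<in> lists A" "u' \<in> lists A" "v \<in> lists A" "v' \<in> lists A"
    and "syn_morphism A L u = syn_morphism A L u'" "syn_morphism A L v = syn_morphism A L v'"
  shows "syn_morphism A L (u @ v) = syn_morphism A L (u' @ v')"
proof -
  have "x @ (u @ v) @ y \<in> L \<longleftrightarrow> x @ (u' @ v') @ y \<in> L" if xy: "x \<in> lists A" "y \<in> lists A" for x y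
  proof -
    have "x @ u @ (v @ y) \<in> L \<longleftrightarrow> x @ u' @ (v @ y) \<in> L"
      using assms(5) xy assms(1-4) by (subst (asm) syn_morphism_eq_iff) auto
    moreover have "(x @ u') @ v @ y \<in> L \<longleftrightarrow> (x @ u') @ v' @ y \<in> L"
      using assms(6) xy assms(1-4) append_in_lists_conv[of x u' A]
      by (subst (asm) syn_morphism_eq_iff) blast+
    ultimately show ?thesis by simp
  qed
  then show ?thesis using assms by (subst syn_morphism_eq_iff) auto
qed

lemma syn_carrier: "carrier (syn_monoid A L) = syn_morphism A L ` lists A"
  by (auto simp: syn_monoid_def syn_morphism_def quotient_def)

text \<open>The product of classes is a union over all pairs of representatives; congruence makes
  all its terms the same class, and classes of words over \<open>A\<close> are nonempty.\<close>

lemma syn_mult: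
  assumes "u \<in> lists A" "v \<in> lists A"
  shows "syn_morphism A L u \<otimes>\<^bsub>syn_monoid A L\<^esub> syn_morphism A L v = syn_morphism A L (u @ v)"
proof -
  have mem: "x \<in> lists A \<and> syn_morphism A L x = syn_morphism A L w"
    if "x \<in> syn_morphism A L w" "w \<in> lists A" for x w
    using that syn_morphism_eq_iff[of x A w L] by (auto simp: syn_morphism_def syn_cong_def)
  have "syn_morphism A L (x @ y) = syn_morphism A L (u @ v)"
    if "x \<in> syn_morphism A L u" "y \<in> syn_morphism A L v" for x y
    using mem[OF that(1) assms(1)] mem[OF that(2) assms(2)] assms by (intro syn_morphism_append_cong) auto
  then have "(\<Union>x\<in>syn_morphism A L u. \<Union>y\<in>syn_morphism A L v. syn_morphism A L (x @ y)) =
      (\<Union>x\<in>syn_morphism A L u. \<Union>y\<in>syn_morphism A L v. syn_morphism A L (u @ v))"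
    by (intro SUP_cong refl)
  moreover have "u \<in> syn_morphism A L u" "v \<in> syn_morphism A L v"
    using assms by (auto simp: syn_morphism_def syn_cong_def)
  then have "(\<Union>x\<in>syn_morphism A L u. \<Union>y\<in>syn_morphism A L v. syn_morphism A L (u @ v)) =
      syn_morphism A L (u @ v)"
    by blast
  ultimately show ?thesis by (simp add: syn_monoid_def)
qed

lemma syn_one: "\<one>\<^bsub>syn_monoid A L\<^esub> = syn_morphism A L []"
  by (simp add: syn_monoid_def)

lemma syn_monoid_monoid: "monoid (syn_monoid A L)"
proof (rule monoidI)
  fix x y z
  assume "x \<in> carrier (syn_monoid A L)" "y \<in> carrier (syn_monoid A L)" "z \<in> carrier (syn_monoid A L)"
  then obtain u v w where "u \<in> lists A" "v \<in> lists A" "w \<in> lists A"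
    "x = syn_morphism A L u" "y = syn_morphism A L v" "z = syn_morphism A L w"
    unfolding syn_carrier by blast
  then show "x \<otimes>\<^bsub>syn_monoid A L\<^esub> y \<otimes>\<^bsub>syn_monoid A L\<^esub> z = x \<otimes>\<^bsub>syn_monoid A L\<^esub> (y \<otimes>\<^bsub>syn_monoid A L\<^esub> z)"
    by (simp add: syn_mult)
next
  fix x y assume "x \<in> carrier (syn_monoid A L)" "y \<in> carrier (syn_monoid A L)"
  then obtain u v where "u \<in> lists A" "v \<in> lists A" "x = syn_morphism A L u" "y = syn_morphism A L v"
    unfolding syn_carrier by blast
  then show "x \<otimes>\<^bsub>syn_monoid A L\<^esub> y \<in> carrier (syn_monoid A L)"
    unfolding syn_carrier by (simp add: syn_mult)
next
  fix x assume "x \<in> carrier (syn_monoid A L)"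
  then obtain u where "u \<in> lists A" "x = syn_morphism A L u" unfolding syn_carrier by blast
  then show "\<one>\<^bsub>syn_monoid A L\<^esub> \<otimes>\<^bsub>syn_monoid A L\<^esub> x = x" "x \<otimes>\<^bsub>syn_monoid A L\<^esub> \<one>\<^bsub>syn_monoid A L\<^esub> = x"
    by (simp_all add: syn_mult syn_one)
qed (simp add: syn_carrier syn_one)

section \<open>Transition maps of automata\<close>

text \<open>Restricting to the states makes equality of functions mean equality on states, and puts
  all transitions into a finite extensional function space.\<close>

definition transition :: "dfa \<Rightarrow> word \<Rightarrow> nat \<Rightarrow> nat" where
  "transition D w = (\<lambda>q\<in>{..<length (trans D)}. foldl (dfa_step D) q w)"

lemma dfa_step_lt:
  assumes "wf_dfa D" "q < length (trans D)" "a \<in> set (letters D)"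
  shows "dfa_step D q a < length (trans D)"
proof -
  have row: "length (trans D ! q) = length (letters D)" "set (trans D ! q) \<subseteq> {..<length (trans D)}"
    using assms nth_mem[of q "trans D"] unfolding wf_dfa_def by auto
  then obtain b where b: "map_of (zip (letters D) (trans D ! q)) a = Some b"
    using assms(3) by (metis map_of_zip_is_Some)
  then have "b \<in> set (trans D ! q)" by (metis map_of_SomeD set_zip_rightD)
  then show ?thesis using b row unfolding dfa_step_def by auto
qed

lemma run_lt:
  assumes "wf_dfa D" "w \<in> lists (set (letters D))" "q < length (trans D)"
  shows "foldl (dfa_step D) q w < length (trans D)"
  using assms(2,3)
proof (induction w arbitrary: q)
  case (Cons a w)
  then show ?case using dfa_step_lt[OF assms(1)] by simp
qed simp

lemma transition_eq_iff:
  "transition D u = transition D v \<longleftrightarrow>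
     (\<forall>q<length (trans D). foldl (dfa_step D) q u = foldl (dfa_step D) q v)"
  unfolding transition_def restrict_def by (auto simp: fun_eq_iff)

lemma transition_in:
  assumes "wf_dfa D"
  shows "transition D ` lists (set (letters D)) \<subseteq>
    {..<length (trans D)} \<rightarrow>\<^sub>E {..<length (trans D)}"
proof (rule image_subsetI)
  fix w assume "w \<in> lists (set (letters D))"
  then show "transition D w \<in> {..<length (trans D)} \<rightarrow>\<^sub>E {..<length (trans D)}"
    unfolding transition_def using run_lt[OF assms] by (simp add: restrict_PiE_iff)
qed

lemma transition_word_quotient:
  assumes "wf_dfa D"
  shows "word_quotient (set (letters D)) (transition D)"
proof
  show "finite (transition D ` lists (set (letters D)))"
    by (rule finite_subset[OF transition_in[OF assms]]) (simp add: finite_PiE)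
  fix u u' v v'
  assume "u \<in> lists (set (letters D))" "u' \<in> lists (set (letters D))"
    "transition D u = transition D u'" "transition D v = transition D v'"
  then show "transition D (u @ v) = transition D (u' @ v')"
    using run_lt[OF assms] by (simp add: transition_eq_iff)
qed

lemma card_transitions:
  assumes "wf_dfa D"
  shows "card (transition D ` lists (set (letters D))) \<le> length (trans D) ^ length (trans D)"
proof -
  have "card (transition D ` lists (set (letters D))) \<le>
      card ({..<length (trans D)} \<rightarrow>\<^sub>E {..<length (trans D)})"
    by (rule card_mono[OF _ transition_in[OF assms]]) (simp add: finite_PiE)
  then show ?thesis by (simp add: card_PiE)
qed

lemma transition_eq_imp_syn_eq:
  assumes "wf_dfa D" "u \<in> lists (set (letters D))" "v \<in> lists (set (letters D))"
    and "transition D u = transition D v"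
  shows "syn_morphism (set (letters D)) (dfa_lang D) u = syn_morphism (set (letters D)) (dfa_lang D) v"
proof -
  have "x @ u @ y \<in> dfa_lang D \<longleftrightarrow> x @ v @ y \<in> dfa_lang D"
    if "x \<in> lists (set (letters D))" "y \<in> lists (set (letters D))" for x y
  proof -
    have "foldl (dfa_step D) (init D) x < length (trans D)"
      using run_lt[OF assms(1) that(1)] assms(1) by (simp add: wf_dfa_def)
    then show ?thesis using assms that by (auto simp: dfa_lang_def transition_eq_iff)
  qed
  then show ?thesis by (subst syn_morphism_eq_iff[OF assms(2,3)]) auto
qed

lemma finite_image_coarser:
  assumes "finite (g ` X)" and "\<And>u v. \<lbrakk>u \<in> X; v \<in> X; g u = g v\<rbrakk> \<Longrightarrow> f u = f v"
  shows "finite (f ` X)"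
proof -
  have "f ` X \<subseteq> (\<lambda>t. f (inv_into X g t)) ` (g ` X)"
  proof (rule image_subsetI)
    fix u assume u: "u \<in> X"
    have "f u = f (inv_into X g (g u))"
      by (rule assms(2)[OF u inv_into_into]) (use u in \<open>auto simp: f_inv_into_f\<close>)
    then show "f u \<in> (\<lambda>t. f (inv_into X g t)) ` (g ` X)" using u by blast
  qed
  then show ?thesis using assms(1) finite_subset by blast
qed

lemma syn_word_quotient:
  assumes "regular_lang A L"
  shows "word_quotient A (syn_morphism A L)"
proof (rule word_quotient.intro)
  obtain D where D: "wf_dfa D" "set (letters D) = A" "dfa_lang D = L"
    using assms unfolding regular_lang_def by (elim exE conjE)
  have "finite (transition D ` lists A)"
    using word_quotient.finite_image[OF transition_word_quotient[OF D(1)]] unfolding D(2) .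
  then show "finite (syn_morphism A L ` lists A)"
    by (rule finite_image_coarser) (use transition_eq_imp_syn_eq[OF D(1)] in \<open>unfold D(2,3)\<close>)
qed (rule syn_morphism_append_cong)

lemma regular_lang_subset: "regular_lang A L \<Longrightarrow> L \<subseteq> lists A"
  by (auto simp: regular_lang_def dfa_lang_def)

lemma regular_lang_finite: "regular_lang A L \<Longrightarrow> finite A"
  by (auto simp: regular_lang_def)

context word_quotient
begin

lemma stability_index:
  shows "0 < stability_index A f"
    and "f ` words_of_length A (stability_index A f) = f ` words_of_length A (2 * stability_index A f)"
proof -
  let ?P = "\<lambda>s. 0 < s \<and> f ` words_of_length A s = f ` words_of_length A (2 * s)"
  have "?P (fact (2 ^ card (f ` lists A)))" using stable_fact[OF order_refl] by simp
  then have "?P (stability_index A f)" unfolding stability_index_def by (rule LeastI)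
  then show "0 < stability_index A f"
    "f ` words_of_length A (stability_index A f) = f ` words_of_length A (2 * stability_index A f)" by auto
qed

text \<open>For the stability index \<open>s\<close>, words of length \<open>N * s\<close> have the
  same images as those of length \<open>N\<close> and as those of length \<open>s\<close>. Hence the
  stable semigroup can be computed from any stable exponent.\<close>

lemma stable_set_eq:
  assumes "0 < N" "f ` words_of_length A N = f ` words_of_length A (2 * N)"
  shows "stable_set A f = f ` words_of_length A N"
  using stable_multiple[OF assms(2), of "stability_index A f"] stability_index(1)
    stable_multiple[OF stability_index(2), of N] assms(1)
  unfolding stable_set_def by (simp add: mult.commute)

end

section \<open>Recognition by varieties\<close>

declare in_listsD [rule del] in_listsI [rule del]

lemma free_monoid_simps [simp]:
  "carrier (free_monoid A) = lists A" "x \<otimes>\<^bsub>free_monoid A\<^esub> y = x @ y" "\<one>\<^bsub>free_monoid A\<^esub> = []"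
  by (simp_all add: free_monoid_def)

lemma free_homD:
  assumes "h \<in> monoid_homs (free_monoid A) M"
  shows "h [] = \<one>\<^bsub>M\<^esub>" and "u \<in> lists A \<Longrightarrow> h u \<in> carrier M"
    and "\<lbrakk>u \<in> lists A; v \<in> lists A\<rbrakk> \<Longrightarrow> h (u @ v) = h u \<otimes>\<^bsub>M\<^esub> h v"
  using assms by (auto simp: monoid_homs_def hom_def)

lemma free_homI:
  assumes "h [] = \<one>\<^bsub>M\<^esub>" and "\<And>u. u \<in> lists A \<Longrightarrow> h u \<in> carrier M"
    and "\<And>u v. \<lbrakk>u \<in> lists A; v \<in> lists A\<rbrakk> \<Longrightarrow> h (u @ v) = h u \<otimes>\<^bsub>M\<^esub> h v"
  shows "h \<in> monoid_homs (free_monoid A) M"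
  using assms by (auto simp: monoid_homs_def hom_def)

lemma free_hom_comp:
  assumes "g \<in> monoid_homs (free_monoid A) M" and "f [] = []"
    and "\<And>u. u \<in> lists C \<Longrightarrow> f u \<in> lists A"
    and "\<And>u v. \<lbrakk>u \<in> lists C; v \<in> lists C\<rbrakk> \<Longrightarrow> f (u @ v) = f u @ f v"
  shows "g \<circ> f \<in> monoid_homs (free_monoid C) M"
  using free_homD[OF assms(1)] assms(2-4) by (intro free_homI) auto

lemma free_hom_exists:
  assumes "monoid M" and "\<And>a. a \<in> C \<Longrightarrow> f a \<in> carrier M"
  shows "(\<lambda>u. foldr (\<lambda>a m. f a \<otimes>\<^bsub>M\<^esub> m) u \<one>\<^bsub>M\<^esub>) \<in> monoid_homs (free_monoid C) M" (is "?h \<in> _")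
proof (rule free_homI)
  interpret monoid M by fact
  show cl: "?h u \<in> carrier M" if "u \<in> lists C" for u
    using that by (induction u) (auto simp: assms(2))
  show "?h (u @ v) = ?h u \<otimes>\<^bsub>M\<^esub> ?h v" if "u \<in> lists C" "v \<in> lists C" for u v
    using that(1) by (induction u) (use cl that(2) assms(2) in \<open>auto simp: m_assoc\<close>)
qed simp

lemma iso_monoidD:
  assumes "monoid S" "monoid N" and iso: "enc \<in> iso S N"
  shows "\<And>x. x \<in> carrier S \<Longrightarrow> enc x \<in> carrier N"
    and "inj_on enc (carrier S)"
    and "enc ` carrier S = carrier N"
    and "\<And>x y. \<lbrakk>x \<in> carrier S; y \<in> carrier S\<rbrakk> \<Longrightarrow> enc (x \<otimes>\<^bsub>S\<^esub> y) = enc x \<otimes>\<^bsub>N\<^esub> enc y"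
    and "enc \<one>\<^bsub>S\<^esub> = \<one>\<^bsub>N\<^esub>"
proof -
  interpret S: monoid S by fact
  interpret N: monoid N by fact
  show hom: "\<And>x. x \<in> carrier S \<Longrightarrow> enc x \<in> carrier N"
    "\<And>x y. \<lbrakk>x \<in> carrier S; y \<in> carrier S\<rbrakk> \<Longrightarrow> enc (x \<otimes>\<^bsub>S\<^esub> y) = enc x \<otimes>\<^bsub>N\<^esub> enc y"
    using iso by (auto simp: iso_def hom_def)
  show "inj_on enc (carrier S)" and onto: "enc ` carrier S = carrier N"
    using iso by (auto simp: iso_def bij_betw_def)
  obtain e where e: "e \<in> carrier S" "enc e = \<one>\<^bsub>N\<^esub>" using onto N.one_closed by (metis imageE)
  have "enc \<one>\<^bsub>S\<^esub> = enc \<one>\<^bsub>S\<^esub> \<otimes>\<^bsub>N\<^esub> enc e" using e hom(1) by simp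
  also have "\<dots> = enc e" using hom(2)[OF S.one_closed e(1)] e by simp
  finally show "enc \<one>\<^bsub>S\<^esub> = \<one>\<^bsub>N\<^esub>" using e by simp
qed

lemma nat_copy_exists:
  fixes S :: "('a, 'm) monoid_scheme"
  assumes "monoid S" "finite (carrier S)"
  shows "\<exists>(N :: nat monoid) enc. monoid N \<and> enc \<in> iso S N"
proof -
  interpret S: monoid S by fact
  obtain enc :: "'a \<Rightarrow> nat" where enc: "inj_on enc (carrier S)"
    using finite_imp_inj_to_nat_seg[OF assms(2)] by blast
  let ?dec = "inv_into (carrier S) enc"
  define N :: "nat monoid" where
    "N = \<lparr>carrier = enc ` carrier S, mult = (\<lambda>x y. enc (?dec x \<otimes>\<^bsub>S\<^esub> ?dec y)), one = enc \<one>\<^bsub>S\<^esub>\<rparr>"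
  have dec: "?dec (enc x) = x" if "x \<in> carrier S" for x using enc that by simp
  have N: "carrier N = enc ` carrier S" "\<one>\<^bsub>N\<^esub> = enc \<one>\<^bsub>S\<^esub>"
    "\<And>x y. \<lbrakk>x \<in> carrier S; y \<in> carrier S\<rbrakk> \<Longrightarrow> enc (x \<otimes>\<^bsub>S\<^esub> y) = enc x \<otimes>\<^bsub>N\<^esub> enc y"
    unfolding N_def by (simp_all add: dec)
  have "monoid N"
    by (rule monoidI) (auto simp: N(1,2) N(3)[symmetric] S.m_assoc)
  moreover have "enc \<in> iso S N" using enc N by (auto simp: iso_def hom_def bij_betw_def)
  ultimately show ?thesis by blast
qed

lemma varietyD:
  assumes "variety V" "M \<in> V"
  shows "monoid M" "finite (carrier M)"
  using assms by (auto simp: variety_def)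

lemma belongsE:
  assumes "variety V" "belongs S V"
  obtains N enc where "N \<in> V" "monoid N" "enc \<in> iso S N"
  using assms varietyD unfolding belongs_def is_iso_def by blast

text \<open>The kernel condition lets \<open>g\<close> factor through \<open>h\<close>, so
  \<open>S\<close> is a quotient of the submonoid of \<open>M\<close> formed by the values of
  \<open>h\<close>, that is, \<open>S\<close> divides \<open>M\<close>.\<close>

lemma belongs_of_quotient:
  assumes V: "variety V" and S: "monoid S" "finite (carrier S)" and M: "M \<in> V"
    and h: "h \<in> monoid_homs (free_monoid C) M" and g: "g \<in> monoid_homs (free_monoid C) S"
    and onto: "g ` lists C = carrier S"
    and ker: "\<And>u v. \<lbrakk>u \<in> lists C; v \<in> lists C; h u = h v\<rbrakk> \<Longrightarrow> g u = g v"
  shows "belongs S V"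
proof -
  obtain N :: "nat monoid" and enc where N': "monoid N" "enc \<in> iso S N"
    using nat_copy_exists[OF S] by metis
  note N = N'(1) is_isoI[OF N'(2)] iso_monoidD(3,5,4)[OF S(1) N']
  \<comment> \<open>The induced map from values of \<open>h\<close> to values of \<open>g\<close>,
    computed on a chosen preimage; the kernel condition makes the choice immaterial.\<close>
  define r where "r m = enc (g (inv_into (lists C) h m))" for m
  have r: "r (h u) = enc (g u)" if "u \<in> lists C" for u
    unfolding r_def using ker[of "inv_into (lists C) h (h u)" u] that
    by (simp add: inv_into_into f_inv_into_f)
  have hM: "h ` lists C \<subseteq> carrier M" using free_homD(2)[OF h] by blast
  have "divides N M" unfolding divides_def
  proof (intro exI conjI)
    have mul: "h u \<otimes>\<^bsub>M\<^esub> h v \<in> h ` lists C" if "u \<in> lists C" "v \<in> lists C" for u v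
      using free_homD(3)[OF h that] that by (metis append_in_lists_conv imageI)
    show "submonoid (h ` lists C) M"
    proof
      show "\<one>\<^bsub>M\<^esub> \<in> h ` lists C" using free_homD(1)[OF h] by (metis imageI lists.Nil)
    qed (use hM mul in auto)
    show "r \<in> monoid_homs (M\<lparr>carrier := h ` lists C\<rparr>) N"
      unfolding monoid_homs_def hom_def
    proof (intro CollectI conjI ballI funcsetI)
      fix x assume "x \<in> carrier (M\<lparr>carrier := h ` lists C\<rparr>)"
      then obtain u where u: "u \<in> lists C" "x = h u" by auto
      then show "r x \<in> carrier N" using r N(3) free_homD(2)[OF g] by blast
      fix y assume "y \<in> carrier (M\<lparr>carrier := h ` lists C\<rparr>)"
      then obtain v where v: "v \<in> lists C" "y = h v" by auto
      have "x \<otimes>\<^bsub>M\<^esub> y = h (u @ v)" using free_homD(3)[OF h u(1) v(1)] u v by simp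
      then show "r (x \<otimes>\<^bsub>M\<lparr>carrier := h ` lists C\<rparr>\<^esub> y) = r x \<otimes>\<^bsub>N\<^esub> r y"
        using u v r[of "u @ v"] r[of u] r[of v] free_homD(2,3)[OF g] N(5)
        by simp
    next
      show "r \<one>\<^bsub>M\<lparr>carrier := h ` lists C\<rparr>\<^esub> = \<one>\<^bsub>N\<^esub>"
        using r[of "[]"] free_homD(1)[OF h] free_homD(1)[OF g] N(4) by simp
    qed
    show "r ` h ` lists C = carrier N"
      using r onto N(3) by (metis (no_types, lifting) image_cong image_image)
  qed
  then have "N \<in> V" using V M N(1) unfolding variety_def by blast
  then show ?thesis using N(2) unfolding belongs_def by blast
qed

definition var_recognizable :: "nat monoid set \<Rightarrow> letter set \<Rightarrow> word set \<Rightarrow> bool" where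
  "var_recognizable V C K \<longleftrightarrow> (\<exists>M\<in>V. recognizes M C K)"

text \<open>Being a preimage under \<open>h\<close> is the same as being saturated for the kernel of
  \<open>h\<close>: the image of the language serves as accepting set.\<close>

lemma recognizes_iff:
  assumes "monoid M"
  shows "recognizes M C {w \<in> lists C. P w} \<longleftrightarrow>
    (\<exists>h\<in>monoid_homs (free_monoid C) M. \<forall>u\<in>lists C. \<forall>v\<in>lists C. h u = h v \<longrightarrow> P u \<longrightarrow> P v)"
proof
  assume "recognizes M C {w \<in> lists C. P w}"
  then obtain h Q where h: "h \<in> monoid_homs (free_monoid C) M"
    and Q: "{w \<in> lists C. P w} = {w \<in> lists C. h w \<in> Q}"
    unfolding recognizes_def by blast
  have "P w \<longleftrightarrow> h w \<in> Q" if "w \<in> lists C" for w using Q that by blast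
  then show "\<exists>h\<in>monoid_homs (free_monoid C) M. \<forall>u\<in>lists C. \<forall>v\<in>lists C. h u = h v \<longrightarrow> P u \<longrightarrow> P v"
    using h by metis
next
  assume "\<exists>h\<in>monoid_homs (free_monoid C) M. \<forall>u\<in>lists C. \<forall>v\<in>lists C. h u = h v \<longrightarrow> P u \<longrightarrow> P v"
  then obtain h where h: "h \<in> monoid_homs (free_monoid C) M"
    and P: "\<And>u v. \<lbrakk>u \<in> lists C; v \<in> lists C; h u = h v; P u\<rbrakk> \<Longrightarrow> P v" by blast
  show "recognizes M C {w \<in> lists C. P w}" unfolding recognizes_def
  proof (intro bexI[OF _ h] exI conjI)
    show "h ` {w \<in> lists C. P w} \<subseteq> carrier M" using free_homD(2)[OF h] by blast
    show "{w \<in> lists C. P w} = {w \<in> lists C. h w \<in> h ` {w \<in> lists C. P w}}"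
    proof (rule Collect_cong, rule conj_cong[OF refl], rule iffI)
      fix w assume "w \<in> lists C" "h w \<in> h ` {w \<in> lists C. P w}"
      then obtain u where "u \<in> lists C" "P u" "h w = h u" by auto
      then show "P w" using P[of u w] \<open>w \<in> lists C\<close> by simp
    qed auto
  qed
qed

lemma var_recognizable_of_belongs:
  assumes V: "variety V" and S: "belongs S V" and g: "g \<in> monoid_homs (free_monoid C) S"
    and P: "\<And>u v. \<lbrakk>u \<in> lists C; v \<in> lists C; g u = g v; P u\<rbrakk> \<Longrightarrow> P v"
    and one: "monoid S"
  shows "var_recognizable V C {w \<in> lists C. P w}"
proof -
  obtain N enc where N: "N \<in> V" "monoid N" "enc \<in> iso S N"
    using belongsE[OF V S] .
  note enc = iso_monoidD[OF one N(2,3)]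
  have "enc \<circ> g \<in> monoid_homs (free_monoid C) N"
    using free_homD[OF g] enc by (intro free_homI) auto
  moreover have "g u = g v" if "u \<in> lists C" "v \<in> lists C" "(enc \<circ> g) u = (enc \<circ> g) v" for u v
    using inj_onD[OF enc(2), of "g u" "g v"] free_homD(2)[OF g] that by simp
  ultimately have "recognizes N C {w \<in> lists C. P w}"
    using P by (subst recognizes_iff[OF N(2)]) blast
  then show ?thesis using N(1) unfolding var_recognizable_def by blast
qed

text \<open>The product of two monoids of \<open>V\<close> carries both morphisms at once. As
  \<open>V\<close> contains the product only up to isomorphism, the pair of morphisms is transported
  to the copy \<open>Q\<close>. The empty family is served by a constant morphism, which exists
  because \<open>V\<close> is nonempty.\<close>

lemma joint_recognition:
  assumes V: "variety V" and "finite I"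
    and "\<And>i. i \<in> I \<Longrightarrow> \<exists>M\<in>V. \<exists>h\<in>monoid_homs (free_monoid C) M.
      \<forall>u\<in>lists C. \<forall>v\<in>lists C. h u = h v \<longrightarrow> R i u v"
  shows "\<exists>M\<in>V. \<exists>h\<in>monoid_homs (free_monoid C) M.
      \<forall>i\<in>I. \<forall>u\<in>lists C. \<forall>v\<in>lists C. h u = h v \<longrightarrow> R i u v"
  using assms(2,3)
proof (induction I)
  case empty
  obtain M where M: "M \<in> V" using V unfolding variety_def by blast
  then interpret monoid M using V unfolding variety_def by blast
  have "(\<lambda>_. \<one>\<^bsub>M\<^esub>) \<in> monoid_homs (free_monoid C) M" by (rule free_homI) auto
  then show ?case using M by blast
next
  case (insert i I)
  obtain M h where M: "M \<in> V" and h: "h \<in> monoid_homs (free_monoid C) M"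
    and hR: "\<forall>i\<in>I. \<forall>u\<in>lists C. \<forall>v\<in>lists C. h u = h v \<longrightarrow> R i u v"
    using insert.IH insert.prems by blast
  obtain N g where N: "N \<in> V" and g: "g \<in> monoid_homs (free_monoid C) N"
    and gR: "\<forall>u\<in>lists C. \<forall>v\<in>lists C. g u = g v \<longrightarrow> R i u v"
    using insert.prems by blast
  interpret M: monoid M using V M unfolding variety_def by blast
  interpret N: monoid N using V N unfolding variety_def by blast
  define k where "k u = (h u, g u)" for u
  have bel: "belongs (M \<times>\<times> N) V" using V M N unfolding variety_def by blast
  have k: "k \<in> monoid_homs (free_monoid C) (M \<times>\<times> N)"
    using free_homD[OF h] free_homD[OF g]
    by (intro free_homI) (simp_all add: k_def DirProd_def)
  have monP: "monoid (M \<times>\<times> N)" by (rule DirProd_monoid) unfold_locales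
  obtain Q \<phi> where Q: "Q \<in> V" "monoid Q" "\<phi> \<in> iso (M \<times>\<times> N) Q"
    using belongsE[OF V bel] .
  note \<phi> = iso_monoidD[OF monP Q(2,3)]
  have "\<phi> \<circ> k \<in> monoid_homs (free_monoid C) Q"
    using free_homD[OF k] \<phi> by (intro free_homI) (simp_all del: mult_DirProd)
  moreover have "h u = h v \<and> g u = g v"
    if "u \<in> lists C" "v \<in> lists C" "(\<phi> \<circ> k) u = (\<phi> \<circ> k) v" for u v
  proof -
    have "k u = k v" using inj_onD[OF \<phi>(2), of "k u" "k v"] free_homD(2)[OF k] that by auto
    then show ?thesis by (simp add: k_def)
  qed
  ultimately show ?case using hR gR Q(1) by blast
qed

section \<open>Quantifier-free substitutions and windows\<close>

text \<open>As chains of steps, substitutions carried out in different subformulas can be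
  concatenated under a connective.\<close>

lemma qf_closure_iff: "\<phi> \<in> qf_closure F \<tau> \<longleftrightarrow> (\<exists>\<psi>\<in>F. (qf_subst \<tau>)\<^sup>*\<^sup>* \<psi> \<phi>)"
proof
  assume "\<phi> \<in> qf_closure F \<tau>"
  then show "\<exists>\<psi>\<in>F. (qf_subst \<tau>)\<^sup>*\<^sup>* \<psi> \<phi>"
    by induction (blast intro: rtranclp.rtrancl_into_rtrancl)+
next
  assume "\<exists>\<psi>\<in>F. (qf_subst \<tau>)\<^sup>*\<^sup>* \<psi> \<phi>"
  then obtain \<psi> where "\<psi> \<in> F" "(qf_subst \<tau>)\<^sup>*\<^sup>* \<psi> \<phi>" by blast
  from this(2,1) show "\<phi> \<in> qf_closure F \<tau>"
    by (induction rule: rtranclp_induct) (auto intro: qf_closure.intros)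
qed

lemma rtranclp_cong:
  assumes "\<And>x y. R x y \<Longrightarrow> S (f x) (f y)" "R\<^sup>*\<^sup>* x y"
  shows "S\<^sup>*\<^sup>* (f x) (f y)"
  using assms(2) by (induction rule: rtranclp_induct) (auto intro: assms(1) rtranclp.rtrancl_into_rtrancl)

lemma qf_subst_rtranclp_cong:
  assumes "(qf_subst \<tau>)\<^sup>*\<^sup>* \<phi> \<phi>'"
  shows "(qf_subst \<tau>)\<^sup>*\<^sup>* (Neg \<phi>) (Neg \<phi>')"
    and "(qf_subst \<tau>)\<^sup>*\<^sup>* (Ex1 x \<phi>) (Ex1 x \<phi>')" and "(qf_subst \<tau>)\<^sup>*\<^sup>* (All1 x \<phi>) (All1 x \<phi>')"
    and "(qf_subst \<tau>)\<^sup>*\<^sup>* (Ex2 x \<phi>) (Ex2 x \<phi>')" and "(qf_subst \<tau>)\<^sup>*\<^sup>* (All2 x \<phi>) (All2 x \<phi>')"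
  by (rule rtranclp_cong[OF _ assms], erule qf_subst.intros)+

lemma qf_subst_rtranclp_cong2:
  assumes "(qf_subst \<tau>)\<^sup>*\<^sup>* \<phi> \<phi>'" "(qf_subst \<tau>)\<^sup>*\<^sup>* \<psi> \<psi>'"
  shows "(qf_subst \<tau>)\<^sup>*\<^sup>* (Conj \<phi> \<psi>) (Conj \<phi>' \<psi>')" and "(qf_subst \<tau>)\<^sup>*\<^sup>* (Disj \<phi> \<psi>) (Disj \<phi>' \<psi>')"
proof -
  show "(qf_subst \<tau>)\<^sup>*\<^sup>* (Conj \<phi> \<psi>) (Conj \<phi>' \<psi>')"
    using rtranclp_cong[of "qf_subst \<tau>" "qf_subst \<tau>" "\<lambda>\<phi>. Conj \<phi> \<psi>", OF conj1 assms(1)]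
      rtranclp_cong[of "qf_subst \<tau>" "qf_subst \<tau>" "Conj \<phi>'", OF conj2 assms(2)] by (rule rtranclp_trans)
  show "(qf_subst \<tau>)\<^sup>*\<^sup>* (Disj \<phi> \<psi>) (Disj \<phi>' \<psi>')"
    using rtranclp_cong[of "qf_subst \<tau>" "qf_subst \<tau>" "\<lambda>\<phi>. Disj \<phi> \<psi>", OF disj1 assms(1)]
      rtranclp_cong[of "qf_subst \<tau>" "qf_subst \<tau>" "Disj \<phi>'", OF disj2 assms(2)] by (rule rtranclp_trans)
qed

lemma over_sig_mono: "over_sig \<sigma> \<phi> \<Longrightarrow> \<sigma> \<subseteq> \<tau> \<Longrightarrow> over_sig \<tau> \<phi>"
  by (induction \<phi>) auto

lemma qf_subst_mono:
  assumes "\<sigma> \<subseteq> \<tau>" "qf_subst \<sigma> \<phi> \<phi>'"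
  shows "qf_subst \<tau> \<phi> \<phi>'"
  using assms(2)
proof induction
  case (here \<psi> \<psi>')
  then show ?case using over_sig_mono[OF _ assms(1)] by (intro qf_subst.here) (auto simp: MSO_def)
qed (auto intro: qf_subst.intros)

lemma enrich_mono:
  assumes "\<tau> \<subseteq> \<tau>'"
  shows "enrich F \<sigma> \<tau> \<subseteq> enrich F \<sigma> \<tau>'"
proof
  fix \<phi> assume "\<phi> \<in> enrich F \<sigma> \<tau>"
  then show "\<phi> \<in> enrich F \<sigma> \<tau>'" unfolding enrich_def
    by induction (use assms in \<open>auto intro: qf_closure.intros qf_subst_mono[rotated]\<close>)
qed

lemma qf_subst_over_sig: "qf_subst \<tau> \<phi> \<phi>' \<Longrightarrow> over_sig \<tau> \<phi> \<Longrightarrow> over_sig \<tau> \<phi>'"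
  by (induction rule: qf_subst.induct) (auto simp: MSO_def)

lemma qf_subst_fv: "qf_subst \<tau> \<phi> \<phi>' \<Longrightarrow> fv1 \<phi>' = fv1 \<phi> \<and> fv2 \<phi>' = fv2 \<phi>"
  by (induction rule: qf_subst.induct) auto

lemma qf_closure_over_sig: "\<phi> \<in> qf_closure F \<tau> \<Longrightarrow> F \<subseteq> MSO \<tau> \<Longrightarrow> over_sig \<tau> \<phi>"
  by (induction rule: qf_closure.induct) (auto intro: qf_subst_over_sig simp: MSO_def)

lemma qf_closure_closed: "\<phi> \<in> qf_closure F \<tau> \<Longrightarrow> \<forall>\<psi>\<in>F. closed_form \<psi> \<Longrightarrow> closed_form \<phi>"
  by (induction rule: qf_closure.induct) (auto simp: closed_form_def dest: qf_subst_fv)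

section \<open>Translation of atoms\<close>

primrec translate :: "(letter \<Rightarrow> nat \<Rightarrow> form) \<Rightarrow> (predicate \<Rightarrow> nat list \<Rightarrow> form) \<Rightarrow> form \<Rightarrow> form" where
  "translate lt at TT = TT"
| "translate lt at FF = FF"
| "translate lt at (Letter a x) = lt a x"
| "translate lt at (Atom P xs) = at P xs"
| "translate lt at (Mem x X) = Mem x X"
| "translate lt at (Neg \<phi>) = Neg (translate lt at \<phi>)"
| "translate lt at (Conj \<phi> \<psi>) = Conj (translate lt at \<phi>) (translate lt at \<psi>)"
| "translate lt at (Disj \<phi> \<psi>) = Disj (translate lt at \<phi>) (translate lt at \<psi>)"
| "translate lt at (Ex1 x \<phi>) = Ex1 x (translate lt at \<phi>)"
| "translate lt at (All1 x \<phi>) = All1 x (translate lt at \<phi>)"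
| "translate lt at (Ex2 X \<phi>) = Ex2 X (translate lt at \<phi>)"
| "translate lt at (All2 X \<phi>) = All2 X (translate lt at \<phi>)"

definition qf_over :: "predicate set \<Rightarrow> nat set \<Rightarrow> form \<Rightarrow> bool" where
  "qf_over \<sigma> X \<phi> \<longleftrightarrow> quantifier_free \<phi> \<and> over_sig \<sigma> \<phi> \<and> fv1 \<phi> = X \<and> fv2 \<phi> = {}"

text \<open>Free variables must be preserved exactly, not merely up to inclusion, since this is what
  \<open>qf_subst\<close> demands. The formulas \<open>letter_among\<close> and
  \<open>unwindow\<close> are padded for this purpose.\<close>

locale translation =
  fixes lt :: "letter \<Rightarrow> nat \<Rightarrow> form" and at :: "predicate \<Rightarrow> nat list \<Rightarrow> form"
    and \<sigma>1 \<sigma>2 :: "predicate set"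
  assumes lt: "qf_over \<sigma>2 {x} (lt a x)"
    and at: "\<lbrakk>P \<in> \<sigma>1; length xs = arity P\<rbrakk> \<Longrightarrow> qf_over \<sigma>2 (set xs) (at P xs)"
begin

abbreviation "tr \<equiv> translate lt at"

lemma translate_syntax:
  "over_sig \<sigma>1 \<phi> \<Longrightarrow> fv1 (tr \<phi>) = fv1 \<phi> \<and> fv2 (tr \<phi>) = fv2 \<phi> \<and> over_sig \<sigma>2 (tr \<phi>) \<and>
     (quantifier_free (tr \<phi>) \<longleftrightarrow> quantifier_free \<phi>)"
  by (induction \<phi>) (use lt at in \<open>auto simp: qf_over_def\<close>)

lemma translate_qf_subst:
  "qf_subst \<sigma>1 \<phi> \<phi>' \<Longrightarrow> over_sig \<sigma>1 \<phi> \<Longrightarrow> qf_subst \<sigma>2 (tr \<phi>) (tr \<phi>')"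
proof (induction rule: qf_subst.induct)
  case (here \<psi> \<psi>')
  then show ?case using translate_syntax[of \<psi>] translate_syntax[of \<psi>']
    by (intro qf_subst.here) (auto simp: MSO_def)
qed (auto intro: qf_subst.intros)

lemma translate_reachable: "over_sig \<sigma>1 \<phi> \<Longrightarrow> (qf_subst \<sigma>2)\<^sup>*\<^sup>* \<phi> (tr \<phi>)"
proof (induction \<phi>)
  case (Letter a x)
  show ?case using lt[of x a] by (intro r_into_rtranclp qf_subst.here) (auto simp: qf_over_def MSO_def)
next
  case (Atom P xs)
  then show ?case using at[of P xs] by (intro r_into_rtranclp qf_subst.here) (auto simp: qf_over_def MSO_def)
qed (auto intro: qf_subst_rtranclp_cong qf_subst_rtranclp_cong2)

text \<open>A formula of the closure need not lie in \<open>F\<close>, so its derivation is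
  translated instead: the formula of \<open>F\<close> at its origin reaches its own translation by
  replacing atoms one at a time, and every later step over \<open>\<sigma>1\<close> becomes a step
  over \<open>\<sigma>2\<close>.\<close>

lemma translate_qf_closure:
  assumes "F \<subseteq> MSO \<sigma>1" "\<phi> \<in> qf_closure F \<sigma>1"
  shows "tr \<phi> \<in> qf_closure F \<sigma>2"
  using assms(2)
proof induction
  case (base \<phi>)
  then have "over_sig \<sigma>1 \<phi>" using assms(1) by (auto simp: MSO_def)
  then show ?case using base translate_reachable unfolding qf_closure_iff by blast
next
  case (step \<phi> \<phi>')
  then show ?case using translate_qf_subst qf_closure_over_sig[OF _ assms(1)] by (blast intro: qf_closure.step)
qed

end

text \<open>Equal lengths give the quantifiers the same ranges, so only atoms at positions inside
  the word have to be compared. It is applied in both directions between words and their window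
  words.\<close>

lemma sat_translate:
  assumes len: "length w' = length w"
    and lt: "\<And>a x v S. v x < length w \<Longrightarrow> sat w' v S (lt a x) \<longleftrightarrow> w ! v x = a"
    and at: "\<And>P xs v S. \<lbrakk>P \<in> \<sigma>; length xs = arity P; \<forall>x\<in>set xs. v x < length w\<rbrakk> \<Longrightarrow>
      sat w' v S (at P xs) \<longleftrightarrow> pred_holds w P (map v xs)"
  shows "over_sig \<sigma> \<phi> \<Longrightarrow> \<forall>x\<in>fv1 \<phi>. v x < length w \<Longrightarrow>
    sat w' v S (translate lt at \<phi>) \<longleftrightarrow> sat w v S \<phi>"
proof (induction \<phi> arbitrary: v S)
  case (Ex1 x \<phi>)
  have "sat w' (v(x := p)) S (translate lt at \<phi>) \<longleftrightarrow> sat w (v(x := p)) S \<phi>" if "p < length w" for p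
    by (rule Ex1.IH) (use Ex1.prems that in auto)
  then show ?case using len by auto
next
  case (All1 x \<phi>)
  have "sat w' (v(x := p)) S (translate lt at \<phi>) \<longleftrightarrow> sat w (v(x := p)) S \<phi>" if "p < length w" for p
    by (rule All1.IH) (use All1.prems that in auto)
  then show ?case using len by auto
qed (auto simp: lt at len)

lemma fragmentD:
  assumes "fragment F \<sigma>"
  shows "\<phi> \<in> F \<Longrightarrow> over_sig \<sigma> \<phi>" "\<phi> \<in> F \<Longrightarrow> closed_form \<phi>" "F \<subseteq> MSO \<sigma>"
    and "\<lbrakk>\<phi> \<in> F; \<psi> \<in> F\<rbrakk> \<Longrightarrow> Conj \<phi> \<psi> \<in> F" "\<lbrakk>\<phi> \<in> F; \<psi> \<in> F\<rbrakk> \<Longrightarrow> Disj \<phi> \<psi> \<in> F"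
    and "TT \<in> F" "FF \<in> F" "qf_closure F \<sigma> = F"
proof -
  show "\<phi> \<in> F \<Longrightarrow> over_sig \<sigma> \<phi>" "\<phi> \<in> F \<Longrightarrow> closed_form \<phi>" "F \<subseteq> MSO \<sigma>"
    "\<lbrakk>\<phi> \<in> F; \<psi> \<in> F\<rbrakk> \<Longrightarrow> Conj \<phi> \<psi> \<in> F" "\<lbrakk>\<phi> \<in> F; \<psi> \<in> F\<rbrakk> \<Longrightarrow> Disj \<phi> \<psi> \<in> F"
    using assms unfolding fragment_def MSO_def by blast+
  have "TT \<in> {\<phi> \<in> MSO \<sigma>. closed_form \<phi> \<and> quantifier_free \<phi>}"
    "FF \<in> {\<phi> \<in> MSO \<sigma>. closed_form \<phi> \<and> quantifier_free \<phi>}"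
    by (auto simp: MSO_def closed_form_def)
  then show "TT \<in> F" "FF \<in> F" using assms unfolding fragment_def by blast+
  have "\<phi> \<in> F" if "\<phi> \<in> qf_closure F \<sigma>" for \<phi>
    using that by induction (use assms in \<open>auto simp: fragment_def\<close>)
  then show "qf_closure F \<sigma> = F" by (auto intro: qf_closure.base)
qed

primrec big_disj :: "form list \<Rightarrow> form" where
  "big_disj [] = FF"
| "big_disj (\<phi> # \<phi>s) = Disj \<phi> (big_disj \<phi>s)"

primrec big_conj :: "form list \<Rightarrow> form" where
  "big_conj [] = TT"
| "big_conj (\<phi> # \<phi>s) = Conj \<phi> (big_conj \<phi>s)"

lemma sat_big_disj [simp]: "sat w v S (big_disj \<phi>s) \<longleftrightarrow> (\<exists>\<phi>\<in>set \<phi>s. sat w v S \<phi>)"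
  by (induction \<phi>s) auto

lemma sat_big_conj [simp]: "sat w v S (big_conj \<phi>s) \<longleftrightarrow> (\<forall>\<phi>\<in>set \<phi>s. sat w v S \<phi>)"
  by (induction \<phi>s) auto

lemma fv_big_disj [simp]: "fv1 (big_disj \<phi>s) = (\<Union>\<phi>\<in>set \<phi>s. fv1 \<phi>)" "fv2 (big_disj \<phi>s) = (\<Union>\<phi>\<in>set \<phi>s. fv2 \<phi>)"
  by (induction \<phi>s) auto

lemma fv_big_conj [simp]: "fv1 (big_conj \<phi>s) = (\<Union>\<phi>\<in>set \<phi>s. fv1 \<phi>)" "fv2 (big_conj \<phi>s) = (\<Union>\<phi>\<in>set \<phi>s. fv2 \<phi>)"
  by (induction \<phi>s) auto

lemma over_sig_big [simp]:
  "over_sig \<sigma> (big_disj \<phi>s) \<longleftrightarrow> (\<forall>\<phi>\<in>set \<phi>s. over_sig \<sigma> \<phi>)"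
  "over_sig \<sigma> (big_conj \<phi>s) \<longleftrightarrow> (\<forall>\<phi>\<in>set \<phi>s. over_sig \<sigma> \<phi>)"
  by (induction \<phi>s) auto

lemma quantifier_free_big [simp]:
  "quantifier_free (big_disj \<phi>s) \<longleftrightarrow> (\<forall>\<phi>\<in>set \<phi>s. quantifier_free \<phi>)"
  "quantifier_free (big_conj \<phi>s) \<longleftrightarrow> (\<forall>\<phi>\<in>set \<phi>s. quantifier_free \<phi>)"
  by (induction \<phi>s) auto

section \<open>Window words and boundaries\<close>

text \<open>\<open>i\<close> is the position of the first letter and \<open>r\<close> the right
  context: the windows of the word see into \<open>r\<close>, but \<open>r\<close> contributes no
  letters. With these two parameters windows can be computed factor by factor.\<close>

primrec windows :: "nat \<Rightarrow> nat \<Rightarrow> nat \<Rightarrow> word \<Rightarrow> word \<Rightarrow> word" where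
  "windows K d i [] r = []"
| "windows K d i (a # w) r =
     prod_encode (list_encode (take K (a # w @ r)), i mod d) # windows K d (Suc i) w r"

lemma length_windows [simp]: "length (windows K d i w r) = length w"
  by (induction w arbitrary: i) auto

lemma nth_windows:
  "p < length w \<Longrightarrow> windows K d i w r ! p = prod_encode (list_encode (take K (drop p w @ r)), (i + p) mod d)"
proof (induction w arbitrary: i p)
  case (Cons a w)
  then show ?case by (cases p) auto
qed simp

lemma windows_append:
  "windows K d i (u @ v) r = windows K d i u (v @ r) @ windows K d (i + length u) v r"
  by (induction u arbitrary: i) auto

lemma windows_cong:
  assumes "take K r = take K r'" "i mod d = j mod d"
  shows "windows K d i w r = windows K d j w r'"
proof (rule nth_equalityI)
  fix p assume "p < length (windows K d i w r)"
  moreover have "take K (drop p w @ r) = take K (drop p w @ r')"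
    using assms(1) by (simp, metis diff_le_self min.absorb1 take_take)
  moreover have "(i + p) mod d = (j + p) mod d" using assms(2) by (metis mod_add_left_eq)
  ultimately show "windows K d i w r ! p = windows K d j w r' ! p"
    by (simp add: nth_windows)
qed simp

text \<open>Words shorter than \<open>K\<close> are included because windows near the end of a word
  are truncated.\<close>

definition window_alphabet :: "letter set \<Rightarrow> nat \<Rightarrow> nat \<Rightarrow> letter set" where
  "window_alphabet A K d = prod_encode ` (list_encode ` {u \<in> lists A. length u \<le> K} \<times> {..<d})"

lemma finite_short_lists: "finite A \<Longrightarrow> finite {u \<in> lists A. length u \<le> K}"
  using finite_lists_length_le[of A K] by (simp add: lists_eq_set)

lemma finite_window_alphabet: "finite A \<Longrightarrow> finite (window_alphabet A K d)"
  unfolding window_alphabet_def by (simp add: finite_short_lists)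

lemma take_in_lists: "w \<in> lists A \<Longrightarrow> take n w \<in> lists A"
  by (metis append_in_lists_conv append_take_drop_id)

lemma drop_in_lists: "w \<in> lists A \<Longrightarrow> drop n w \<in> lists A"
  by (metis append_in_lists_conv append_take_drop_id)

lemma rev_in_lists: "w \<in> lists A \<Longrightarrow> rev w \<in> lists A"
  by (simp add: in_lists_conv_set)

lemma windows_in:
  assumes "w \<in> lists A" "r \<in> lists A" "0 < d"
  shows "windows K d i w r \<in> lists (window_alphabet A K d)"
  using assms(1)
proof (induction w arbitrary: i)
  case (Cons a w)
  have "take K (a # w @ r) \<in> {u \<in> lists A. length u \<le> K}"
    using Cons assms(2) take_in_lists[of "a # w @ r" A K] by simp
  then show ?case using Cons assms(3) by (auto simp: window_alphabet_def)
qed simp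

text \<open>This is all that the added zero-ary predicates can observe. The suffix is stored
  backwards, so that \<open>max - k\<close> reads its entry at index \<open>k\<close>.\<close>

definition boundary :: "nat \<Rightarrow> nat \<Rightarrow> word \<Rightarrow> word \<times> word \<times> nat" where
  "boundary K d w = (take K w, take K (rev w), length w mod d)"

definition bounded_preds :: "nat \<Rightarrow> nat \<Rightarrow> predicate set" where
  "bounded_preds K d = {Plus_letter a k | a k. k < K} \<union> {Min_letter a k | a k. k < K} \<union>
     {Max_letter a k | a k. k < K} \<union> (\<Union>e\<in>{e. e dvd d}. MOD_preds e)"

lemma bounded_preds_mono: "K \<le> K' \<Longrightarrow> d dvd d' \<Longrightarrow> bounded_preds K d \<subseteq> bounded_preds K' d'"
  unfolding bounded_preds_def by (auto intro: dvd_trans)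

lemma over_bounded_preds:
  "over_sig (\<sigma> \<union> (local_preds \<union> all_MOD_preds)) \<phi> \<Longrightarrow>
    \<exists>K d. 0 < K \<and> 0 < d \<and> over_sig (\<sigma> \<union> bounded_preds K d) \<phi>"
proof (induction \<phi>)
  case (Atom P xs)
  consider "P \<in> \<sigma>" | a k where "P \<in> {Plus_letter a k, Min_letter a k, Max_letter a k}"
    | d where "1 \<le> d" "P \<in> MOD_preds d"
    using Atom by (auto simp: local_preds_def all_MOD_preds_def)
  then show ?case
  proof cases
    case 1
    then show ?thesis using Atom by auto
  next
    case (2 a k)
    then have "P \<in> bounded_preds (Suc k) 1" by (auto simp: bounded_preds_def)
    then show ?thesis using Atom by (intro exI[of _ "Suc k"] exI[of _ 1]) auto
  next
    case (3 d)
    then have "P \<in> bounded_preds 1 d" by (auto simp: bounded_preds_def)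
    then show ?thesis using Atom 3 by (intro exI[of _ 1] exI[of _ d]) auto
  qed
next
  case (Conj \<phi> \<psi>)
  then obtain K d K' d' where *: "0 < K" "0 < d" "over_sig (\<sigma> \<union> bounded_preds K d) \<phi>"
    "0 < K'" "0 < d'" "over_sig (\<sigma> \<union> bounded_preds K' d') \<psi>" by auto
  have "bounded_preds K d \<subseteq> bounded_preds (K + K') (d * d')" "bounded_preds K' d' \<subseteq> bounded_preds (K + K') (d * d')"
    by (rule bounded_preds_mono; simp)+
  then have "over_sig (\<sigma> \<union> bounded_preds (K + K') (d * d')) (Conj \<phi> \<psi>)"
    using * by (auto elim!: over_sig_mono)
  then show ?case using * by (intro exI[of _ "K + K'"] exI[of _ "d * d'"]) simp
next
  case (Disj \<phi> \<psi>)
  then obtain K d K' d' where *: "0 < K" "0 < d" "over_sig (\<sigma> \<union> bounded_preds K d) \<phi>"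
    "0 < K'" "0 < d'" "over_sig (\<sigma> \<union> bounded_preds K' d') \<psi>" by auto
  have "bounded_preds K d \<subseteq> bounded_preds (K + K') (d * d')" "bounded_preds K' d' \<subseteq> bounded_preds (K + K') (d * d')"
    by (rule bounded_preds_mono; simp)+
  then have "over_sig (\<sigma> \<union> bounded_preds (K + K') (d * d')) (Disj \<phi> \<psi>)"
    using * by (auto elim!: over_sig_mono)
  then show ?case using * by (intro exI[of _ "K + K'"] exI[of _ "d * d'"]) simp
qed auto

text \<open>The first disjunct is false; it keeps \<open>x\<close> free when \<open>cs\<close> is
  empty.\<close>

definition letter_among :: "letter list \<Rightarrow> nat \<Rightarrow> form" where
  "letter_among cs x = big_disj (Conj FF (Letter 0 x) # map (\<lambda>c. Letter c x) cs)"

lemma qf_over_letter_among: "qf_over \<sigma> {x} (letter_among cs x)"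
  by (auto simp: qf_over_def letter_among_def)

lemma sat_letter_among:
  "v x < length w \<Longrightarrow> sat w v S (letter_among cs x) \<longleftrightarrow> w ! v x \<in> set cs"
  by (auto simp: letter_among_def)

text \<open>
  A window letter \<open>c\<close> knows the next letters after its position and its position modulo \<open>d\<close>, so it decides
  the predicates \<open>a(x + k)\<close> and \<open>MOD\<close> at this position; the length argument \<open>0\<close> of \<open>R\<close> is irrelevant.
\<close>

definition window_holds :: "predicate \<Rightarrow> letter \<Rightarrow> bool" where
  "window_holds P c = (case prod_decode c of (u, i) \<Rightarrow>
     (case P of Plus_letter a k \<Rightarrow> k < length (list_decode u) \<and> list_decode u ! k = a
      | Numerical k R \<Rightarrow> R 0 [i] | _ \<Rightarrow> False))"

text \<open>The residue \<open>r\<close> stands in for the length of the word, which is faithful for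
  \<open>MOD_len e i\<close> with \<open>e\<close> dividing \<open>d\<close>. The clause for
  \<open>Plus_letter\<close> is a default value.\<close>

fun boundary_holds :: "word \<times> word \<times> nat \<Rightarrow> predicate \<Rightarrow> bool" where
  "boundary_holds (p, q, r) (Min_letter a k) \<longleftrightarrow> k < length p \<and> p ! k = a"
| "boundary_holds (p, q, r) (Max_letter a k) \<longleftrightarrow> k < length q \<and> q ! k = a"
| "boundary_holds (p, q, r) (Numerical k R) \<longleftrightarrow> R r []"
| "boundary_holds (p, q, r) (Plus_letter a k) \<longleftrightarrow> False"

definition window_atom :: "predicate set \<Rightarrow> letter list \<Rightarrow> word \<times> word \<times> nat \<Rightarrow> predicate \<Rightarrow> nat list \<Rightarrow> form" where
  "window_atom \<sigma> cs t P xs =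
    (if P \<in> \<sigma> then Atom P xs
     else if arity P = 0 then (if boundary_holds t P then TT else FF)
     else letter_among (filter (window_holds P) cs) (hd xs))"

text \<open>The letter at a position is the first letter of its window, which is why
  \<open>K\<close> has to be positive.\<close>

definition window_letter :: "letter list \<Rightarrow> letter \<Rightarrow> nat \<Rightarrow> form" where
  "window_letter cs a x = letter_among (filter (window_holds (Plus_letter a 0)) cs) x"

lemma translation_windows:
  "translation (window_letter cs) (window_atom \<sigma> cs t) (\<sigma> \<union> (local_preds \<union> all_MOD_preds)) \<sigma>"
proof
  show "qf_over \<sigma> {x} (window_letter cs a x)" for a x
    by (simp add: window_letter_def qf_over_letter_among)
  fix P and xs :: "nat list" assume P: "P \<in> \<sigma> \<union> (local_preds \<union> all_MOD_preds)" "length xs = arity P"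
  show "qf_over \<sigma> (set xs) (window_atom \<sigma> cs t P xs)"
  proof (cases "P \<in> \<sigma>")
    case True
    then show ?thesis using P by (simp add: window_atom_def qf_over_def)
  next
    case False
    then have "arity P \<le> 1"
      using P by (auto simp: local_preds_def all_MOD_preds_def MOD_preds_def MOD_pos_def MOD_len_def)
    then consider "arity P = 0" "xs = []" | x where "arity P = 1" "xs = [x]"
      using P by (cases xs) (auto simp: le_Suc_eq)
    then show ?thesis
      using False qf_over_letter_among by cases (auto simp: window_atom_def qf_over_def)
  qed
qed

lemma sat_windows_translate:
  assumes \<sigma>: "numerical_signature \<sigma>" and w: "w \<in> lists A" and K: "0 < K" and d: "0 < d"
    and cs: "set cs = window_alphabet A K d"
    and \<phi>: "over_sig (\<sigma> \<union> bounded_preds K d) \<phi>" "closed_form \<phi>"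
  shows "sat (windows K d 0 w []) v S (translate (window_letter cs) (window_atom \<sigma> cs (boundary K d w)) \<phi>) \<longleftrightarrow>
    sat w v S \<phi>"
proof (rule sat_translate[OF _ _ _ \<phi>(1)])
  let ?w = "windows K d 0 w []"
  have among: "sat ?w v S (letter_among (filter (window_holds P) cs) x) \<longleftrightarrow> window_holds P (?w ! v x)"
    if "v x < length w" for P v x S
  proof -
    have "?w ! v x \<in> window_alphabet A K d"
      using windows_in[OF w, of "[]" d K 0] d that by (simp add: in_lists_conv_set)
    then show ?thesis using that cs by (simp add: sat_letter_among)
  qed
  have holds: "window_holds (Plus_letter a k) (?w ! p) \<longleftrightarrow> p + k < length w \<and> w ! (p + k) = a"
    if "p < length w" "k < K" for p k a
    using that by (auto simp: window_holds_def nth_windows less_diff_conv add.commute)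
  show "sat ?w v S (window_letter cs a x) \<longleftrightarrow> w ! v x = a" if "v x < length w" for a x v S
    using that holds[of "v x" 0 a] K by (simp add: window_letter_def among)
  fix P xs S and v :: "nat \<Rightarrow> nat"
  assume P: "P \<in> \<sigma> \<union> bounded_preds K d" "length xs = arity P" "\<forall>x\<in>set xs. v x < length w"
  show "sat ?w v S (window_atom \<sigma> cs (boundary K d w) P xs) \<longleftrightarrow> pred_holds w P (map v xs)"
  proof (cases "P \<in> \<sigma>")
    case True
    then show ?thesis using \<sigma> by (auto simp: numerical_signature_def window_atom_def)
  next
    case False
    then consider a k where "P = Plus_letter a k" "k < K" | a k where "P = Min_letter a k" "k < K"
      | a k where "P = Max_letter a k" "k < K" | e i where "e dvd d" "P = MOD_pos e i"
      | e i where "e dvd d" "P = MOD_len e i"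
      using P(1) unfolding bounded_preds_def MOD_preds_def by blast
    then show ?thesis
    proof cases
      case (1 a k)
      then obtain x where x: "xs = [x]" using P(2) by (cases xs) auto
      then show ?thesis using False 1 P(3) holds[of "v x" k a] among[of v x]
        by (simp add: window_atom_def)
    next
      case (2 a k)
      then show ?thesis using False by (auto simp: window_atom_def boundary_def)
    next
      case (3 a k)
      then show ?thesis using False by (auto simp: window_atom_def boundary_def rev_nth)
    next
      case (4 e i)
      then obtain x where x: "xs = [x]" using P(2) by (cases xs) (auto simp: MOD_pos_def)
      then show ?thesis using False 4 P(3) among[of v x]
        by (simp add: window_atom_def MOD_pos_def window_holds_def nth_windows mod_mod_cancel)
    next
      case (5 e i)
      then show ?thesis using False
        by (simp add: window_atom_def MOD_len_def boundary_def mod_mod_cancel)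
    qed
  qed
qed (use \<phi>(2) in \<open>auto simp: closed_form_def\<close>)

text \<open>\<open>K\<close> and \<open>d\<close> bound the finitely many atoms of the given
  formula. Its translation with the boundary frozen to \<open>t\<close> lies in \<open>F\<close> for
  every \<open>t\<close>, and is correct on the words that have boundary \<open>t\<close>.\<close>

lemma definable_imp_windows:
  assumes \<sigma>: "numerical_signature \<sigma>" and F: "fragment F \<sigma>" and A: "finite A"
    and L: "definable (enrich F \<sigma> (local_preds \<union> all_MOD_preds)) A L"
  obtains K d where "0 < K" "0 < d"
    "\<And>t. \<exists>\<phi>\<in>F. \<forall>w\<in>lists A. boundary K d w = t \<longrightarrow>
      (w \<in> L \<longleftrightarrow> windows K d 0 w [] \<in> form_lang (window_alphabet A K d) \<phi>)"
proof -
  obtain \<phi> where \<phi>: "\<phi> \<in> qf_closure F (\<sigma> \<union> (local_preds \<union> all_MOD_preds))" "L = form_lang A \<phi>"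
    using L unfolding definable_def enrich_def by blast
  have FM: "F \<subseteq> MSO (\<sigma> \<union> (local_preds \<union> all_MOD_preds))"
    using fragmentD(1)[OF F] over_sig_mono unfolding MSO_def by blast
  obtain K d where Kd: "0 < K" "0 < d" "over_sig (\<sigma> \<union> bounded_preds K d) \<phi>"
    using over_bounded_preds[OF qf_closure_over_sig[OF \<phi>(1) FM]] by blast
  have closed: "closed_form \<phi>" using qf_closure_closed[OF \<phi>(1)] fragmentD(2)[OF F] by blast
  obtain cs where cs: "set cs = window_alphabet A K d"
    using finite_list[OF finite_window_alphabet[OF A]] by blast
  show thesis
  proof (rule that[OF Kd(1,2)])
    fix t
    interpret translation "window_letter cs" "window_atom \<sigma> cs t" "\<sigma> \<union> (local_preds \<union> all_MOD_preds)" \<sigma>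
      by (rule translation_windows)
    have "tr \<phi> \<in> F" using translate_qf_closure[OF FM \<phi>(1)] fragmentD(8)[OF F] by simp
    moreover have "w \<in> L \<longleftrightarrow> windows K d 0 w [] \<in> form_lang (window_alphabet A K d) (tr \<phi>)"
      if "w \<in> lists A" "boundary K d w = t" for w
      using sat_windows_translate[OF \<sigma> that(1) Kd(1,2) cs Kd(3) closed] that windows_in[OF that(1) lists.Nil Kd(2)]
      unfolding \<phi>(2) form_lang_def by simp
    ultimately show "\<exists>\<phi>\<in>F. \<forall>w\<in>lists A. boundary K d w = t \<longrightarrow>
      (w \<in> L \<longleftrightarrow> windows K d 0 w [] \<in> form_lang (window_alphabet A K d) \<phi>)" by blast
  qed
qed

section \<open>Formulas that express windows and boundaries\<close>

text \<open>It says that the word read by the tests \<open>at a k\<close> is exactly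
  \<open>u\<close>. The negated tests at indices beyond \<open>u\<close> also fix its length, as a
  missing letter fails all tests.\<close>

definition profile :: "nat \<Rightarrow> letter list \<Rightarrow> (letter \<Rightarrow> nat \<Rightarrow> form) \<Rightarrow> word \<Rightarrow> form" where
  "profile K as at u = big_conj (map (\<lambda>(k, a). if k < length u \<and> u ! k = a then at a k else Neg (at a k))
     (List.product [0..<K] as))"

lemma profile_syntax:
  assumes "\<And>a k. qf_over \<sigma> X (at a k)"
  shows "quantifier_free (profile K as at u)" "over_sig \<sigma> (profile K as at u)"
    "fv1 (profile K as at u) \<subseteq> X" "fv2 (profile K as at u) = {}"
  using assms by (auto simp: profile_def qf_over_def split: if_splits)

lemma list_eq_by_letters:
  assumes "u \<in> lists A" "u' \<in> lists A" "length u \<le> K" "length u' \<le> K"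
    and eq: "\<And>k a. \<lbrakk>k < K; a \<in> A\<rbrakk> \<Longrightarrow> (k < length u \<and> u ! k = a) \<longleftrightarrow> (k < length u' \<and> u' ! k = a)"
  shows "u = u'"
proof (rule nth_equalityI)
  have *: "u ! k = u' ! k \<and> k < length u'" if "k < length u" for k
  proof -
    have "k < K" "u ! k \<in> A" using that assms(1,3) by (simp_all add: in_lists_conv_set)
    then show ?thesis using eq[of k "u ! k"] that by metis
  qed
  have **: "k < length u" if "k < length u'" for k
  proof -
    have "k < K" "u' ! k \<in> A" using that assms(2,4) by (simp_all add: in_lists_conv_set)
    then show ?thesis using eq[of k "u' ! k"] that by metis
  qed
  show "length u = length u'" using *[of "length u'"] **[of "length u"] by (metis nat_neq_iff)
  show "u ! k = u' ! k" if "k < length u" for k using * that by blast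
qed

lemma sat_profile:
  assumes "u \<in> lists (set as)" "u' \<in> lists (set as)" "length u \<le> K" "length u' \<le> K"
    and at: "\<And>a k. k < K \<Longrightarrow> sat w v S (at a k) \<longleftrightarrow> k < length u' \<and> u' ! k = a"
  shows "sat w v S (profile K as at u) \<longleftrightarrow> u = u'"
proof
  assume "sat w v S (profile K as at u)"
  then have *: "sat w v S (if k < length u \<and> u ! k = a then at a k else Neg (at a k))"
    if "k < K" "a \<in> set as" for k a
    using that by (force simp: profile_def)
  show "u = u'"
  proof (rule list_eq_by_letters[OF assms(1-4)])
    show "k < length u \<and> u ! k = a \<longleftrightarrow> k < length u' \<and> u' ! k = a" if "k < K" "a \<in> set as" for k a
      using *[OF that] at[OF that(1), of a] by (cases "k < length u \<and> u ! k = a") auto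
  qed
qed (use at in \<open>auto simp: profile_def\<close>)

text \<open>It says, in the original word, that the window letter at \<open>x\<close> is
  \<open>c\<close>. The leading tautology keeps \<open>x\<close> free when \<open>c\<close> codes no
  possible window and the rest is \<open>FF\<close>.\<close>

definition unwindow :: "nat \<Rightarrow> nat \<Rightarrow> letter list \<Rightarrow> letter \<Rightarrow> nat \<Rightarrow> form" where
  "unwindow K d as c x = Conj (Disj (Letter 0 x) (Neg (Letter 0 x)))
     (case prod_decode c of (u, i) \<Rightarrow>
       (if list_decode u \<in> lists (set as) \<and> length (list_decode u) \<le> K \<and> i < d
        then Conj (Atom (MOD_pos d i) [x])
          (profile K as (\<lambda>a k. Atom (Plus_letter a k) [x]) (list_decode u))
        else FF))"

definition boundary_form :: "nat \<Rightarrow> nat \<Rightarrow> letter list \<Rightarrow> word \<times> word \<times> nat \<Rightarrow> form" where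
  "boundary_form K d as t = (case t of (p, q, r) \<Rightarrow> Conj (Atom (MOD_len d r) [])
     (Conj (profile K as (\<lambda>a k. Atom (Min_letter a k) []) p)
       (profile K as (\<lambda>a k. Atom (Max_letter a k) []) q)))"

lemma qf_over_unwindow: "qf_over (\<sigma> \<union> (local_preds \<union> MOD_preds d)) {x} (unwindow K d as c x)"
proof -
  have *: "qf_over (\<sigma> \<union> (local_preds \<union> MOD_preds d)) {x} (Atom (Plus_letter a k) [x])" for a k
    by (auto simp: qf_over_def local_preds_def)
  obtain u i where c: "prod_decode c = (u, i)" by fastforce
  show ?thesis
    using profile_syntax[where at = "\<lambda>a k. Atom (Plus_letter a k) [x]", OF *, of K as "list_decode u"] c
    by (auto simp: qf_over_def unwindow_def MOD_preds_def MOD_pos_def)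
qed

lemma qf_over_boundary_form:
  assumes "r < d"
  shows "qf_over (\<sigma> \<union> (local_preds \<union> MOD_preds d)) {} (boundary_form K d as (p, q, r))"
proof -
  have *: "qf_over (\<sigma> \<union> (local_preds \<union> MOD_preds d)) {} (Atom (Min_letter a k) [])"
    "qf_over (\<sigma> \<union> (local_preds \<union> MOD_preds d)) {} (Atom (Max_letter a k) [])" for a k
    by (auto simp: qf_over_def local_preds_def)
  have "MOD_len d r \<in> \<sigma> \<union> (local_preds \<union> MOD_preds d)" "arity (MOD_len d r) = 0"
    using assms by (auto simp: MOD_preds_def) (simp add: MOD_len_def)
  then show ?thesis
    using profile_syntax[where at = "\<lambda>a k. Atom (Min_letter a k) []", OF *(1), of K as p]
      profile_syntax[where at = "\<lambda>a k. Atom (Max_letter a k) []", OF *(2), of K as q]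
    by (simp add: qf_over_def boundary_form_def)
qed

lemma sat_boundary_form:
  assumes w: "w \<in> lists (set as)" and "p \<in> lists (set as)" "length p \<le> K" "q \<in> lists (set as)" "length q \<le> K"
  shows "sat w v S (boundary_form K d as (p, q, r)) \<longleftrightarrow> boundary K d w = (p, q, r)"
proof -
  have "sat w v S (profile K as (\<lambda>a k. Atom (Min_letter a k) []) p) \<longleftrightarrow> p = take K w"
    by (rule sat_profile) (use assms in \<open>auto simp: take_in_lists\<close>)
  moreover have "sat w v S (profile K as (\<lambda>a k. Atom (Max_letter a k) []) q) \<longleftrightarrow> q = take K (rev w)"
    by (rule sat_profile) (use assms in \<open>auto simp: take_in_lists rev_in_lists rev_nth\<close>)
  ultimately show ?thesis by (auto simp: boundary_form_def boundary_def MOD_len_def)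
qed

lemma qf_closure_disj:
  assumes F: "fragment F \<sigma>" and "\<phi> \<in> qf_closure F \<tau>" "\<psi> \<in> qf_closure F \<tau>"
  shows "Disj \<phi> \<psi> \<in> qf_closure F \<tau>"
proof -
  obtain \<phi>0 \<psi>0 where "\<phi>0 \<in> F" "\<psi>0 \<in> F" "(qf_subst \<tau>)\<^sup>*\<^sup>* \<phi>0 \<phi>" "(qf_subst \<tau>)\<^sup>*\<^sup>* \<psi>0 \<psi>"
    using assms(2,3) unfolding qf_closure_iff by blast
  then show ?thesis using fragmentD(5)[OF F] qf_subst_rtranclp_cong2(2) unfolding qf_closure_iff by blast
qed

text \<open>\<open>\<psi>\<close> may use predicates outside \<open>\<sigma>\<close> and so lie
  outside \<open>F\<close>; it is substituted for \<open>TT\<close> in a conjunction with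
  \<open>TT\<close>, which does belong to \<open>F\<close>.\<close>

lemma qf_closure_conj:
  assumes F: "fragment F \<sigma>" and "\<phi> \<in> qf_closure F \<tau>" "qf_over \<tau> {} \<psi>"
  shows "Conj \<psi> \<phi> \<in> qf_closure F \<tau>"
proof -
  obtain \<phi>0 where "\<phi>0 \<in> F" "(qf_subst \<tau>)\<^sup>*\<^sup>* \<phi>0 \<phi>"
    using assms(2) unfolding qf_closure_iff by blast
  moreover have "(qf_subst \<tau>)\<^sup>*\<^sup>* TT \<psi>"
    using assms(3) by (intro r_into_rtranclp qf_subst.here) (auto simp: qf_over_def MSO_def)
  ultimately show ?thesis
    using fragmentD(4)[OF F fragmentD(6)[OF F]] qf_subst_rtranclp_cong2(1) unfolding qf_closure_iff by blast
qed

text \<open>The defining formula is a disjunction over the finitely many boundaries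
  \<open>t\<close>: the boundary is \<open>t\<close>, and the formula of \<open>F\<close>
  responsible for \<open>t\<close> holds once its window letters are spelled out by
  \<open>unwindow\<close>. Only the modulus \<open>d\<close> occurs in it.\<close>

lemma windows_imp_definable:
  assumes \<sigma>: "numerical_signature \<sigma>" and F: "fragment F \<sigma>" and A: "finite A" and L: "L \<subseteq> lists A" and d: "0 < d"
    and win: "\<And>t. \<exists>\<phi>\<in>F. \<forall>w\<in>lists A. boundary K d w = t \<longrightarrow>
      (w \<in> L \<longleftrightarrow> windows K d 0 w [] \<in> form_lang (window_alphabet A K d) \<phi>)"
  shows "definable (enrich F \<sigma> (local_preds \<union> MOD_preds d)) A L"
proof -
  let ?\<tau> = "\<sigma> \<union> (local_preds \<union> MOD_preds d)"
  obtain as where as: "set as = A" using finite_list[OF A] by blast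
  obtain \<Phi> where \<Phi>: "\<And>t. \<Phi> t \<in> F" "\<And>w. w \<in> lists A \<Longrightarrow>
      (w \<in> L \<longleftrightarrow> windows K d 0 w [] \<in> form_lang (window_alphabet A K d) (\<Phi> (boundary K d w)))"
    using win by metis
  let ?T = "{u \<in> lists A. length u \<le> K} \<times> {u \<in> lists A. length u \<le> K} \<times> {..<d}"
  obtain ts where ts: "set ts = ?T"
    using finite_list[of ?T] finite_short_lists[OF A] by blast
  let ?tr = "translate (unwindow K d as) Atom"
  interpret translation "unwindow K d as" Atom ?\<tau> ?\<tau>
    by unfold_locales (auto simp: qf_over_unwindow, auto simp: qf_over_def)
  have FM: "F \<subseteq> MSO ?\<tau>" using fragmentD(1)[OF F] over_sig_mono unfolding MSO_def by blast
  have tr: "tr (\<Phi> t) \<in> qf_closure F ?\<tau>" for t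
    by (rule translate_qf_closure[OF FM qf_closure.base[OF \<Phi>(1)]])
  have sat_tr: "sat w (\<lambda>_. 0) (\<lambda>_. {}) (tr (\<Phi> t)) \<longleftrightarrow>
      windows K d 0 w [] \<in> form_lang (window_alphabet A K d) (\<Phi> t)" if w: "w \<in> lists A" for w t
  proof -
    let ?w = "windows K d 0 w []"
    \<comment> \<open>The roles are now exchanged: the translated formula is read in
      \<open>w\<close> and the original one in the window word.\<close>
    have "sat w (\<lambda>_. 0) (\<lambda>_. {}) (tr (\<Phi> t)) \<longleftrightarrow> sat ?w (\<lambda>_. 0) (\<lambda>_. {}) (\<Phi> t)"
    proof (rule sat_translate[where \<sigma> = \<sigma>])
      fix c x S and v :: "nat \<Rightarrow> nat" assume "v x < length ?w"
      then have x: "v x < length w" by simp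
      obtain u i where c: "c = prod_encode (list_encode u, i)"
        by (metis list_decode_inverse prod_decode_inverse prod.exhaust)
      have dr: "take K (drop (v x) w) \<in> lists (set as)" using w as by (simp add: take_in_lists drop_in_lists)
      have "sat w v S (profile K as (\<lambda>a k. Atom (Plus_letter a k) [x]) u) \<longleftrightarrow> u = take K (drop (v x) w)"
        if "u \<in> lists (set as)" "length u \<le> K"
        by (rule sat_profile[OF that(1) dr that(2)]) (use x in \<open>auto simp: less_diff_conv add.commute\<close>)
      then show "sat w v S (unwindow K d as c x) \<longleftrightarrow> ?w ! v x = c"
        using x dr d by (auto simp: unwindow_def c nth_windows MOD_pos_def list_encode_eq)
    next
      fix P xs S and v :: "nat \<Rightarrow> nat" assume "P \<in> \<sigma>"
      then show "sat w v S (Atom P xs) \<longleftrightarrow> pred_holds ?w P (map v xs)"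
        using \<sigma> unfolding numerical_signature_def by auto
    qed (use fragmentD(1,2)[OF F \<Phi>(1)] in \<open>auto simp: closed_form_def\<close>)
    then show ?thesis using windows_in[OF w lists.Nil d] by (simp add: form_lang_def)
  qed
  let ?\<phi> = "big_disj (map (\<lambda>t. Conj (boundary_form K d as t) (tr (\<Phi> t))) ts)"
  have "big_disj (map (\<lambda>t. Conj (boundary_form K d as t) (tr (\<Phi> t))) us) \<in> qf_closure F ?\<tau>"
    if "set us \<subseteq> set ts" for us
    using that
  proof (induction us)
    case Nil
    show ?case using fragmentD(7)[OF F] by (auto intro: qf_closure.base)
  next
    case (Cons t us)
    obtain p q r where t: "t = (p, q, r)" "r < d" using Cons.prems ts by auto
    show ?case using Cons qf_closure_conj[OF F tr qf_over_boundary_form[OF t(2)]] t(1)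
      by (auto intro!: qf_closure_disj[OF F])
  qed
  then have "?\<phi> \<in> enrich F \<sigma> (local_preds \<union> MOD_preds d)" unfolding enrich_def by blast
  moreover have "L = form_lang A ?\<phi>"
  proof -
    have "w \<in> L \<longleftrightarrow> sat w (\<lambda>_. 0) (\<lambda>_. {}) ?\<phi>" if w: "w \<in> lists A" for w
    proof -
      have bd: "boundary K d w \<in> set ts"
        using w d by (auto simp: ts boundary_def take_in_lists rev_in_lists)
      have "sat w (\<lambda>_. 0) (\<lambda>_. {}) (boundary_form K d as t) \<longleftrightarrow> boundary K d w = t" if "t \<in> set ts" for t
      proof -
        obtain p q r where t: "t = (p, q, r)" by (cases t) auto
        then have "p \<in> lists (set as)" "length p \<le> K" "q \<in> lists (set as)" "length q \<le> K"
          using that ts as by auto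
        then show ?thesis using sat_boundary_form[of w as p K q] w as t by simp
      qed
      then have "sat w (\<lambda>_. 0) (\<lambda>_. {}) ?\<phi> \<longleftrightarrow> sat w (\<lambda>_. 0) (\<lambda>_. {}) (tr (\<Phi> (boundary K d w)))"
        using bd by auto
      then show ?thesis using sat_tr[OF w] \<Phi>(2)[OF w] by simp
    qed
    then show ?thesis using L by (auto simp: form_lang_def)
  qed
  ultimately show ?thesis unfolding definable_def by blast
qed

section \<open>Block languages and local monoids\<close>

definition blocks :: "word \<Rightarrow> (letter \<Rightarrow> word) \<Rightarrow> word \<Rightarrow> word" where
  "blocks u x cs = concat (map (\<lambda>c. u @ x c) cs) @ u"

definition block_lang :: "word set \<Rightarrow> word \<Rightarrow> word \<Rightarrow> word \<Rightarrow> (letter \<Rightarrow> word) \<Rightarrow> letter set \<Rightarrow> word set" where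
  "block_lang L y z u x C = {cs \<in> lists C. y @ blocks u x cs @ z \<in> L}"

lemma blocks_simps [simp]: "blocks u x [] = u" "blocks u x (c # cs) = u @ x c @ blocks u x cs"
  by (simp_all add: blocks_def)

lemma blocks_in_lists:
  "\<lbrakk>u \<in> lists A; \<forall>c\<in>C. x c \<in> lists A; cs \<in> lists C\<rbrakk> \<Longrightarrow> blocks u x cs \<in> lists A"
  by (induction cs) auto

lemma take_blocks: "K \<le> length u \<Longrightarrow> take K (blocks u x cs @ z) = take K u"
  by (cases cs) auto

lemma length_blocks_mod:
  assumes "d dvd length u" "\<forall>c\<in>C. d dvd length (x c)" "cs \<in> lists C"
  shows "d dvd length (blocks u x cs)"
  using assms(3) by (induction cs) (auto simp: assms(1,2))

text \<open>Whatever follows a block begins with \<open>u\<close>, which is at least as long as a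
  window, so the windows of the block do not depend on the later blocks. Block lengths are multiples
  of \<open>d\<close>, so the residues start afresh at each block.\<close>

lemma windows_blocks:
  assumes K: "K \<le> length u" and u: "d dvd length u" and x: "\<forall>c\<in>C. d dvd length (x c)"
    and cs: "cs \<in> lists C"
  shows "windows K d i (blocks u x cs @ z) [] =
    concat (map (\<lambda>c. windows K d i (u @ x c) u) cs) @ windows K d i (u @ z) []"
  using cs
proof (induction cs)
  case (Cons c cs)
  let ?B = "blocks u x cs @ z"
  have "windows K d i (blocks u x (c # cs) @ z) [] =
      windows K d i (u @ x c) ?B @ windows K d (i + length (u @ x c)) ?B []"
    using windows_append[of K d i "u @ x c" ?B "[]"] by simp
  also have "windows K d i (u @ x c) ?B = windows K d i (u @ x c) u"
    by (rule windows_cong[OF take_blocks[OF K] refl])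
  also have "windows K d (i + length (u @ x c)) ?B [] = windows K d i ?B []"
  proof (rule windows_cong[OF refl])
    have "d dvd length (u @ x c)" using Cons.hyps u x by simp
    then show "(i + length (u @ x c)) mod d = i mod d" by (metis add.right_neutral dvd_eq_mod_eq_0 mod_add_right_eq)
  qed
  finally show ?case using Cons.IH by simp
qed simp

lemma boundary_blocks:
  assumes K: "K \<le> length u" and u: "d dvd length u" and x: "\<forall>c\<in>C. d dvd length (x c)"
    and cs: "cs \<in> lists C"
  shows "boundary K d (y @ blocks u x cs @ z) =
    (take K (y @ u), take K (rev (u @ z)), (length y + length z) mod d)"
proof -
  have "take K (y @ blocks u x cs @ z) = take K (y @ u)"
    using K take_blocks[of "K - length y" u x cs z] by simp
  moreover have "take K (rev (y @ blocks u x cs @ z)) = take K (rev (u @ z))"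
    using K by (simp add: blocks_def)
  moreover obtain q where "length (blocks u x cs) = d * q"
    using length_blocks_mod[OF u x cs] by blast
  then have "length (y @ blocks u x cs @ z) mod d = (length y + length z) mod d"
    by (simp add: add.left_commute[of "length y"])
  ultimately show ?thesis by (simp add: boundary_def)
qed

lemma form_lang_subset: "form_lang A \<phi> \<subseteq> lists A"
  by (auto simp: form_lang_def)

text \<open>By \<open>boundary_blocks\<close> the boundary is the same for all \<open>cs\<close>, so
  one formula of \<open>F\<close> decides the whole block language. The window word is
  \<open>Wy @ g cs @ Wz\<close> for a morphism \<open>g\<close> of free monoids, hence
  \<open>h\<close> composed with \<open>g\<close> recognizes the block language.\<close>

lemma block_lang_recognizable:
  assumes V: "variety V" and cor: "corresponds F V" and A: "finite A" and d: "0 < d"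
    and win: "\<And>t. \<exists>\<phi>\<in>F. \<forall>w\<in>lists A. boundary K d w = t \<longrightarrow>
      (w \<in> L \<longleftrightarrow> windows K d 0 w [] \<in> form_lang (window_alphabet A K d) \<phi>)"
    and y: "y \<in> lists A" and z: "z \<in> lists A" and u: "u \<in> lists A" "K \<le> length u" "d dvd length u"
    and x: "\<forall>c\<in>C. x c \<in> lists A" "\<forall>c\<in>C. d dvd length (x c)"
  shows "var_recognizable V C (block_lang L y z u x C)"
proof -
  let ?A = "window_alphabet A K d" and ?i = "length y"
  obtain \<phi> where \<phi>: "\<phi> \<in> F" "\<And>w. \<lbrakk>w \<in> lists A; boundary K d w =
      (take K (y @ u), take K (rev (u @ z)), (length y + length z) mod d)\<rbrakk> \<Longrightarrow>
      w \<in> L \<longleftrightarrow> windows K d 0 w [] \<in> form_lang ?A \<phi>"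
    using win by blast
  have "definable F ?A (form_lang ?A \<phi>)" using \<phi>(1) unfolding definable_def by blast
  then obtain M where M: "M \<in> V" "recognizes M ?A (form_lang ?A \<phi>)"
    using cor finite_window_alphabet[OF A, of K d] form_lang_subset unfolding corresponds_def by blast
  then obtain h P where h: "h \<in> monoid_homs (free_monoid ?A) M" and P: "form_lang ?A \<phi> = {w \<in> lists ?A. h w \<in> P}"
    unfolding recognizes_def by blast
  define g where "g cs = concat (map (\<lambda>c. windows K d ?i (u @ x c) u) cs)" for cs
  define Wy where "Wy = windows K d 0 y u"
  define Wz where "Wz = windows K d ?i (u @ z) []"
  have in_A: "g cs \<in> lists ?A" if "cs \<in> lists C" for cs
    using that unfolding g_def by (induction cs) (use windows_in[OF _ u(1) d] u(1) x(1) in auto)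
  have Wy: "Wy \<in> lists ?A" "Wz \<in> lists ?A"
    unfolding Wy_def Wz_def using windows_in d y z u(1) by auto
  have mem: "y @ blocks u x cs @ z \<in> L \<longleftrightarrow> h Wy \<otimes>\<^bsub>M\<^esub> (h (g cs) \<otimes>\<^bsub>M\<^esub> h Wz) \<in> P" if cs: "cs \<in> lists C" for cs
  proof -
    have "windows K d 0 (y @ blocks u x cs @ z) [] = Wy @ g cs @ Wz"
      unfolding Wy_def Wz_def g_def
      using windows_blocks[of K u d C x cs ?i z, OF u(2,3) x(2) cs] take_blocks[OF u(2), of x cs z]
      by (auto simp: windows_append intro: windows_cong)
    moreover have "y @ blocks u x cs @ z \<in> lists A"
      using y z blocks_in_lists[of u A C x cs, OF u(1) x(1) cs] by simp
    ultimately have "y @ blocks u x cs @ z \<in> L \<longleftrightarrow> Wy @ g cs @ Wz \<in> form_lang ?A \<phi>"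
      using \<phi>(2) boundary_blocks[OF u(2,3) x(2) cs] by metis
    also have "\<dots> \<longleftrightarrow> h (Wy @ g cs @ Wz) \<in> P" unfolding P using in_A[OF cs] Wy by simp
    also have "h (Wy @ g cs @ Wz) = h Wy \<otimes>\<^bsub>M\<^esub> (h (g cs) \<otimes>\<^bsub>M\<^esub> h Wz)"
      using free_homD(3)[OF h] in_A[OF cs] Wy by simp
    finally show ?thesis .
  qed
  have "h \<circ> g \<in> monoid_homs (free_monoid C) M"
    by (rule free_hom_comp[OF h]) (use in_A in \<open>auto simp: g_def\<close>)
  moreover have "y @ blocks u x cs' @ z \<in> L"
    if "cs \<in> lists C" "cs' \<in> lists C" "(h \<circ> g) cs = (h \<circ> g) cs'" "y @ blocks u x cs @ z \<in> L" for cs cs'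
    using mem that by simp
  ultimately have "recognizes M C (block_lang L y z u x C)"
    unfolding block_lang_def recognizes_iff[OF varietyD(1)[OF V M(1)]] by blast
  then show ?thesis using M(1) unfolding var_recognizable_def by blast
qed

section \<open>Local monoids of the stable semigroup\<close>

lemma local_monoid_carrier:
  assumes M: "monoid M" and T: "T \<subseteq> carrier M" "\<forall>a\<in>T. \<forall>b\<in>T. a \<otimes>\<^bsub>M\<^esub> b \<in> T"
    and e: "e \<in> T" "e \<otimes>\<^bsub>M\<^esub> e = e"
  shows "carrier (local_monoid M T e) = {t \<in> T. e \<otimes>\<^bsub>M\<^esub> t = t \<and> t \<otimes>\<^bsub>M\<^esub> e = t}"
proof -
  interpret monoid M by fact
  have "e \<otimes>\<^bsub>M\<^esub> (e \<otimes>\<^bsub>M\<^esub> t \<otimes>\<^bsub>M\<^esub> e) = e \<otimes>\<^bsub>M\<^esub> t \<otimes>\<^bsub>M\<^esub> e" "e \<otimes>\<^bsub>M\<^esub> t \<otimes>\<^bsub>M\<^esub> e \<otimes>\<^bsub>M\<^esub> e = e \<otimes>\<^bsub>M\<^esub> t \<otimes>\<^bsub>M\<^esub> e" if "t \<in> T" for t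
  proof -
    have c: "e \<in> carrier M" "t \<in> carrier M" using T e that by auto
    have "e \<otimes>\<^bsub>M\<^esub> (e \<otimes>\<^bsub>M\<^esub> t \<otimes>\<^bsub>M\<^esub> e) = (e \<otimes>\<^bsub>M\<^esub> e) \<otimes>\<^bsub>M\<^esub> t \<otimes>\<^bsub>M\<^esub> e" using c by (simp only: m_assoc m_closed)
    then show "e \<otimes>\<^bsub>M\<^esub> (e \<otimes>\<^bsub>M\<^esub> t \<otimes>\<^bsub>M\<^esub> e) = e \<otimes>\<^bsub>M\<^esub> t \<otimes>\<^bsub>M\<^esub> e" using e(2) by simp
    show "e \<otimes>\<^bsub>M\<^esub> t \<otimes>\<^bsub>M\<^esub> e \<otimes>\<^bsub>M\<^esub> e = e \<otimes>\<^bsub>M\<^esub> t \<otimes>\<^bsub>M\<^esub> e" using c e(2) by (simp add: m_assoc)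
  qed
  moreover have "\<exists>s. t = e \<otimes>\<^bsub>M\<^esub> s \<otimes>\<^bsub>M\<^esub> e \<and> s \<in> T" if "t \<in> T" "e \<otimes>\<^bsub>M\<^esub> t = t" "t \<otimes>\<^bsub>M\<^esub> e = t" for t
    using that by metis
  ultimately show ?thesis using T e by (auto simp: local_monoid_def)
qed

lemma local_monoid_monoid:
  assumes M: "monoid M" and T: "T \<subseteq> carrier M" "\<forall>a\<in>T. \<forall>b\<in>T. a \<otimes>\<^bsub>M\<^esub> b \<in> T"
    and e: "e \<in> T" "e \<otimes>\<^bsub>M\<^esub> e = e"
  shows "monoid (local_monoid M T e)"
proof -
  interpret monoid M by fact
  note c = local_monoid_carrier[OF assms]
  have ops: "mult (local_monoid M T e) = mult M" "one (local_monoid M T e) = e" by (simp_all add: local_monoid_def)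
  have ecl: "e \<in> carrier M" using T(1) e(1) by blast
  have *: "e \<otimes>\<^bsub>M\<^esub> (a \<otimes>\<^bsub>M\<^esub> b) = (e \<otimes>\<^bsub>M\<^esub> a) \<otimes>\<^bsub>M\<^esub> b \<and> a \<otimes>\<^bsub>M\<^esub> b \<otimes>\<^bsub>M\<^esub> e = a \<otimes>\<^bsub>M\<^esub> (b \<otimes>\<^bsub>M\<^esub> e)"
    if "a \<in> T" "b \<in> T" for a b
  proof -
    have "a \<in> carrier M" "b \<in> carrier M" using that T(1) by auto
    then show ?thesis using ecl by (simp add: m_assoc)
  qed
  show ?thesis
  proof (rule monoidI)
    fix a b assume "a \<in> carrier (local_monoid M T e)" "b \<in> carrier (local_monoid M T e)"
    then show "a \<otimes>\<^bsub>local_monoid M T e\<^esub> b \<in> carrier (local_monoid M T e)"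
      using *[of a b] T(2) by (simp add: c ops)
  next
    fix a b d assume "a \<in> carrier (local_monoid M T e)" "b \<in> carrier (local_monoid M T e)"
      "d \<in> carrier (local_monoid M T e)"
    then have "a \<in> carrier M" "b \<in> carrier M" "d \<in> carrier M" using T(1) c by auto
    then show "a \<otimes>\<^bsub>local_monoid M T e\<^esub> b \<otimes>\<^bsub>local_monoid M T e\<^esub> d =
      a \<otimes>\<^bsub>local_monoid M T e\<^esub> (b \<otimes>\<^bsub>local_monoid M T e\<^esub> d)"
      by (simp add: ops m_assoc)
  qed (use e in \<open>auto simp: c ops\<close>)
qed

text \<open>\<open>s\<close> may be any stable exponent: the stability index in one application, a
  factorial computed from an automaton in another.\<close>

locale stable_lang =
  fixes A :: "letter set" and L :: "word set" and s :: nat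
  assumes reg: "regular_lang A L" and s_pos: "0 < s"
    and stable: "syn_morphism A L ` words_of_length A s = syn_morphism A L ` words_of_length A (2 * s)"
begin

abbreviation "\<phi> \<equiv> syn_morphism A L"
abbreviation "M \<equiv> syn_monoid A L"
abbreviation "T \<equiv> \<phi> ` words_of_length A s"

lemma stable_closed:
  shows "T \<subseteq> carrier M" and "\<forall>a\<in>T. \<forall>b\<in>T. a \<otimes>\<^bsub>M\<^esub> b \<in> T"
proof -
  show "T \<subseteq> carrier M" by (auto simp: syn_carrier in_words_of_length)
  show "\<forall>a\<in>T. \<forall>b\<in>T. a \<otimes>\<^bsub>M\<^esub> b \<in> T"
  proof (intro ballI)
    fix a b assume "a \<in> T" "b \<in> T"
    then obtain u v where uv: "u \<in> words_of_length A s" "v \<in> words_of_length A s" "a = \<phi> u" "b = \<phi> v" by blast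
    then have "a \<otimes>\<^bsub>M\<^esub> b = \<phi> (u @ v)" by (simp add: syn_mult in_words_of_length)
    moreover have "u @ v \<in> words_of_length A (2 * s)" using uv by (simp add: in_words_of_length)
    ultimately show "a \<otimes>\<^bsub>M\<^esub> b \<in> T" using stable by blast
  qed
qed

text \<open>The idempotent that ends one sequence of blocks absorbs the one that begins the next, so
  concatenation becomes multiplication in eTe; the empty sequence gives \<open>u\<close>, whose
  image is the identity.\<close>

lemma blocks_morphism:
  assumes u: "u \<in> words_of_length A s" "\<phi> (u @ u) = \<phi> u" and x: "\<And>c. c \<in> C \<Longrightarrow> x c \<in> words_of_length A s"
  shows "(\<lambda>cs. \<phi> (blocks u x cs)) \<in> monoid_homs (free_monoid C) (local_monoid M T (\<phi> u))" (is "?g \<in> _")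
proof -
  have ul: "u \<in> lists A" using u by (simp add: in_words_of_length)
  have xl: "x c \<in> lists A" if "c \<in> C" for c using x[OF that] by (simp add: in_words_of_length)
  have bl: "blocks u x cs \<in> lists A" if "cs \<in> lists C" for cs
    using blocks_in_lists[of u A C x cs] ul xl that by simp
  have e: "\<phi> u \<in> T" "\<phi> u \<otimes>\<^bsub>M\<^esub> \<phi> u = \<phi> u" using u ul by (auto simp: syn_mult)
  interpret M: monoid M by (rule syn_monoid_monoid)
  have mcl: "\<phi> w \<in> carrier M" if "w \<in> lists A" for w using that by (simp add: syn_carrier)
  have mul: "?g (cs @ cs') = ?g cs \<otimes>\<^bsub>M\<^esub> ?g cs'" if "cs \<in> lists C" "cs' \<in> lists C" for cs cs'
    using that(1)
  proof (induction cs)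
    case Nil
    have "\<phi> u \<otimes>\<^bsub>M\<^esub> ?g cs' = ?g cs'"
    proof (cases cs')
      case (Cons c ds)
      then have "x c \<in> lists A" "blocks u x ds \<in> lists A" using that(2) xl bl by auto
      then have "\<phi> u \<otimes>\<^bsub>M\<^esub> ?g cs' = \<phi> u \<otimes>\<^bsub>M\<^esub> \<phi> u \<otimes>\<^bsub>M\<^esub> \<phi> (x c @ blocks u x ds)"
        using Cons ul by (simp add: syn_mult)
      also have "\<dots> = ?g cs'" using e(2) Cons ul \<open>x c \<in> lists A\<close> \<open>blocks u x ds \<in> lists A\<close>
        by (simp add: syn_mult)
      finally show ?thesis .
    qed (use e in simp)
    then show ?case by simp
  next
    case (Cons c cs)
    have in_l: "x c \<in> lists A" "blocks u x cs \<in> lists A" "blocks u x (cs @ cs') \<in> lists A" "blocks u x cs' \<in> lists A"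
      using Cons xl that(2) bl by auto
    have "?g ((c # cs) @ cs') = \<phi> (u @ x c) \<otimes>\<^bsub>M\<^esub> ?g (cs @ cs')"
      using in_l ul by (simp add: syn_mult)
    also have "\<dots> = \<phi> (u @ x c) \<otimes>\<^bsub>M\<^esub> ?g cs \<otimes>\<^bsub>M\<^esub> ?g cs'"
      using Cons in_l ul mcl M.m_assoc[of "\<phi> (u @ x c)" "?g cs" "?g cs'"] by simp
    finally show ?case using in_l ul by (simp add: syn_mult)
  qed
  note carr = local_monoid_carrier[OF syn_monoid_monoid stable_closed e]
  have "?g cs \<in> carrier (local_monoid M T (\<phi> u))" if "cs \<in> lists C" for cs
  proof -
    have "?g cs \<in> T" using that
    proof (induction cs)
      case (Cons c cs)
      then have "?g (c # cs) = \<phi> u \<otimes>\<^bsub>M\<^esub> (\<phi> (x c) \<otimes>\<^bsub>M\<^esub> ?g cs)"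
        using ul xl bl by (simp add: syn_mult)
      then show ?case using e Cons x stable_closed(2) by (metis image_eqI)
    qed (use e in simp)
    moreover have "\<phi> u \<otimes>\<^bsub>M\<^esub> ?g cs = ?g cs" "?g cs \<otimes>\<^bsub>M\<^esub> \<phi> u = ?g cs"
      using mul[of "[]" cs] mul[of cs "[]"] that by simp_all
    ultimately show ?thesis unfolding carr by simp
  qed
  then show ?thesis
    using mul by (intro free_homI) (auto simp: local_monoid_def)
qed

text \<open>Membership of a block word in \<open>L\<close> depends only on its image in eTe, so eTe
  recognizes the block languages. Conversely, two elements of eTe are distinguished by some context
  in \<open>L\<close>, that is, by some block language; a joint morphism for all pairs has a kernel
  fine enough to make eTe a quotient of a submonoid of a monoid in \<open>V\<close>.\<close>

lemma local_monoid_belongs_iff: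
  assumes V: "variety V" and C: "finite C" "x ` C = words_of_length A s"
    and u: "u \<in> words_of_length A s" "\<phi> (u @ u) = \<phi> u"
  shows "belongs (local_monoid M T (\<phi> u)) V \<longleftrightarrow>
    (\<forall>y\<in>lists A. \<forall>z\<in>lists A. var_recognizable V C (block_lang L y z u x C))"
proof -
  let ?S = "local_monoid M T (\<phi> u)" and ?g = "\<lambda>cs. \<phi> (blocks u x cs)"
  have ul: "u \<in> lists A" using u by (simp add: in_words_of_length)
  have xw: "x c \<in> words_of_length A s" if "c \<in> C" for c using C(2) that by blast
  have xl: "x c \<in> lists A" if "c \<in> C" for c using xw[OF that] by (simp add: in_words_of_length)
  have bl: "blocks u x cs \<in> lists A" if "cs \<in> lists C" for cs
    using blocks_in_lists[of u A C x cs] ul xl that by simp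
  have e: "\<phi> u \<in> T" "\<phi> u \<otimes>\<^bsub>M\<^esub> \<phi> u = \<phi> u" using u ul by (auto simp: syn_mult)
  have S: "monoid ?S" by (rule local_monoid_monoid[OF syn_monoid_monoid stable_closed e])
  have g: "?g \<in> monoid_homs (free_monoid C) ?S" using blocks_morphism[OF u xw] .
  have ctx: "y @ blocks u x cs @ z \<in> L \<longleftrightarrow> y @ w @ z \<in> L"
    if "cs \<in> lists C" "w \<in> lists A" "y \<in> lists A" "z \<in> lists A" "?g cs = \<phi> w" for cs w y z
    using that bl[OF that(1)] syn_morphism_eq_iff[of "blocks u x cs" A w L] by blast
  show ?thesis
  proof (intro iffI ballI)
    fix y z assume "belongs ?S V" "y \<in> lists A" "z \<in> lists A"
    then show "var_recognizable V C (block_lang L y z u x C)"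
      unfolding block_lang_def
      by (intro var_recognizable_of_belongs[OF V _ g _ S]) (use ctx bl in blast)+
  next
    assume rec: "\<forall>y\<in>lists A. \<forall>z\<in>lists A. var_recognizable V C (block_lang L y z u x C)"
    let ?I = "{(a, b) \<in> carrier ?S \<times> carrier ?S. a \<noteq> b}"
    have Tfin: "finite T"
      using word_quotient.finite_image[OF syn_word_quotient[OF reg]] by (rule finite_subset[rotated]) (auto simp: in_words_of_length)
    have Sfin: "finite (carrier ?S)"
      using Tfin unfolding local_monoid_carrier[OF syn_monoid_monoid stable_closed e] by simp
    have onto: "?g ` lists C = carrier ?S"
    proof (rule equalityI)
      show "?g ` lists C \<subseteq> carrier ?S" using free_homD(2)[OF g] by blast
      show "carrier ?S \<subseteq> ?g ` lists C"
      proof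
        fix a assume "a \<in> carrier ?S"
        then have a: "a \<in> T" "\<phi> u \<otimes>\<^bsub>M\<^esub> a = a" "a \<otimes>\<^bsub>M\<^esub> \<phi> u = a"
          unfolding local_monoid_carrier[OF syn_monoid_monoid stable_closed e] by auto
        then obtain c where c: "c \<in> C" "a = \<phi> (x c)" using C(2) by (metis (no_types, lifting) imageE)
        \<comment> \<open>Sequences of one letter already reach all of eTe, as \<open>x\<close> runs
          through all words of length \<open>s\<close>.\<close>
        have "?g [c] = \<phi> u \<otimes>\<^bsub>M\<^esub> (\<phi> (x c) \<otimes>\<^bsub>M\<^esub> \<phi> u)" using c ul xl by (simp add: syn_mult)
        then have "?g [c] = a" using a c by simp
        then show "a \<in> ?g ` lists C" using c by (metis Cons_in_lists_iff image_eqI lists.Nil)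
      qed
    qed
    have "\<exists>M'\<in>V. \<exists>h\<in>monoid_homs (free_monoid C) M'. \<forall>i\<in>?I. \<forall>cs\<in>lists C. \<forall>ds\<in>lists C.
        h cs = h ds \<longrightarrow> \<not> (?g cs = fst i \<and> ?g ds = snd i)"
    proof (rule joint_recognition[OF V])
      show "finite ?I" by (rule finite_subset[of _ "carrier ?S \<times> carrier ?S"]) (use Sfin in auto)
      fix i assume "i \<in> ?I"
      then obtain a b where i: "i = (a, b)" "a \<in> carrier ?S" "b \<in> carrier ?S" "a \<noteq> b" by auto
      obtain cs0 ds0 where ab: "cs0 \<in> lists C" "ds0 \<in> lists C" "a = ?g cs0" "b = ?g ds0"
        using i onto by (metis (no_types, lifting) imageE)
      then obtain y z where yz: "y \<in> lists A" "z \<in> lists A"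
        "y @ blocks u x cs0 @ z \<in> L \<longleftrightarrow> y @ blocks u x ds0 @ z \<notin> L"
        using i(4) syn_morphism_eq_iff[of "blocks u x cs0" A "blocks u x ds0" L] bl by metis
      obtain M' where M': "M' \<in> V" "recognizes M' C (block_lang L y z u x C)"
        using rec yz unfolding var_recognizable_def by blast
      obtain h where h: "h \<in> monoid_homs (free_monoid C) M'"
        "\<And>cs ds. \<lbrakk>cs \<in> lists C; ds \<in> lists C; h cs = h ds; y @ blocks u x cs @ z \<in> L\<rbrakk> \<Longrightarrow> y @ blocks u x ds @ z \<in> L"
        using M'(2) unfolding block_lang_def recognizes_iff[OF varietyD(1)[OF V M'(1)]] by blast
      have "\<not> (?g cs = fst i \<and> ?g ds = snd i)" if "cs \<in> lists C" "ds \<in> lists C" "h cs = h ds" for cs ds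
      proof
        assume "?g cs = fst i \<and> ?g ds = snd i"
        then have "?g cs = \<phi> (blocks u x cs0)" "?g ds = \<phi> (blocks u x ds0)" using i ab by auto
        then have "y @ blocks u x cs @ z \<in> L \<longleftrightarrow> y @ blocks u x cs0 @ z \<in> L"
          "y @ blocks u x ds @ z \<in> L \<longleftrightarrow> y @ blocks u x ds0 @ z \<in> L"
          using ctx[of cs "blocks u x cs0" y z] ctx[of ds "blocks u x ds0" y z] bl that yz ab by simp_all
        then show False using yz(3) h(2)[of cs ds] h(2)[of ds cs] that by auto
      qed
      then show "\<exists>M'\<in>V. \<exists>h\<in>monoid_homs (free_monoid C) M'. \<forall>cs\<in>lists C. \<forall>ds\<in>lists C.
        h cs = h ds \<longrightarrow> \<not> (?g cs = fst i \<and> ?g ds = snd i)" using M'(1) h(1) by blast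
    qed
    then obtain M' h where M': "M' \<in> V" "h \<in> monoid_homs (free_monoid C) M'"
      and sep: "\<And>i cs ds. \<lbrakk>i \<in> ?I; cs \<in> lists C; ds \<in> lists C; h cs = h ds\<rbrakk> \<Longrightarrow> \<not> (?g cs = fst i \<and> ?g ds = snd i)"
      by blast
    show "belongs ?S V"
    proof (rule belongs_of_quotient[OF V S Sfin M'(1,2) g onto])
      fix cs ds assume *: "cs \<in> lists C" "ds \<in> lists C" "h cs = h ds"
      show "?g cs = ?g ds"
      proof (rule ccontr)
        assume "?g cs \<noteq> ?g ds"
        then have "(?g cs, ?g ds) \<in> ?I" using free_homD(2)[OF g] * by auto
        then show False using sep[OF _ *] by fastforce
      qed
    qed
  qed
qed

end

text \<open>
  The fine quotient \<open>f\<close> can be the transition map of a given automaton, so that the criterion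
  does not need the minimal one.
\<close>

lemma stable_local_monoids_iff:
  assumes V: "variety V" and reg: "regular_lang A L"
    and f: "word_quotient A f"
    and fine: "\<And>u v. \<lbrakk>u \<in> lists A; v \<in> lists A; f u = f v\<rbrakk> \<Longrightarrow> syn_morphism A L u = syn_morphism A L v"
    and N: "0 < N" "f ` words_of_length A N = f ` words_of_length A (2 * N)"
    and C: "finite C" "x ` C = words_of_length A N"
  shows "stable_local_monoids_in A L V \<longleftrightarrow>
    (\<forall>u\<in>words_of_length A N. f (u @ u) = f u \<longrightarrow>
      (\<forall>y\<in>lists A. \<forall>z\<in>lists A. var_recognizable V C (block_lang L y z u x C)))"
proof -
  let ?\<phi> = "syn_morphism A L" and ?M = "syn_monoid A L"
  interpret f: word_quotient A f by fact
  interpret syn: word_quotient A ?\<phi> by (rule syn_word_quotient[OF reg])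
  have wl: "w \<in> lists A" if "w \<in> words_of_length A n" for w n using that by (simp add: in_words_of_length)
  have sub: "?\<phi> ` words_of_length A n \<subseteq> ?\<phi> ` words_of_length A m"
    if "f ` words_of_length A n = f ` words_of_length A m" for n m
  proof (rule image_subsetI)
    fix u assume u: "u \<in> words_of_length A n"
    then have "f u \<in> f ` words_of_length A m" using that by blast
    then obtain v where "f u = f v" "v \<in> words_of_length A m" by (rule imageE)
    then show "?\<phi> u \<in> ?\<phi> ` words_of_length A m" using fine[OF wl wl] u by blast
  qed
  have st: "?\<phi> ` words_of_length A N = ?\<phi> ` words_of_length A (2 * N)"
    using sub[OF N(2)] sub[OF N(2)[symmetric]] by blast
  note T = syn.stable_set_eq[OF N(1) st]
  \<comment> \<open>A word that is idempotent for the coarse quotient need not be so for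
    \<open>f\<close>. Some power of it is, without changing the coarse image, and stability brings
    this power back to length \<open>N\<close>.\<close>
  have lift: "\<exists>u\<in>words_of_length A N. f (u @ u) = f u \<and> ?\<phi> u = ?\<phi> v"
    if v: "v \<in> words_of_length A N" "?\<phi> (v @ v) = ?\<phi> v" for v
  proof -
    obtain k where k: "0 < k" "f (concat (replicate k v)) = f (concat (replicate k v) @ concat (replicate k v))"
      using f.idempotent_power[OF wl[OF v(1)]] by blast
    let ?w = "concat (replicate k v)"
    have "?w \<in> words_of_length A (k * N)"
      using v by (simp add: in_words_of_length in_lists_conv_set length_concat sum_list_replicate)
    then obtain u where u: "u \<in> words_of_length A N" "f u = f ?w"
      using f.stable_multiple[OF N(2) k(1)] by (metis imageE imageI)
    have wA: "?w \<in> lists A" using v by (simp add: in_words_of_length in_lists_conv_set)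
    have "f (u @ u) = f (?w @ ?w)" by (rule f.append_cong) (use u wl wA in auto)
    then have "f (u @ u) = f u" using k u by simp
    moreover have "?\<phi> u = ?\<phi> ?w" using fine[OF wl[OF u(1)] wA u(2)] .
    moreover have "?\<phi> ?w = ?\<phi> v" by (rule syn.power_cong[OF wl[OF v(1)] v(2) k(1)])
    ultimately show ?thesis using u(1) by metis
  qed
  have "stable_local_monoids_in A L V \<longleftrightarrow>
    (\<forall>u\<in>words_of_length A N. ?\<phi> (u @ u) = ?\<phi> u \<longrightarrow>
      belongs (local_monoid ?M (?\<phi> ` words_of_length A N) (?\<phi> u)) V)"
  proof -
    have eq: "?\<phi> u \<otimes>\<^bsub>?M\<^esub> ?\<phi> u = ?\<phi> (u @ u)" if "u \<in> words_of_length A N" for u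
      using syn_mult[OF wl[OF that] wl[OF that]] .
    show ?thesis unfolding stable_local_monoids_in_def Let_def T
    proof (intro iffI ballI impI)
      fix u assume *: "\<forall>e\<in>?\<phi> ` words_of_length A N. e \<otimes>\<^bsub>?M\<^esub> e = e \<longrightarrow>
          belongs (local_monoid ?M (?\<phi> ` words_of_length A N) e) V"
        and u: "u \<in> words_of_length A N" "?\<phi> (u @ u) = ?\<phi> u"
      show "belongs (local_monoid ?M (?\<phi> ` words_of_length A N) (?\<phi> u)) V"
        by (rule *[rule_format, OF imageI[OF u(1)]]) (simp only: eq[OF u(1)] u(2))
    next
      fix e assume *: "\<forall>u\<in>words_of_length A N. ?\<phi> (u @ u) = ?\<phi> u \<longrightarrow>
          belongs (local_monoid ?M (?\<phi> ` words_of_length A N) (?\<phi> u)) V"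
        and e: "e \<in> ?\<phi> ` words_of_length A N" "e \<otimes>\<^bsub>?M\<^esub> e = e"
      obtain u where u: "u \<in> words_of_length A N" "e = ?\<phi> u" using e(1) by (rule imageE)
      show "belongs (local_monoid ?M (?\<phi> ` words_of_length A N) e) V"
        using *[rule_format, OF u(1)] e(2) unfolding u(2) eq[OF u(1)] by (simp only: simp_thms)
    qed
  qed
  also have "\<dots> \<longleftrightarrow> (\<forall>u\<in>words_of_length A N. f (u @ u) = f u \<longrightarrow>
      belongs (local_monoid ?M (?\<phi> ` words_of_length A N) (?\<phi> u)) V)"
  proof (intro iffI ballI impI)
    fix u assume *: "\<forall>u\<in>words_of_length A N. ?\<phi> (u @ u) = ?\<phi> u \<longrightarrow>
      belongs (local_monoid ?M (?\<phi> ` words_of_length A N) (?\<phi> u)) V"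
      "u \<in> words_of_length A N" "f (u @ u) = f u"
    then show "belongs (local_monoid ?M (?\<phi> ` words_of_length A N) (?\<phi> u)) V"
      using fine[of "u @ u" u] wl[OF *(2)] by auto
  next
    fix v assume *: "\<forall>u\<in>words_of_length A N. f (u @ u) = f u \<longrightarrow>
      belongs (local_monoid ?M (?\<phi> ` words_of_length A N) (?\<phi> u)) V"
      "v \<in> words_of_length A N" "?\<phi> (v @ v) = ?\<phi> v"
    then show "belongs (local_monoid ?M (?\<phi> ` words_of_length A N) (?\<phi> v)) V"
      using lift[OF *(2,3)] by metis
  qed
  also have "\<dots> \<longleftrightarrow> (\<forall>u\<in>words_of_length A N. f (u @ u) = f u \<longrightarrow>
      (\<forall>y\<in>lists A. \<forall>z\<in>lists A. var_recognizable V C (block_lang L y z u x C)))"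
  proof (intro ball_cong refl imp_cong)
    fix u assume "u \<in> words_of_length A N" "f (u @ u) = f u"
    then show "belongs (local_monoid ?M (?\<phi> ` words_of_length A N) (?\<phi> u)) V \<longleftrightarrow>
      (\<forall>y\<in>lists A. \<forall>z\<in>lists A. var_recognizable V C (block_lang L y z u x C))"
      using fine[of "u @ u" u] wl[of u] by (intro stable_lang.local_monoid_belongs_iff[OF stable_lang.intro[OF reg N(1) st] V C]) auto
  qed
  finally show ?thesis .
qed

lemma finite_words_of_length: "finite A \<Longrightarrow> finite (words_of_length A n)"
  using finite_lists_length_eq[of A n] by (simp add: words_of_length_def lists_eq_set)

text \<open>The words of length \<open>s\<close> that occur in a block language are too short for
  the windows and have the wrong lengths modulo \<open>d\<close>. Exchanging them for words with the
  same images under \<open>syn_morphism\<close> does not alter the block language and makes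
  \<open>block_lang_recognizable\<close> applicable.\<close>

lemma definable_imp_stable_local_monoids:
  assumes \<sigma>: "numerical_signature \<sigma>" and F: "fragment F \<sigma>" and V: "variety V" and cor: "corresponds F V"
    and reg: "regular_lang A L"
    and L: "definable (enrich F \<sigma> (local_preds \<union> all_MOD_preds)) A L"
  shows "stable_local_monoids_in A L V"
proof -
  let ?\<phi> = "syn_morphism A L" and ?s = "lang_stability_index A L"
  interpret syn: word_quotient A ?\<phi> by (rule syn_word_quotient[OF reg])
  note A = regular_lang_finite[OF reg]
  note s = syn.stability_index[folded lang_stability_index_def]
  obtain K d where Kd: "0 < K" "0 < d" and win: "\<And>t. \<exists>\<phi>\<in>F. \<forall>w\<in>lists A. boundary K d w = t \<longrightarrow>
      (w \<in> L \<longleftrightarrow> windows K d 0 w [] \<in> form_lang (window_alphabet A K d) \<phi>)"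
    using definable_imp_windows[OF \<sigma> F A L] by blast
  obtain x :: "nat \<Rightarrow> word" and n where x: "x ` {i. i < n} = words_of_length A ?s"
    using finite_imp_nat_seg_image_inj_on[OF finite_words_of_length[OF A]] by metis
  let ?C = "{i. i < n}"
  have "var_recognizable V ?C (block_lang L y z u x ?C)"
    if u: "u \<in> words_of_length A ?s" "?\<phi> (u @ u) = ?\<phi> u" and yz: "y \<in> lists A" "z \<in> lists A" for u y z
  proof -
    \<comment> \<open>The factor \<open>K\<close> makes the word long enough for the windows, the
      factor \<open>d\<close> makes its length a multiple of \<open>d\<close>; the image is
      unchanged, being idempotent.\<close>
    let ?u = "concat (replicate (K * d) u)"
    have ul: "u \<in> lists A" "?u \<in> lists A" and len: "length ?u = K * d * ?s"
      using u by (simp_all add: in_words_of_length in_lists_conv_set length_concat sum_list_replicate)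
    have \<phi>u: "?\<phi> ?u = ?\<phi> u" by (rule syn.power_cong[OF ul(1) u(2)]) (use Kd in simp)
    have "\<exists>v. v \<in> words_of_length A (d * ?s) \<and> ?\<phi> v = ?\<phi> (x c)" if "c \<in> ?C" for c
    proof -
      have "?\<phi> (x c) \<in> ?\<phi> ` words_of_length A (d * ?s)"
        unfolding syn.stable_multiple[OF s(2) Kd(2)] using x that by blast
      then show ?thesis by (metis imageE)
    qed
    then obtain x' where x': "\<And>c. c \<in> ?C \<Longrightarrow> x' c \<in> words_of_length A (d * ?s) \<and> ?\<phi> (x' c) = ?\<phi> (x c)"
      by metis
    have x'l: "x' c \<in> lists A" "d dvd length (x' c)" "x c \<in> lists A" if "c \<in> ?C" for c
    proof -
      show "x' c \<in> lists A" "d dvd length (x' c)" using x'[OF that] by (auto simp: in_words_of_length)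
      have "x c \<in> words_of_length A ?s" using x that by blast
      then show "x c \<in> lists A" by (simp add: in_words_of_length)
    qed
    have eq: "?\<phi> (blocks ?u x' cs) = ?\<phi> (blocks u x cs)" if "cs \<in> lists ?C" for cs
      using that
    proof (induction cs)
      case (Cons c cs)
      have bl: "blocks ?u x' cs \<in> lists A" "blocks u x cs \<in> lists A"
        using blocks_in_lists[of _ A ?C _ cs] Cons(2) ul x'l by auto
      have "?\<phi> (x' c @ blocks ?u x' cs) = ?\<phi> (x c @ blocks u x cs)"
        by (rule syn.append_cong) (use Cons x' x'l bl in auto)
      then show ?case
        unfolding blocks_simps by (rule syn.append_cong[rotated 5]) (use Cons x'l bl ul \<phi>u in auto)
    qed (simp add: \<phi>u)
    have "block_lang L y z ?u x' ?C = block_lang L y z u x ?C"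
      unfolding block_lang_def
    proof (rule Collect_cong, rule conj_cong[OF refl])
      fix cs assume cs: "cs \<in> lists ?C"
      have "blocks ?u x' cs \<in> lists A" "blocks u x cs \<in> lists A"
        using blocks_in_lists[of _ A ?C _ cs] cs ul x'l by auto
      then show "y @ blocks ?u x' cs @ z \<in> L \<longleftrightarrow> y @ blocks u x cs @ z \<in> L"
        using eq[OF cs] yz by (simp add: syn_morphism_eq_iff)
    qed
    moreover have "var_recognizable V ?C (block_lang L y z ?u x' ?C)"
    proof (rule block_lang_recognizable[OF V cor A Kd(2) win yz ul(2)])
      show "K \<le> length ?u" using Kd s(1) by (simp add: len)
      show "d dvd length ?u" by (simp add: len)
    qed (use x'l in auto)
    ultimately show ?thesis by simp
  qed
  then show ?thesis
    unfolding stable_local_monoids_iff[OF V reg syn.word_quotient_axioms _ s finite_Collect_less_nat x, simplified]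
    by blast
qed

section \<open>The category of idempotents\<close>

locale stable_local_lang = stable_lang A L s for A L s +
  fixes V :: "nat monoid set"
  assumes V: "local_variety V"
    and local_in: "\<And>e. \<lbrakk>e \<in> T; e \<otimes>\<^bsub>M\<^esub> e = e\<rbrakk> \<Longrightarrow> belongs (local_monoid M T e) V"
begin

definition "Idems = {e \<in> T. e \<otimes>\<^bsub>M\<^esub> e = e}"

definition "Hom e f = {e \<otimes>\<^bsub>M\<^esub> t \<otimes>\<^bsub>M\<^esub> f | t. t \<in> T}"

text \<open>
  By the pigeonhole principle, a word of length at least \<open>B s\<close> has a prefix of length \<open>j s\<close> with
  \<open>j < B\<close> whose image is stabilised by an idempotent. Taking the least \<open>j\<close> makes the ends of these
  prefixes move to the right when the first \<open>s\<close> letters are dropped; the word between two such ends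
  yields the arrow \<open>gap w\<close>. All these data depend only on the first \<open>B s + s\<close> letters.
\<close>

definition "B = Suc (card T)"

definition "stabilises e w j \<longleftrightarrow> e \<in> Idems \<and> \<phi> (take (j * s) w) \<otimes>\<^bsub>M\<^esub> e = \<phi> (take (j * s) w)"

definition "cutoff w = (LEAST j. j \<le> B \<and> (\<exists>e. stabilises e w j))"

definition "anchor w = (SOME e. stabilises e w (cutoff w))"

definition "start w = \<phi> (take (cutoff w * s) w)"

definition "long w \<longleftrightarrow> w \<in> lists A \<and> B * s \<le> length w"

definition "gap w = anchor w \<otimes>\<^bsub>M\<^esub> \<phi> (drop (cutoff w * s) (take (Suc (cutoff (drop s w)) * s) w)) \<otimes>\<^bsub>M\<^esub> anchor (drop s w)"

sublocale M: monoid M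
  by (rule syn_monoid_monoid)

sublocale syn: word_quotient A \<phi>
  by (rule syn_word_quotient[OF reg])

lemma phi_closed: "u \<in> lists A \<Longrightarrow> \<phi> u \<in> carrier M"
  by (simp add: syn_carrier)

lemma phi_append: "\<lbrakk>u \<in> lists A; v \<in> lists A\<rbrakk> \<Longrightarrow> \<phi> (u @ v) = \<phi> u \<otimes>\<^bsub>M\<^esub> \<phi> v"
  by (simp add: syn_mult)

lemma phi_Nil: "\<phi> [] = \<one>\<^bsub>M\<^esub>"
  by (simp add: syn_one)

lemmas T_sub = stable_closed(1)

lemma T_mult: "\<lbrakk>a \<in> T; b \<in> T\<rbrakk> \<Longrightarrow> a \<otimes>\<^bsub>M\<^esub> b \<in> T"
  using stable_closed(2) by blast

lemma T_closed: "a \<in> T \<Longrightarrow> a \<in> carrier M"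
  using T_sub by blast

lemma T_multiple:
  assumes "v \<in> lists A" "length v = k * s" "0 < k"
  shows "\<phi> v \<in> T"
  using syn.stable_multiple[of s k] stable assms unfolding in_words_of_length[symmetric]
  by (metis image_eqI in_words_of_length)

lemma finite_T: "finite T"
  using syn.finite_image by (rule finite_subset[rotated]) (auto simp: in_words_of_length)

lemma IdemsD: "e \<in> Idems \<Longrightarrow> e \<in> T" "e \<in> Idems \<Longrightarrow> e \<otimes>\<^bsub>M\<^esub> e = e" "e \<in> Idems \<Longrightarrow> e \<in> carrier M"
  using T_closed by (auto simp: Idems_def)

lemma Hom_iff:
  assumes e: "e \<in> Idems" and f: "f \<in> Idems"
  shows "a \<in> Hom e f \<longleftrightarrow> a \<in> T \<and> e \<otimes>\<^bsub>M\<^esub> a = a \<and> a \<otimes>\<^bsub>M\<^esub> f = a"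
proof
  assume "a \<in> Hom e f"
  then obtain t where t: "t \<in> T" "a = e \<otimes>\<^bsub>M\<^esub> t \<otimes>\<^bsub>M\<^esub> f" unfolding Hom_def by blast
  note c = IdemsD(3)[OF e] IdemsD(3)[OF f] T_closed[OF t(1)]
  have "e \<otimes>\<^bsub>M\<^esub> a = (e \<otimes>\<^bsub>M\<^esub> e) \<otimes>\<^bsub>M\<^esub> t \<otimes>\<^bsub>M\<^esub> f" using c t(2) by (simp only: M.m_assoc M.m_closed)
  moreover have "a \<otimes>\<^bsub>M\<^esub> f = e \<otimes>\<^bsub>M\<^esub> t \<otimes>\<^bsub>M\<^esub> (f \<otimes>\<^bsub>M\<^esub> f)" using c t(2) by (simp only: M.m_assoc M.m_closed)
  ultimately show "a \<in> T \<and> e \<otimes>\<^bsub>M\<^esub> a = a \<and> a \<otimes>\<^bsub>M\<^esub> f = a"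
    using t T_mult IdemsD(1,2)[OF e] IdemsD(1,2)[OF f] by metis
next
  assume "a \<in> T \<and> e \<otimes>\<^bsub>M\<^esub> a = a \<and> a \<otimes>\<^bsub>M\<^esub> f = a"
  then show "a \<in> Hom e f" unfolding Hom_def by (metis (mono_tags, lifting) mem_Collect_eq)
qed

lemma Hom_compose:
  assumes "e \<in> Idems" "f \<in> Idems" "g \<in> Idems" "a \<in> Hom e f" "b \<in> Hom f g"
  shows "a \<otimes>\<^bsub>M\<^esub> b \<in> Hom e g"
proof -
  have ab: "a \<in> T" "b \<in> T" "e \<otimes>\<^bsub>M\<^esub> a = a" "b \<otimes>\<^bsub>M\<^esub> g = b"
    using assms by (simp_all add: Hom_iff)
  note c = T_closed[OF ab(1)] T_closed[OF ab(2)] IdemsD(3)[OF assms(1)] IdemsD(3)[OF assms(3)]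
  have "e \<otimes>\<^bsub>M\<^esub> (a \<otimes>\<^bsub>M\<^esub> b) = a \<otimes>\<^bsub>M\<^esub> b" using M.m_assoc[OF c(3,1,2)] ab(3) by simp
  moreover have "a \<otimes>\<^bsub>M\<^esub> b \<otimes>\<^bsub>M\<^esub> g = a \<otimes>\<^bsub>M\<^esub> b" using M.m_assoc[OF c(1,2,4)] ab(4) by simp
  ultimately show ?thesis using T_mult[OF ab(1,2)] by (simp only: Hom_iff assms simp_thms)
qed

lemma Idem_Hom: "e \<in> Idems \<Longrightarrow> e \<in> Hom e e"
  by (simp add: Hom_iff IdemsD)

text \<open>
  The idempotents of \<open>T\<close> are the objects of a category whose arrows from \<open>e\<close> to \<open>f\<close> are the
  elements of \<open>eTf\<close>. Its local monoids are those of \<open>T\<close>, so by locality it divides a monoid of \<open>V\<close>.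
\<close>

lemma division_exists:
  obtains N \<rho> where "N \<in> V"
    "\<forall>e\<in>Idems. \<forall>f\<in>Idems. \<forall>a\<in>Hom e f. \<rho> e f a \<subseteq> carrier N \<and> \<rho> e f a \<noteq> {}"
    "\<forall>e\<in>Idems. \<forall>f\<in>Idems. \<forall>g\<in>Idems. \<forall>a\<in>Hom e f. \<forall>b\<in>Hom f g. \<forall>m\<in>\<rho> e f a. \<forall>n\<in>\<rho> f g b.
      m \<otimes>\<^bsub>N\<^esub> n \<in> \<rho> e g (a \<otimes>\<^bsub>M\<^esub> b)"
    "\<forall>e\<in>Idems. \<one>\<^bsub>N\<^esub> \<in> \<rho> e e e"
    "\<forall>e\<in>Idems. \<forall>f\<in>Idems. \<forall>a\<in>Hom e f. \<forall>b\<in>Hom e f. a \<noteq> b \<longrightarrow> \<rho> e f a \<inter> \<rho> e f b = {}"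
proof -
  obtain enc :: "word set \<Rightarrow> nat" where enc: "inj_on enc T"
    using finite_imp_inj_to_nat_seg[OF finite_T] by blast
  define dec where "dec = inv_into T enc"
  have dec: "dec (enc a) = a" if "a \<in> T" for a
    using enc that by (simp add: dec_def)
  have HomT: "a \<in> T" if "e \<in> Idems" "f \<in> Idems" "a \<in> Hom e f" for a e f using that by (simp add: Hom_iff)
  \<comment> \<open>Locality speaks of categories on natural numbers, hence the coding. The identity
    arrow at the object \<open>e\<close> is \<open>e\<close> itself, so \<open>ident\<close> is the
    identity function.\<close>
  define C :: "(nat, nat) cat" where "C = \<lparr>obj = enc ` Idems, arr = (\<lambda>x y. enc ` Hom (dec x) (dec y)),
    compose = (\<lambda>_ _ _ f g. enc (dec f \<otimes>\<^bsub>M\<^esub> dec g)), ident = (\<lambda>x. x)\<rparr>"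
  have C: "obj C = enc ` Idems" "compose C x y z f g = enc (dec f \<otimes>\<^bsub>M\<^esub> dec g)" "ident C x = x" for x y z f g
    by (simp_all add: C_def)
  have decI: "dec (enc e) = e" if "e \<in> Idems" for e using dec IdemsD(1)[OF that] by simp
  have arr: "arr C (enc e) (enc f) = enc ` Hom e f" if "e \<in> Idems" "f \<in> Idems" for e f
    using that by (simp add: C_def decI)
  have fin: "finite_category C"
    unfolding finite_category_def C(1) ball_simps(9)
  proof (intro conjI ballI)
    have "Idems \<subseteq> T" by (auto simp: Idems_def)
    then show "finite (enc ` Idems)" using finite_T finite_subset by blast
  next
    fix e f assume "e \<in> Idems" "f \<in> Idems"
    then show "finite (arr C (enc e) (enc f))"
      using finite_subset[OF _ finite_T, of "Hom e f"] HomT by (auto simp: arr)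
  next
    fix e assume "e \<in> Idems"
    then show "ident C (enc e) \<in> arr C (enc e) (enc e)" by (simp add: arr C Idem_Hom)
  next
    fix d e f a b assume *: "d \<in> Idems" "e \<in> Idems" "f \<in> Idems" "a \<in> arr C (enc d) (enc e)" "b \<in> arr C (enc e) (enc f)"
    then obtain a' b' where ab: "a = enc a'" "b = enc b'" "a' \<in> Hom d e" "b' \<in> Hom e f"
      by (auto simp: arr)
    then have "a' \<in> T" "b' \<in> T" using HomT * by blast+
    then show "compose C (enc d) (enc e) (enc f) a b \<in> arr C (enc d) (enc f)"
      using Hom_compose[OF *(1-3) ab(3,4)] unfolding arr[OF *(1,3)] C ab by (simp only: dec imageI)
  next
    fix e f a assume *: "e \<in> Idems" "f \<in> Idems" "a \<in> arr C (enc e) (enc f)"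
    then obtain a' where a: "a = enc a'" "a' \<in> Hom e f" by (auto simp: arr)
    note a' = Hom_iff[OF *(1,2), THEN iffD1, OF a(2)]
    show "compose C (enc e) (enc e) (enc f) (ident C (enc e)) a = a"
      "compose C (enc e) (enc f) (enc f) a (ident C (enc f)) = a"
      using a' decI[OF *(1)] decI[OF *(2)] dec[of a'] by (simp_all only: C a)
  next
    fix d e f g a b c assume *: "d \<in> Idems" "e \<in> Idems" "f \<in> Idems" "g \<in> Idems"
      "a \<in> arr C (enc d) (enc e)" "b \<in> arr C (enc e) (enc f)" "c \<in> arr C (enc f) (enc g)"
    then obtain a' b' c' where abc: "a = enc a'" "b = enc b'" "c = enc c'"
      "a' \<in> Hom d e" "b' \<in> Hom e f" "c' \<in> Hom f g" by (auto simp: arr)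
    have T: "a' \<in> T" "b' \<in> T" "c' \<in> T" using HomT * abc by blast+
    then have "a' \<otimes>\<^bsub>M\<^esub> b' \<in> T" "b' \<otimes>\<^bsub>M\<^esub> c' \<in> T" using T_mult by blast+
    then show "compose C (enc d) (enc f) (enc g) (compose C (enc d) (enc e) (enc f) a b) c =
      compose C (enc d) (enc e) (enc g) a (compose C (enc e) (enc f) (enc g) b c)"
      using T by (simp add: abc C dec M.m_assoc T_closed)
  qed
  have "belongs (cat_local_monoid C (enc e)) V" if e: "e \<in> Idems" for e
  proof -
    have carr: "carrier (local_monoid M T e) = Hom e e"
      by (auto simp: local_monoid_def Hom_def)
    have "dec \<in> iso (cat_local_monoid C (enc e)) (local_monoid M T e)"
    proof (rule isoI)
      have cc: "carrier (cat_local_monoid C (enc e)) = enc ` Hom e e"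
        by (simp add: cat_local_monoid_def arr[OF e e])
      show "dec \<in> hom (cat_local_monoid C (enc e)) (local_monoid M T e)"
        unfolding hom_def carr cc
      proof (intro CollectI conjI ballI funcsetI)
        fix x y assume "x \<in> enc ` Hom e e" "y \<in> enc ` Hom e e"
        then obtain a b where ab': "x = enc a" "y = enc b" "a \<in> Hom e e" "b \<in> Hom e e" by (elim imageE)
        note ab = ab'(1,2) HomT[OF e e ab'(3)] HomT[OF e e ab'(4)]
        show "dec (x \<otimes>\<^bsub>cat_local_monoid C (enc e)\<^esub> y) = dec x \<otimes>\<^bsub>local_monoid M T e\<^esub> dec y"
          by (simp add: cat_local_monoid_def local_monoid_def C ab(1,2) dec[OF ab(3)] dec[OF ab(4)] dec[OF T_mult[OF ab(3,4)]])
      next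
        fix x assume "x \<in> enc ` Hom e e"
        then show "dec x \<in> Hom e e" using HomT e dec by auto
      qed
      show "bij_betw dec (carrier (cat_local_monoid C (enc e))) (carrier (local_monoid M T e))"
        unfolding carr cc using HomT e dec by (intro bij_betwI[where g = enc]) auto
    qed
    then have "cat_local_monoid C (enc e) \<cong> local_monoid M T e" by (rule is_isoI)
    moreover have "belongs (local_monoid M T e) V"
      using local_in IdemsD(1,2)[OF e] by blast
    ultimately show ?thesis unfolding belongs_def by (blast intro: iso_trans)
  qed
  then have "C \<in> locally_cats V" using fin by (simp add: locally_cats_def C)
  then have "C \<in> global_cats V" using V unfolding local_variety_def by simp
  then obtain N t \<tau> where N: "N \<in> V" "category_division t \<tau> C (monoid_cat N)"
    unfolding global_cats_def category_divides_def by blast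
  note D = N(2)[unfolded category_division_def C(1) ball_simps(9)]
  show thesis
  proof (rule that[OF N(1), of "\<lambda>e f a. \<tau> (enc e) (enc f) (enc a)"]; intro ballI impI)
    fix e f a assume *: "e \<in> Idems" "f \<in> Idems" "a \<in> Hom e f"
    then show "\<tau> (enc e) (enc f) (enc a) \<subseteq> carrier N \<and> \<tau> (enc e) (enc f) (enc a) \<noteq> {}"
      using D[THEN conjunct2, THEN conjunct1, rule_format, of e f "enc a"]
      by (simp add: arr monoid_cat_def)
    fix b assume b: "b \<in> Hom e f" "a \<noteq> b"
    have "enc a \<noteq> enc b" using b * HomT enc by (metis inj_onD)
    then show "\<tau> (enc e) (enc f) (enc a) \<inter> \<tau> (enc e) (enc f) (enc b) = {}"
      using D[THEN conjunct2, THEN conjunct2, THEN conjunct2, THEN conjunct2, rule_format, of e f "enc a" "enc b"] * b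
      by (simp add: arr)
  next
    fix e f g a b m n
    assume *: "e \<in> Idems" "f \<in> Idems" "g \<in> Idems" "a \<in> Hom e f" "b \<in> Hom f g"
      "m \<in> \<tau> (enc e) (enc f) (enc a)" "n \<in> \<tau> (enc f) (enc g) (enc b)"
    have "a \<in> T" "b \<in> T" using * HomT by blast+
    then show "m \<otimes>\<^bsub>N\<^esub> n \<in> \<tau> (enc e) (enc g) (enc (a \<otimes>\<^bsub>M\<^esub> b))"
      using D[THEN conjunct2, THEN conjunct2, THEN conjunct1, rule_format, of e f g "enc a" "enc b" m n] *
      by (simp add: arr monoid_cat_def C dec)
  next
    fix e assume "e \<in> Idems"
    then show "\<one>\<^bsub>N\<^esub> \<in> \<tau> (enc e) (enc e) (enc e)"
      using D[THEN conjunct2, THEN conjunct2, THEN conjunct2, THEN conjunct1, rule_format, of e]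
      by (simp add: monoid_cat_def C)
  qed
qed

section \<open>Idempotent anchors and the gaps between them\<close>

text \<open>The bound \<open>j\<close> \<le> \<open>B\<close> inside the \<open>LEAST\<close>
  confines the search to prefixes of length at most \<open>B * s\<close>.\<close>

lemma cutoff_cong:
  assumes "take (B * s) w = take (B * s) w'"
  shows "cutoff w = cutoff w'" and "cutoff w \<le> B \<Longrightarrow> anchor w = anchor w'" and "cutoff w \<le> B \<Longrightarrow> start w = start w'"
proof -
  have tk: "take (j * s) w = take (j * s) w'" if "j \<le> B" for j
  proof -
    have "j * s \<le> B * s" using that by simp
    then show ?thesis using assms by (metis min.absorb1 take_take)
  qed
  have st: "stabilises e w j \<longleftrightarrow> stabilises e w' j" if "j \<le> B" for e j
    using tk[OF that] by (simp add: stabilises_def)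
  have "(\<lambda>j. j \<le> B \<and> (\<exists>e. stabilises e w j)) = (\<lambda>j. j \<le> B \<and> (\<exists>e. stabilises e w' j))"
    using st by blast
  then show cutoff: "cutoff w = cutoff w'" unfolding cutoff_def by (rule arg_cong)
  show "anchor w = anchor w'" if "cutoff w \<le> B"
    using st[OF that] unfolding anchor_def cutoff[symmetric] by presburger
  show "start w = start w'" if "cutoff w \<le> B"
    using tk[OF that] unfolding start_def cutoff[symmetric] by simp
qed

text \<open>The \<open>B\<close> = |T| + 1 nonempty prefixes of lengths \<open>j * s\<close>,
  \<open>j\<close> \<le> \<open>B\<close>, have images in \<open>T\<close>, so two of them agree.
  The factor between their ends fixes the image of the shorter prefix, and so does its idempotent
  power, which lies in \<open>T\<close> because its length is a multiple of
  \<open>s\<close>.\<close>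

lemma stabilises_exists:
  assumes w: "long w"
  shows "\<exists>j<B. \<exists>e. stabilises e w j"
proof -
  let ?p = "\<lambda>j. \<phi> (take (j * s) w)"
  have wA: "w \<in> lists A" using w by (simp add: long_def)
  have "\<not> inj_on ?p {1..B}"
  proof
    assume "inj_on ?p {1..B}"
    moreover have "?p ` {1..B} \<subseteq> T"
    proof (rule image_subsetI)
      fix j assume j: "j \<in> {1..B}"
      then have "j * s \<le> B * s" by (intro mult_le_mono1) simp
      then have "length (take (j * s) w) = j * s"
        using w unfolding long_def length_take by linarith
      then show "?p j \<in> T" using j take_in_lists[OF wA] by (intro T_multiple[of _ j]) auto
    qed
    ultimately have "card {1..B} \<le> card T" by (rule card_inj_on_le[OF _ _ finite_T])
    then show False by (simp add: B_def)
  qed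
  then obtain i j where ij: "1 \<le> i" "i < j" "j \<le> B" "?p i = ?p j"
    unfolding inj_on_def by (metis atLeastAtMost_iff nat_neq_iff)
  let ?v = "drop (i * s) (take (j * s) w)"
  have v: "?v \<in> lists A" "length ?v = (j - i) * s"
  proof -
    show "?v \<in> lists A" using wA by (simp add: take_in_lists drop_in_lists del: drop_take)
    have "j * s \<le> B * s" using ij by (intro mult_le_mono1) simp
    then show "length ?v = (j - i) * s"
      using w unfolding long_def length_take length_drop diff_mult_distrib by linarith
  qed
  have "i * s \<le> j * s" using ij by simp
  then have "take (j * s) w = take (i * s) w @ ?v"
    by (metis append_take_drop_id min.absorb1 take_take)
  then have pv: "?p i \<otimes>\<^bsub>M\<^esub> \<phi> ?v = ?p i"
    using ij(4) phi_append[OF take_in_lists[OF wA] v(1)] by metis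
  obtain k where k: "0 < k" "\<phi> (concat (replicate k ?v)) = \<phi> (concat (replicate k ?v) @ concat (replicate k ?v))"
    using syn.idempotent_power[OF v(1)] by blast
  have rl: "concat (replicate m ?v) \<in> lists A" for m using v(1) by (auto simp: in_lists_conv_set)
  have "?p i \<otimes>\<^bsub>M\<^esub> \<phi> (concat (replicate m ?v)) = ?p i" for m
  proof (induction m)
    case 0
    then show ?case using phi_closed[OF take_in_lists[OF wA]] by (simp add: phi_Nil)
  next
    case (Suc m)
    have "?p i \<otimes>\<^bsub>M\<^esub> \<phi> (concat (replicate (Suc m) ?v)) = ?p i \<otimes>\<^bsub>M\<^esub> \<phi> ?v \<otimes>\<^bsub>M\<^esub> \<phi> (concat (replicate m ?v))"
      using phi_append[OF v(1) rl] phi_closed[OF take_in_lists[OF wA]] phi_closed[OF v(1)] phi_closed[OF rl]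
      by (simp add: M.m_assoc)
    then show ?case using Suc pv by simp
  qed
  moreover have "\<phi> (concat (replicate k ?v)) \<in> T"
  proof (rule T_multiple[OF rl])
    show "length (concat (replicate k ?v)) = k * (j - i) * s"
      using v(2) by (simp only: length_concat map_replicate sum_list_replicate mult.assoc) simp
    show "0 < k * (j - i)" using k(1) ij by simp
  qed
  moreover have "\<phi> (concat (replicate k ?v)) \<otimes>\<^bsub>M\<^esub> \<phi> (concat (replicate k ?v)) = \<phi> (concat (replicate k ?v))"
    unfolding phi_append[OF rl rl, symmetric] by (rule k(2)[symmetric])
  ultimately have "stabilises (\<phi> (concat (replicate k ?v))) w i"
    unfolding stabilises_def Idems_def by (simp only: mem_Collect_eq simp_thms)
  then show ?thesis using ij by (intro exI[of _ i]) auto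
qed

lemma cutoff_props:
  assumes w: "long w"
  shows "cutoff w < B" and "anchor w \<in> Idems" and "start w \<otimes>\<^bsub>M\<^esub> anchor w = start w" and "start w \<in> carrier M"
proof -
  obtain j where j: "j < B" "\<exists>e. stabilises e w j" using stabilises_exists[OF w] by blast
  then have *: "j \<le> B \<and> (\<exists>e. stabilises e w j)" by simp
  have "cutoff w \<le> j" unfolding cutoff_def
    by (rule Least_le[where P = "\<lambda>j. j \<le> B \<and> (\<exists>e. stabilises e w j)", OF *])
  moreover have "cutoff w \<le> B \<and> (\<exists>e. stabilises e w (cutoff w))" unfolding cutoff_def
    by (rule LeastI[where P = "\<lambda>j. j \<le> B \<and> (\<exists>e. stabilises e w j)", OF *])
  then have "stabilises (anchor w) w (cutoff w)" unfolding anchor_def by (metis someI_ex)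
  ultimately have "stabilises (anchor w) w (cutoff w)" "cutoff w < B" using j by auto
  then show "cutoff w < B" "anchor w \<in> Idems" "start w \<otimes>\<^bsub>M\<^esub> anchor w = start w"
    by (auto simp: stabilises_def start_def)
  show "start w \<in> carrier M" using w phi_closed take_in_lists unfolding start_def long_def by blast
qed

text \<open>The gap reads the factor between the anchor position of \<open>w\<close> and that of
  \<open>drop s w\<close>. The equation moves \<open>start\<close> one block to the right; iterated,
  it writes the image of a long word as a start, a product of gaps and a remainder.\<close>

lemma gap_props:
  assumes w: "w \<in> lists A" "Suc B * s \<le> length w"
  shows "gap w \<in> Hom (anchor w) (anchor (drop s w))"
    and "start w \<otimes>\<^bsub>M\<^esub> gap w = \<phi> (take s w) \<otimes>\<^bsub>M\<^esub> start (drop s w)"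
proof -
  let ?w' = "drop s w"
  have lw: "long w" "long ?w'" using w by (auto simp: long_def drop_in_lists)
  note p = cutoff_props[OF lw(1)] and p' = cutoff_props[OF lw(2)]
  have tk: "take (Suc (cutoff ?w') * s) w = take s w @ take (cutoff ?w' * s) ?w'"
    by (simp add: take_add)
  have in_l: "take n w \<in> lists A" "take n ?w' \<in> lists A" for n using w by (simp_all add: take_in_lists drop_in_lists)
  \<comment> \<open>Stabilisation survives prepending \<open>s\<close> letters. As the cutoff of
    \<open>?w'\<close> is strictly below \<open>B\<close>, its successor still satisfies the bound
    \<open>B\<close> in the definition of \<open>cutoff w\<close>, so minimality yields that the
    anchor positions do not move to the left.\<close>
  have "stabilises (anchor ?w') w (Suc (cutoff ?w'))"
    unfolding stabilises_def tk
    using p'(2,3,4) phi_append[OF in_l] M.m_assoc phi_closed[OF in_l(1)] IdemsD(3)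
    by (simp add: start_def[symmetric])
  then have le: "cutoff w \<le> Suc (cutoff ?w')"
    using p'(1) unfolding cutoff_def[of w] by (intro Least_le) auto
  let ?r = "drop (cutoff w * s) (take (Suc (cutoff ?w') * s) w)"
  have lem: "cutoff w * s \<le> Suc (cutoff ?w') * s" using le by (rule mult_le_mono1)
  have r: "?r \<in> lists A" "take (cutoff w * s) w @ ?r = take s w @ take (cutoff ?w' * s) ?w'"
  proof -
    show "?r \<in> lists A" using in_l by (simp only: drop_in_lists)
    have "take (cutoff w * s) w = take (cutoff w * s) (take (Suc (cutoff ?w') * s) w)" using lem by (simp add: min.absorb1)
    then show "take (cutoff w * s) w @ ?r = take s w @ take (cutoff ?w' * s) ?w'"
      by (metis append_take_drop_id tk)
  qed
  have len: "length ?r = (Suc (cutoff ?w') - cutoff w) * s"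
  proof -
    have "Suc (cutoff ?w') * s \<le> Suc B * s" using p'(1) by (intro mult_le_mono1) simp
    then show ?thesis
      using w(2) unfolding length_drop length_take diff_mult_distrib by linarith
  qed
  note cl = IdemsD(3)[OF p(2)] IdemsD(3)[OF p'(2)] phi_closed[OF r(1)]
  show "gap w \<in> Hom (anchor w) (anchor ?w')"
  proof (cases "Suc (cutoff ?w') - cutoff w = 0")
    \<comment> \<open>The two anchor positions coincide; the product of the two idempotents is still
      an arrow, with the first idempotent inserted as the element of \<open>T\<close>.\<close>
    case True
    then have r0: "?r = []" using len by simp
    have "gap w = anchor w \<otimes>\<^bsub>M\<^esub> anchor w \<otimes>\<^bsub>M\<^esub> anchor ?w'"
      unfolding gap_def r0 using cl IdemsD(2)[OF p(2)] by (simp add: phi_Nil)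
    then show ?thesis unfolding Hom_def using IdemsD(1)[OF p(2)] by blast
  next
    case False
    then have "\<phi> ?r \<in> T" using T_multiple[OF r(1) len] by simp
    then show ?thesis unfolding Hom_def gap_def by blast
  qed
  have "start w \<otimes>\<^bsub>M\<^esub> gap w = (start w \<otimes>\<^bsub>M\<^esub> anchor w) \<otimes>\<^bsub>M\<^esub> \<phi> ?r \<otimes>\<^bsub>M\<^esub> anchor ?w'"
    unfolding gap_def using cl p(4) by (simp only: M.m_assoc M.m_closed)
  also have "\<dots> = \<phi> (take (cutoff w * s) w @ ?r) \<otimes>\<^bsub>M\<^esub> anchor ?w'"
    unfolding p(3) unfolding phi_append[OF in_l(1) r(1)] start_def ..
  also have "\<dots> = \<phi> (take s w) \<otimes>\<^bsub>M\<^esub> (start ?w' \<otimes>\<^bsub>M\<^esub> anchor ?w')"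
    unfolding r(2) phi_append[OF in_l] start_def[symmetric]
    using cl phi_closed[OF in_l(1)] p'(4) by (simp add: M.m_assoc)
  finally show "start w \<otimes>\<^bsub>M\<^esub> gap w = \<phi> (take s w) \<otimes>\<^bsub>M\<^esub> start ?w'" unfolding p'(3) .
qed

text \<open>Length \<open>Suc B * s\<close> leaves \<open>B * s\<close> letters to find the anchor
  after the first \<open>s\<close> letters are dropped, and the factor read by the gap also ends
  within it.\<close>

lemma window_props:
  assumes w: "w \<in> lists A" "Suc B * s \<le> length w" and u: "u = take (Suc B * s) w"
  shows "anchor u = anchor w" and "anchor (drop s u) = anchor (drop s w)" and "gap u = gap w"
proof -
  have lw: "long w" "long (drop s w)" using w by (auto simp: long_def drop_in_lists)
  have t: "take (B * s) w = take (B * s) u" "take (B * s) (drop s w) = take (B * s) (drop s u)"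
    unfolding u by (simp_all add: min.absorb1 drop_take)
  note c = cutoff_cong[OF t(1)] cutoff_cong[OF t(2)]
  have b: "cutoff w \<le> B" "cutoff (drop s w) \<le> B" using cutoff_props(1)[OF lw(1)] cutoff_props(1)[OF lw(2)] by auto
  show a: "anchor u = anchor w" "anchor (drop s u) = anchor (drop s w)" using c b by simp_all
  have "Suc (cutoff (drop s w)) * s \<le> Suc B * s" using b(2) by (intro mult_le_mono1) simp
  then have "take (Suc (cutoff (drop s w)) * s) w = take (Suc (cutoff (drop s w)) * s) u"
    unfolding u by (simp only: take_take min.absorb1)
  then show "gap u = gap w" unfolding gap_def a using c by simp
qed

text \<open>Each full window at a multiple of \<open>s\<close> is sent to an element related to its
  gap by the division, every other letter to the identity. The product is then related to the
  product of the gaps. The boundary fixes the start and the remainder of the word, and disjointness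
  of the division recovers the product of the gaps, hence the image of the word.\<close>

lemma windows_separate:
  obtains N h where "N \<in> V" "h \<in> monoid_homs (free_monoid (window_alphabet A (Suc B * s) s)) N"
    "\<And>w w'. \<lbrakk>w \<in> lists A; w' \<in> lists A; boundary (Suc B * s) s w = boundary (Suc B * s) s w';
      h (windows (Suc B * s) s 0 w []) = h (windows (Suc B * s) s 0 w' [])\<rbrakk> \<Longrightarrow> w \<in> L \<longleftrightarrow> w' \<in> L"
proof -
  define K where "K = Suc B * s"
  have K: "K = B * s + s" by (simp add: K_def)
  let ?W = "\<lambda>w. windows K s 0 w []" and ?C = "window_alphabet A K s"
  obtain N \<rho> where N: "N \<in> V"
    and \<rho>': "\<forall>e\<in>Idems. \<forall>f\<in>Idems. \<forall>a\<in>Hom e f. \<rho> e f a \<subseteq> carrier N \<and> \<rho> e f a \<noteq> {}"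
    and mult': "\<forall>e\<in>Idems. \<forall>f\<in>Idems. \<forall>g\<in>Idems. \<forall>a\<in>Hom e f. \<forall>b\<in>Hom f g. \<forall>m\<in>\<rho> e f a. \<forall>n\<in>\<rho> f g b.
      m \<otimes>\<^bsub>N\<^esub> n \<in> \<rho> e g (a \<otimes>\<^bsub>M\<^esub> b)"
    and one': "\<forall>e\<in>Idems. \<one>\<^bsub>N\<^esub> \<in> \<rho> e e e"
    and disj': "\<forall>e\<in>Idems. \<forall>f\<in>Idems. \<forall>a\<in>Hom e f. \<forall>b\<in>Hom e f. a \<noteq> b \<longrightarrow> \<rho> e f a \<inter> \<rho> e f b = {}"
    by (rule division_exists)
  note \<rho> = \<rho>'[rule_format] and mult = mult'[rule_format] and one = one'[rule_format] and disj = disj'[rule_format]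
  interpret N: monoid N using V N varietyD(1) unfolding local_variety_def by blast
  \<comment> \<open>A window letter holds \<open>K\<close> letters, enough to compute both anchors
    and the gap; truncated windows and positions off the multiples of \<open>s\<close> get the
    neutral value.\<close>
  define lt where "lt c = (case prod_decode c of (u, i) \<Rightarrow> let u = list_decode u in
     if i = 0 \<and> u \<in> lists A \<and> length u = K then (SOME m. m \<in> \<rho> (anchor u) (anchor (drop s u)) (gap u)) else \<one>\<^bsub>N\<^esub>)" for c
  have lt: "lt (prod_encode (list_encode u, 0)) \<in> \<rho> (anchor u) (anchor (drop s u)) (gap u)"
    "gap u \<in> Hom (anchor u) (anchor (drop s u))" "anchor u \<in> Idems" "anchor (drop s u) \<in> Idems"
    if u: "u \<in> lists A" "length u = K" for u
  proof -
    have "long u" "long (drop s u)" using u K by (auto simp: long_def drop_in_lists)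
    then show *: "gap u \<in> Hom (anchor u) (anchor (drop s u))" "anchor u \<in> Idems" "anchor (drop s u) \<in> Idems"
      using gap_props(1)[folded K_def, of u] u cutoff_props(2) by auto
    then show "lt (prod_encode (list_encode u, 0)) \<in> \<rho> (anchor u) (anchor (drop s u)) (gap u)"
      using \<rho>[of "anchor u" "anchor (drop s u)" "gap u"] u by (auto simp: lt_def intro: someI)
  qed
  have lt1: "lt (prod_encode (list_encode u, i)) = \<one>\<^bsub>N\<^esub>" if "i \<noteq> 0 \<or> length u < K" for u i
    using that by (auto simp: lt_def)
  have lt_closed: "lt c \<in> carrier N" for c
  proof -
    obtain u i where c: "c = prod_encode (list_encode u, i)"
      by (metis list_decode_inverse prod_decode_inverse prod.exhaust)
    show ?thesis
    proof (cases "i = 0 \<and> u \<in> lists A \<and> length u = K")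
      case True
      then show ?thesis using lt[of u] \<rho>[of "anchor u" "anchor (drop s u)" "gap u"] c by blast
    next
      case False
      then have "lt c = \<one>\<^bsub>N\<^esub>" using c by (auto simp: lt_def)
      then show ?thesis by simp
    qed
  qed
  define h where "h = (\<lambda>w. foldr (\<lambda>a m. lt a \<otimes>\<^bsub>N\<^esub> m) w \<one>\<^bsub>N\<^esub>)"
  have h: "h \<in> monoid_homs (free_monoid ?C) N"
    unfolding h_def by (rule free_hom_exists[OF N.monoid_axioms lt_closed])
  have h1: "h w = \<one>\<^bsub>N\<^esub>" if "\<forall>c\<in>set w. lt c = \<one>\<^bsub>N\<^esub>" for w
    using that unfolding h_def by (induction w) auto
  \<comment> \<open>\<open>m\<close> counts the full windows at multiples of \<open>s\<close>; what
    remains after \<open>m * s\<close> letters has length at least \<open>B * s\<close> and less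
    than \<open>Suc B * s\<close>, so it still has an anchor. \<open>x\<close> is the product of the
    \<open>m\<close> gaps.\<close>
  have main: "\<exists>x \<in> Hom (anchor w) (anchor (drop (m * s) w)). h (?W w) \<in> \<rho> (anchor w) (anchor (drop (m * s) w)) x \<and>
      \<phi> w = start w \<otimes>\<^bsub>M\<^esub> x \<otimes>\<^bsub>M\<^esub> \<phi> (drop (cutoff (drop (m * s) w) * s) (drop (m * s) w))"
    if "w \<in> lists A" "(B + m) * s \<le> length w" "length w < (Suc B + m) * s" for w m
    using that
  proof (induction m arbitrary: w)
    case 0
    then have lw: "long w" by (simp add: long_def)
    note p = cutoff_props[OF lw]
    have "\<forall>c\<in>set (?W w). lt c = \<one>\<^bsub>N\<^esub>"
    proof
      fix c assume "c \<in> set (?W w)"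
      then obtain q where "q < length w" "c = ?W w ! q" by (auto simp: in_set_conv_nth)
      then have "c = prod_encode (list_encode (take K (drop q w)), q mod s)" by (simp add: nth_windows)
      moreover have "length (take K (drop q w)) < K" using 0 K by (simp add: add.commute)
      ultimately show "lt c = \<one>\<^bsub>N\<^esub>" using lt1[of "q mod s" "take K (drop q w)"] by metis
    qed
    then have "h (?W w) = \<one>\<^bsub>N\<^esub>" by (rule h1)
    moreover have "\<phi> w = start w \<otimes>\<^bsub>M\<^esub> \<phi> (drop (cutoff w * s) w)"
      unfolding start_def using phi_append[OF take_in_lists[OF 0(1)] drop_in_lists[OF 0(1)]] by (metis append_take_drop_id)
    \<comment> \<open>Without full windows the product of gaps is empty: the identity of
      \<open>N\<close> is related to the identity arrow at the anchor, which \<open>start w\<close>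
      absorbs.\<close>
    ultimately show ?case using Idem_Hom[OF p(2)] one[OF p(2)] p(3) by (intro bexI[of _ "anchor w"]) simp_all
  next
    case (Suc m)
    let ?w' = "drop s w" and ?b = "take s w" and ?u = "take K w"
    have lw: "K \<le> length w" using Suc.prems(2) K by (simp add: algebra_simps)
    have s_le: "s \<le> length w" using lw K by simp
    have w': "?w' \<in> lists A" "(B + m) * s \<le> length ?w'" "length ?w' < (Suc B + m) * s"
      using Suc.prems s_le by (auto simp: drop_in_lists algebra_simps)
    let ?z = "drop (m * s) ?w'"
    have z: "drop (Suc m * s) w = ?z" by (simp add: add.commute)
    obtain x where x: "x \<in> Hom (anchor ?w') (anchor ?z)" "h (?W ?w') \<in> \<rho> (anchor ?w') (anchor ?z) x"
      "\<phi> ?w' = start ?w' \<otimes>\<^bsub>M\<^esub> x \<otimes>\<^bsub>M\<^esub> \<phi> (drop (cutoff ?z * s) ?z)"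
      using Suc.IH[OF w'] by blast
    have uu: "?u \<in> lists A" "length ?u = K" using lw Suc.prems(1) by (simp_all add: take_in_lists)
    note wp = window_props[folded K_def, OF Suc.prems(1) lw refl]
    have "B * s + m * s \<le> length ?w'" using w'(2) by (simp only: add_mult_distrib)
    then have lz: "long ?z"
      using drop_in_lists[OF w'(1), of "m * s"] by (simp add: long_def del: drop_drop)
    note zI = cutoff_props(2)[OF lz]
    have la: "lt (prod_encode (list_encode ?u, 0)) \<in> \<rho> (anchor w) (anchor ?w') (gap w)"
      "gap w \<in> Hom (anchor w) (anchor ?w')" "anchor w \<in> Idems" "anchor ?w' \<in> Idems"
      using lt[OF uu] unfolding wp by simp_all
    have "h (windows K s 0 ?b ?w') = lt (prod_encode (list_encode ?u, 0))"
    proof -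
      obtain a b where ab: "w = a # b" using lw s_pos K by (cases w) auto
      obtain s' where s': "s = Suc s'" using s_pos by (cases s) auto
      have eq: "windows K s 0 ?b ?w' = prod_encode (list_encode ?u, 0) # windows K s 1 (take s' b) ?w'"
        by (simp add: ab s')
      \<comment> \<open>Only the first of the \<open>s\<close> positions of a block is a multiple of
        \<open>s\<close>.\<close>
      have "\<forall>c\<in>set (windows K s 1 (take s' b) ?w'). lt c = \<one>\<^bsub>N\<^esub>"
      proof
        fix c assume "c \<in> set (windows K s 1 (take s' b) ?w')"
        then obtain q where q: "q < length (take s' b)" "c = windows K s 1 (take s' b) ?w' ! q"
          by (auto simp: in_set_conv_nth)
        then have "(1 + q) mod s \<noteq> 0" using s' by simp
        then show "lt c = \<one>\<^bsub>N\<^esub>" unfolding q(2) nth_windows[OF q(1)] using lt1 by blast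
      qed
      then have "h (windows K s 1 (take s' b) ?w') = \<one>\<^bsub>N\<^esub>" by (rule h1)
      then show ?thesis unfolding eq using lt_closed by (simp add: h_def)
    qed
    moreover have "?W w = windows K s 0 ?b ?w' @ ?W ?w'"
    proof -
      have "?W (?b @ ?w') = windows K s 0 ?b (?w' @ []) @ windows K s (0 + length ?b) ?w' []"
        by (rule windows_append)
      moreover have "windows K s (0 + length ?b) ?w' [] = ?W ?w'"
        by (rule windows_cong) (use s_le in auto)
      ultimately show ?thesis by simp
    qed
    moreover have "windows K s 0 ?b ?w' \<in> lists ?C" "?W ?w' \<in> lists ?C"
      using windows_in s_pos w'(1) take_in_lists[OF Suc.prems(1)] by auto
    ultimately have hw: "h (?W w) = lt (prod_encode (list_encode ?u, 0)) \<otimes>\<^bsub>N\<^esub> h (?W ?w')"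
      using free_homD(3)[OF h] by simp
    have "h (?W w) \<in> \<rho> (anchor w) (anchor ?z) (gap w \<otimes>\<^bsub>M\<^esub> x)"
      unfolding hw by (rule mult[OF la(3,4) zI la(2) x(1) la(1) x(2)])
    moreover have "gap w \<otimes>\<^bsub>M\<^esub> x \<in> Hom (anchor w) (anchor ?z)"
      by (rule Hom_compose[OF la(3,4) zI la(2) x(1)])
    moreover have "\<phi> w = start w \<otimes>\<^bsub>M\<^esub> (gap w \<otimes>\<^bsub>M\<^esub> x) \<otimes>\<^bsub>M\<^esub> \<phi> (drop (cutoff ?z * s) ?z)"
    proof -
      have c: "start w \<in> carrier M" "gap w \<in> carrier M" "x \<in> carrier M" "\<phi> (drop (cutoff ?z * s) ?z) \<in> carrier M"
        "start ?w' \<in> carrier M" "\<phi> ?b \<in> carrier M"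
        using cutoff_props(4)[of w] cutoff_props(4)[of ?w'] Suc.prems(1) lw w' la x(1) zI
        by (auto simp: long_def Hom_iff T_closed phi_closed take_in_lists drop_in_lists algebra_simps simp del: drop_drop)
      have "\<phi> w = \<phi> ?b \<otimes>\<^bsub>M\<^esub> \<phi> ?w'"
        using phi_append[OF take_in_lists[OF Suc.prems(1)] drop_in_lists[OF Suc.prems(1)], of s s] by simp
      also have "\<dots> = (\<phi> ?b \<otimes>\<^bsub>M\<^esub> start ?w') \<otimes>\<^bsub>M\<^esub> x \<otimes>\<^bsub>M\<^esub> \<phi> (drop (cutoff ?z * s) ?z)"
        unfolding x(3) using c by (simp only: M.m_assoc M.m_closed)
      also have "\<dots> = start w \<otimes>\<^bsub>M\<^esub> (gap w \<otimes>\<^bsub>M\<^esub> x) \<otimes>\<^bsub>M\<^esub> \<phi> (drop (cutoff ?z * s) ?z)"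
        unfolding gap_props(2)[folded K_def, OF Suc.prems(1) lw, symmetric] using c by (simp only: M.m_assoc M.m_closed)
      finally show ?thesis .
    qed
    ultimately show ?case unfolding z by blast
  qed
  show thesis
  proof (rule that[folded K_def, OF N h])
    fix w w' assume w: "w \<in> lists A" "w' \<in> lists A" "boundary K s w = boundary K s w'" "h (?W w) = h (?W w')"
    from w(3) have b: "take K w = take K w'" "take K (rev w) = take K (rev w')" "length w mod s = length w' mod s"
      unfolding boundary_def by auto
    show "w \<in> L \<longleftrightarrow> w' \<in> L"
    proof (cases "length w < K")
      case True
      then have "length (take K w') < K" unfolding b(1)[symmetric] by simp
      then have "w = w'" using True b(1) by simp
      then show ?thesis by simp
    next
      case False
      then have len: "K \<le> length w" "K \<le> length w'"
        using arg_cong[OF b(1), of length] by (simp_all add: min_def split: if_splits)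
      \<comment> \<open>The remainder has length \<open>B * s\<close> plus the length of the word
        modulo \<open>s\<close>, which is less than \<open>K\<close>; so the boundary determines it,
        although two words with this boundary may have different numbers \<open>m\<close> of
        gaps.\<close>
      have split: "\<exists>m. (B + m) * s \<le> length v \<and> length v < (Suc B + m) * s \<and>
          drop (m * s) v = rev (take (B * s + length v mod s) (take K (rev v)))" if "K \<le> length v" for v :: word
      proof -
        let ?m = "length v div s - B"
        have "Suc B \<le> length v div s" using that s_pos by (simp only: K_def less_eq_div_iff_mult_less_eq)
        then have m: "B + ?m = length v div s" by simp
        have le: "(B + ?m) * s + length v mod s = length v" unfolding m by simp
        have "?m * s = length v - (B * s + length v mod s)" using le unfolding add_mult_distrib by linarith
        then have "drop (?m * s) v = rev (take (B * s + length v mod s) (rev v))"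
          by (simp only: take_rev rev_rev_ident)
        moreover have "B * s + length v mod s \<le> K" using s_pos K by (simp add: less_imp_le)
        ultimately have "drop (?m * s) v = rev (take (B * s + length v mod s) (take K (rev v)))"
          by (simp add: min.absorb1)
        moreover have "(B + ?m) * s \<le> length v" using le by linarith
        moreover have "length v < (Suc B + ?m) * s" using le s_pos mod_less_divisor[of s "length v"] by (simp del: mod_less_divisor)
        ultimately show ?thesis by blast
      qed
      obtain m where m: "(B + m) * s \<le> length w" "length w < (Suc B + m) * s"
        "drop (m * s) w = rev (take (B * s + length w mod s) (take K (rev w)))" using split[OF len(1)] by blast
      obtain m' where m': "(B + m') * s \<le> length w'" "length w' < (Suc B + m') * s"
        "drop (m' * s) w' = rev (take (B * s + length w' mod s) (take K (rev w')))" using split[OF len(2)] by blast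
      have z: "drop (m' * s) w' = drop (m * s) w" by (simp only: m(3) m'(3) b)
      let ?z = "drop (m * s) w"
      have "B * s + m * s \<le> length w" using m(1) by (simp only: add_mult_distrib)
      then have lw: "long w" "long w'" "long ?z"
        using w(1,2) len K by (simp_all add: long_def drop_in_lists)
      have tk: "take (B * s) w = take (B * s) w'"
      proof -
        have "B * s \<le> K" using K by simp
        then show ?thesis using b(1) by (metis min.absorb1 take_take)
      qed
      have eq: "anchor w' = anchor w" "start w' = start w"
        using cutoff_cong[OF tk] cutoff_props(1)[OF lw(1)] by simp_all
      obtain x where x: "x \<in> Hom (anchor w) (anchor ?z)" "h (?W w) \<in> \<rho> (anchor w) (anchor ?z) x"
        "\<phi> w = start w \<otimes>\<^bsub>M\<^esub> x \<otimes>\<^bsub>M\<^esub> \<phi> (drop (cutoff ?z * s) ?z)" using main[OF w(1) m(1,2)] by blast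
      obtain x' where x': "x' \<in> Hom (anchor w) (anchor ?z)" "h (?W w') \<in> \<rho> (anchor w) (anchor ?z) x'"
        "\<phi> w' = start w \<otimes>\<^bsub>M\<^esub> x' \<otimes>\<^bsub>M\<^esub> \<phi> (drop (cutoff ?z * s) ?z)"
        using main[OF w(2) m'(1,2)] unfolding z eq by blast
      have "x = x'"
        using disj[OF cutoff_props(2)[OF lw(1)] cutoff_props(2)[OF lw(3)] x(1) x'(1)] x(2) x'(2) w(4) by auto
      then have "\<phi> w = \<phi> w'" using x x' by simp
      then show ?thesis
        unfolding syn_morphism_eq_iff[OF w(1,2)] by (metis append_Nil append_Nil2 lists.Nil)
    qed
  qed
qed

end

lemma definable_iff_var_recognizable:
  assumes "corresponds F V" "finite A" "L \<subseteq> lists A"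
  shows "definable F A L \<longleftrightarrow> var_recognizable V A L"
  using assms unfolding corresponds_def var_recognizable_def by blast

text \<open>For each boundary, the words of \<open>L\<close> are separated from the others by the
  morphism \<open>h\<close> on window words, so the correspondence of \<open>F\<close> and
  \<open>V\<close> supplies a formula of \<open>F\<close>. The modulus of the windows is the
  stability index itself, which gives \<open>MOD_preds\<close> for this index only.\<close>

lemma stable_local_monoids_imp_definable:
  assumes \<sigma>: "numerical_signature \<sigma>" and F: "fragment F \<sigma>" and V: "local_variety V" and cor: "corresponds F V"
    and reg: "regular_lang A L" and loc: "stable_local_monoids_in A L V"
  shows "definable (enrich F \<sigma> (local_preds \<union> MOD_preds (lang_stability_index A L))) A L"
proof -
  let ?s = "lang_stability_index A L"
  interpret syn: word_quotient A "syn_morphism A L" by (rule syn_word_quotient[OF reg])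
  note s = syn.stability_index[folded lang_stability_index_def]
  interpret stable_local_lang A L ?s V
    using V reg s loc unfolding stable_local_monoids_in_def Let_def syn.stable_set_eq[OF s]
    by unfold_locales auto
  let ?K = "Suc B * ?s"
  let ?C = "window_alphabet A ?K ?s" and ?W = "\<lambda>w. windows ?K ?s 0 w []"
  obtain N h where N: "N \<in> V" and h: "h \<in> monoid_homs (free_monoid ?C) N"
    and sep: "\<And>w w'. \<lbrakk>w \<in> lists A; w' \<in> lists A; boundary ?K ?s w = boundary ?K ?s w'; h (?W w) = h (?W w')\<rbrakk>
      \<Longrightarrow> w \<in> L \<longleftrightarrow> w' \<in> L"
    using windows_separate by blast
  note A = regular_lang_finite[OF reg]
  show ?thesis
  proof (rule windows_imp_definable[OF \<sigma> F A regular_lang_subset[OF reg] s(1)])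
    fix t
    \<comment> \<open>The saturation under \<open>h\<close> of the window words of words in
      \<open>L\<close> with boundary \<open>t\<close>. It is recognized by construction, and
      \<open>sep\<close> ensures that it contains no window word of another word with this
      boundary.\<close>
    let ?P = "\<lambda>v. \<exists>w\<in>lists A. boundary ?K ?s w = t \<and> w \<in> L \<and> h v = h (?W w)"
    have "monoid N" using V N varietyD(1) unfolding local_variety_def by blast
    then have "recognizes N ?C {v \<in> lists ?C. ?P v}"
      unfolding recognizes_iff[OF \<open>monoid N\<close>] using h by (intro bexI[of _ h]) auto
    then have "var_recognizable V ?C {v \<in> lists ?C. ?P v}"
      using N unfolding var_recognizable_def by (rule bexI)
    then have "definable F ?C {v \<in> lists ?C. ?P v}"
      by (subst definable_iff_var_recognizable[OF cor finite_window_alphabet[OF A] Collect_restrict])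
    then obtain \<psi> where \<psi>: "\<psi> \<in> F" "{v \<in> lists ?C. ?P v} = form_lang ?C \<psi>" unfolding definable_def by blast
    have "w \<in> L \<longleftrightarrow> ?W w \<in> form_lang ?C \<psi>" if "w \<in> lists A" "boundary ?K ?s w = t" for w
    proof -
      have "?P (?W w) \<longleftrightarrow> w \<in> L"
      proof
        assume "?P (?W w)"
        then obtain w' where "w' \<in> lists A" "boundary ?K ?s w' = t" "w' \<in> L" "h (?W w) = h (?W w')" by blast
        then show "w \<in> L" using sep[OF that(1), of w'] that(2) by simp
      qed (use that in blast)
      then show ?thesis
        unfolding \<psi>(2)[symmetric] mem_Collect_eq using windows_in[OF that(1) lists.Nil s(1)] by simp
    qed
    then show "\<exists>\<psi>\<in>F. \<forall>w\<in>lists A. boundary ?K ?s w = t \<longrightarrow> (w \<in> L \<longleftrightarrow> ?W w \<in> form_lang ?C \<psi>)"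
      using \<psi>(1) by blast
  qed
qed

section \<open>Recursive functions\<close>

lemma recursive_comp1:
  assumes "recursive 1 (\<lambda>xs. F (hd xs))" "recursive n g"
  shows "recursive n (\<lambda>xs. F (g xs))"
  using recursive.comp[of "[g]" "\<lambda>xs. F (hd xs)" n] assms by simp

lemma recursive_comp2:
  assumes "recursive 2 (\<lambda>xs. F (xs ! 0) (xs ! 1))" "recursive n g" "recursive n h"
  shows "recursive n (\<lambda>xs. F (g xs) (h xs))"
  using recursive.comp[of "[g, h]" "\<lambda>xs. F (xs ! 0) (xs ! 1)" n] assms by (simp add: numeral_2_eq_2)

lemma recursive_prim2:
  assumes "recursive 1 (\<lambda>xs. f (hd xs))" "recursive 3 (\<lambda>xs. g (xs ! 0) (xs ! 1) (xs ! 2))"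
  shows "recursive 2 (\<lambda>xs. rec_nat (f (xs ! 1)) (\<lambda>y r. g y r (xs ! 1)) (xs ! 0))"
proof -
  have "(3::nat) = Suc (Suc 1)" by simp
  then have "recursive (Suc (Suc 1)) (\<lambda>xs. g (xs ! 0) (xs ! 1) (xs ! 2))"
    using assms(2) by metis
  from recursive.prim[OF assms(1) this]
  have "recursive (Suc 1) (\<lambda>xs. rec_nat (f (xs ! 1)) (\<lambda>y r. g y r (xs ! 1)) (xs ! 0))"
    by (rule recursive.ext) (auto simp: length_Suc_conv)
  then show ?thesis by (simp only: Suc_1)
qed

lemma recursive_id: "recursive 1 (\<lambda>xs. hd xs)"
proof -
  have "recursive 1 (\<lambda>xs. xs ! 0)" by (rule recursive.proj) simp
  then show ?thesis by (rule recursive.ext) (auto simp: length_Suc_conv)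
qed

lemma recursive_const: "recursive n (\<lambda>xs. k)"
  by (induction k) (auto intro: recursive.zero recursive_comp1[OF recursive.succ])

lemma recursive_Suc: "recursive n g \<Longrightarrow> recursive n (\<lambda>xs. Suc (g xs))"
  by (rule recursive_comp1[OF recursive.succ])

lemma recursive_add: "recursive 2 (\<lambda>xs. xs ! 0 + xs ! 1)"
proof -
  have "rec_nat b (\<lambda>y r. Suc r) a = a + b" for a b :: nat by (induction a) auto
  then show ?thesis
    using recursive_prim2[of "\<lambda>x. x" "\<lambda>y r x. Suc r", OF recursive_id recursive_Suc[OF recursive.proj]] by simp
qed

lemma recursive_diff: "recursive 2 (\<lambda>xs. xs ! 0 - xs ! 1)"
proof -
  have "rec_nat 0 (\<lambda>y r. y) a = a - 1" for a :: nat by (induction a) auto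
  then have p2: "recursive 2 (\<lambda>xs. xs ! 0 - 1)"
    using recursive_prim2[of "\<lambda>x. 0" "\<lambda>y r x. y", OF recursive.zero recursive.proj] by simp
  \<comment> \<open>Recursion runs on the first argument, so truncated subtraction is built with its
    arguments exchanged and swapped back at the end.\<close>
  have "rec_nat b (\<lambda>y r. r - 1) a = b - a" for a b :: nat by (induction a) auto
  moreover have "recursive 3 (\<lambda>xs. xs ! 1 - 1)"
    using recursive_comp2[of "\<lambda>x y. x - 1", OF p2 recursive.proj recursive.proj, of 1 3 0] by simp
  ultimately have d: "recursive 2 (\<lambda>xs. xs ! 1 - xs ! 0)"
    using recursive_prim2[of "\<lambda>x. x" "\<lambda>y r x. r - 1", OF recursive_id] by simp
  show ?thesis
    using recursive_comp2[of "\<lambda>x y. y - x", OF d recursive.proj recursive.proj, of 1 2 0] by simp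
qed

lemma recursive_triangle: "recursive 1 (\<lambda>xs. triangle (hd xs))"
proof -
  have "rec_nat 0 (\<lambda>y r. r + Suc y) a = triangle a" for a by (induction a) auto
  moreover have "recursive 3 (\<lambda>xs. xs ! 1 + Suc (xs ! 0))"
    by (intro recursive_comp2[OF recursive_add] recursive_Suc recursive.proj) simp_all
  ultimately have "recursive 2 (\<lambda>xs. triangle (xs ! 0))"
    using recursive_prim2[of "\<lambda>x. 0" "\<lambda>y r x. r + Suc y", OF recursive.zero] by simp
  then show ?thesis
    using recursive_comp2[of "\<lambda>x y. triangle x", OF _ recursive_id recursive_id] by simp
qed

lemma recursive_pair: "recursive 2 (\<lambda>xs. prod_encode (xs ! 0, xs ! 1))"
  unfolding prod_encode_def split_conv
  by (intro recursive_comp2[OF recursive_add] recursive_comp1[OF recursive_triangle] recursive.proj) simp_all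

lemma recursive_pairI: "recursive n g \<Longrightarrow> recursive n h \<Longrightarrow> recursive n (\<lambda>xs. prod_encode (g xs, h xs))"
  by (rule recursive_comp2[of "\<lambda>a b. prod_encode (a, b)", OF recursive_pair])

definition pfst :: "nat \<Rightarrow> nat" where "pfst z = fst (prod_decode z)"
definition psnd :: "nat \<Rightarrow> nat" where "psnd z = snd (prod_decode z)"

lemma pfst_encode [simp]: "pfst (prod_encode (x, y)) = x" and psnd_encode [simp]: "psnd (prod_encode (x, y)) = y"
  by (simp_all add: pfst_def psnd_def)

text \<open>The diagonal on which \<open>z\<close> lies is found by minimization.\<close>

lemma diagonal_Least: "(LEAST k. Suc z - triangle (Suc k) = 0) = pfst z + psnd z"
proof (rule Least_equality)
  obtain x y where z: "z = prod_encode (x, y)" by (metis prod_decode_inverse prod.exhaust)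
  show "Suc z - triangle (Suc (pfst z + psnd z)) = 0" by (simp add: z, simp add: prod_encode_def)
  have mono: "triangle i \<le> triangle j" if "i \<le> j" for i j
    using that by (induction j) (auto simp: le_Suc_eq)
  fix k assume k: "Suc z - triangle (Suc k) = 0"
  show "pfst z + psnd z \<le> k"
  proof (rule ccontr)
    assume "\<not> pfst z + psnd z \<le> k"
    then have "triangle (Suc k) \<le> triangle (x + y)" by (intro mono) (simp add: z)
    also have "\<dots> \<le> z" by (simp add: z prod_encode_def)
    finally show False using k by simp
  qed
qed

text \<open>Minimization yields the sum of the two components; subtracting the triangular number of
  this sum from the code leaves the first component, and the second is their difference.\<close>

lemma recursive_projections:
  "recursive 1 (\<lambda>xs. pfst (hd xs))" "recursive 1 (\<lambda>xs. psnd (hd xs))"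
proof -
  have "recursive 2 (\<lambda>xs. Suc (xs ! 1) - triangle (Suc (xs ! 0)))"
    by (intro recursive_comp2[OF recursive_diff] recursive_comp1[OF recursive_triangle] recursive_Suc recursive.proj) simp_all
  then have "recursive (Suc 1) (\<lambda>xs. Suc (xs ! 1) - triangle (Suc (xs ! 0)))" by (simp add: numeral_2_eq_2)
  then have "recursive 1 (\<lambda>xs. LEAST y. Suc ((y # xs) ! 1) - triangle (Suc ((y # xs) ! 0)) = 0)"
  proof (rule recursive.mu)
    have "z < triangle (Suc z)" for z by simp
    then show "\<forall>xs. length xs = 1 \<longrightarrow> (\<exists>y. Suc ((y # xs) ! 1) - triangle (Suc ((y # xs) ! 0)) = 0)"
      by (intro allI impI, rule_tac x = "xs ! 0" in exI) (simp add: Suc_le_eq)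
  qed
  then have "recursive 1 (\<lambda>xs. LEAST y. Suc (hd xs) - triangle (Suc y) = 0)"
    by (rule recursive.ext) (auto simp: length_Suc_conv)
  then have s: "recursive 1 (\<lambda>xs. pfst (hd xs) + psnd (hd xs))" unfolding diagonal_Least .
  have f: "pfst z = z - triangle (pfst z + psnd z)" and p: "psnd z = (pfst z + psnd z) - pfst z" for z
  proof -
    obtain x y where z: "z = prod_encode (x, y)" by (metis prod_decode_inverse prod.exhaust)
    have "prod_encode (x, y) = triangle (x + y) + x" by (simp add: prod_encode_def)
    then show "pfst z = z - triangle (pfst z + psnd z)" unfolding z pfst_encode psnd_encode by linarith
  qed simp
  have "recursive 1 (\<lambda>xs. hd xs - triangle (pfst (hd xs) + psnd (hd xs)))"
    by (intro recursive_comp2[OF recursive_diff] recursive_id recursive_comp1[OF recursive_triangle] s)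
  then show fst: "recursive 1 (\<lambda>xs. pfst (hd xs))" unfolding f[symmetric] .
  have "recursive 1 (\<lambda>xs. (pfst (hd xs) + psnd (hd xs)) - pfst (hd xs))"
    by (intro recursive_comp2[OF recursive_diff] s fst)
  then show "recursive 1 (\<lambda>xs. psnd (hd xs))" by simp
qed

text \<open>
  Working with unary functions, several arguments are packed by the pairing function; a bound
  variable then becomes the projections of the single argument.
\<close>

definition rf :: "(nat \<Rightarrow> nat) \<Rightarrow> bool" where
  "rf f \<longleftrightarrow> recursive 1 (\<lambda>xs. f (hd xs))"

lemma rf_comp: "rf f \<Longrightarrow> rf g \<Longrightarrow> rf (\<lambda>x. f (g x))"
  unfolding rf_def by (rule recursive_comp1)

lemma rf_comp2: "recursive 2 (\<lambda>xs. F (xs ! 0) (xs ! 1)) \<Longrightarrow> rf g \<Longrightarrow> rf h \<Longrightarrow> rf (\<lambda>x. F (g x) (h x))"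
  unfolding rf_def by (rule recursive_comp2)

lemma rf_const: "rf (\<lambda>x. k)" and rf_id: "rf (\<lambda>x. x)"
  unfolding rf_def by (rule recursive_const recursive_id)+

lemma rf_Suc: "rf f \<Longrightarrow> rf (\<lambda>x. Suc (f x))"
  unfolding rf_def by (rule recursive_Suc)

lemma rf_pfst: "rf f \<Longrightarrow> rf (\<lambda>x. pfst (f x))" and rf_psnd: "rf f \<Longrightarrow> rf (\<lambda>x. psnd (f x))"
  unfolding rf_def by (rule recursive_comp1[OF recursive_projections(1)] recursive_comp1[OF recursive_projections(2)], assumption)+

lemmas rf_add = rf_comp2[OF recursive_add] and rf_diff = rf_comp2[OF recursive_diff]
  and rf_pair = rf_comp2[OF recursive_pair]

text \<open>The step function, with its parameter \<open>x\<close>, counter \<open>y\<close> and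
  previous value \<open>r\<close>, is presented as a unary function of the nested pair of these
  three.\<close>

lemma rf_rec:
  assumes f: "rf f" and h: "rf h" and g: "rf (\<lambda>p. g (pfst p) (pfst (psnd p)) (psnd (psnd p)))"
  shows "rf (\<lambda>x. rec_nat (f x) (\<lambda>y r. g x y r) (h x))"
proof -
  let ?G = "\<lambda>p. g (pfst p) (pfst (psnd p)) (psnd (psnd p))"
  have "recursive 3 (\<lambda>xs. ?G (prod_encode (xs ! 2, prod_encode (xs ! 0, xs ! 1))))"
    by (rule recursive_comp1[of ?G, OF g[unfolded rf_def]], intro recursive_pairI recursive.proj) simp_all
  then have "recursive 3 (\<lambda>xs. g (xs ! 2) (xs ! 0) (xs ! 1))" by simp
  then have "recursive 2 (\<lambda>xs. rec_nat (f (xs ! 1)) (\<lambda>y r. g (xs ! 1) y r) (xs ! 0))"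
    using recursive_prim2[of f "\<lambda>y r x. g x y r"] f unfolding rf_def by simp
  then show ?thesis using rf_comp2[of "\<lambda>a x. rec_nat (f x) (\<lambda>y r. g x y r) a", OF _ h rf_id] by simp
qed

lemma rf_Least:
  assumes g: "rf (\<lambda>p. g (pfst p) (psnd p))" and ex: "\<And>x. \<exists>y. g x y = 0"
  shows "rf (\<lambda>x. LEAST y. g x y = 0)"
proof -
  let ?G = "\<lambda>p. g (pfst p) (psnd p)"
  have "recursive 2 (\<lambda>xs. ?G (prod_encode (xs ! 1, xs ! 0)))"
    by (rule recursive_comp1[of ?G, OF g[unfolded rf_def]], intro recursive_pairI recursive.proj) simp_all
  then have "recursive (Suc 1) (\<lambda>xs. g (xs ! 1) (xs ! 0))" by (simp add: numeral_2_eq_2)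
  then have "recursive 1 (\<lambda>xs. LEAST y. g ((y # xs) ! 1) ((y # xs) ! 0) = 0)"
    by (rule recursive.mu) (use ex in simp)
  then show ?thesis unfolding rf_def by (rule recursive.ext) (auto simp: length_Suc_conv)
qed

definition rp :: "(nat \<Rightarrow> bool) \<Rightarrow> bool" where
  "rp P \<longleftrightarrow> rf (\<lambda>x. if P x then 1 else 0)"

text \<open>Case distinction is a recursion whose step ignores counter and previous value.\<close>

lemma rf_ifzero:
  assumes "rf c" "rf f" "rf g"
  shows "rf (\<lambda>x. if c x = 0 then f x else g x)"
proof -
  have "rec_nat a (\<lambda>y r. b) n = (if n = 0 then a else b)" for a b n :: nat by (cases n) auto
  then show ?thesis
    using rf_rec[of f c "\<lambda>x y r. g x", OF assms(2,1) rf_comp[OF assms(3) rf_pfst[OF rf_id]]] by simp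
qed

lemma rf_cong:
  assumes "rf f" "\<And>x. f x = g x"
  shows "rf g"
proof -
  have "f = g" by (rule HOL.ext) (rule assms(2))
  then show ?thesis using assms(1) by simp
qed

lemma rf_If:
  assumes "rp P" "rf f" "rf g"
  shows "rf (\<lambda>x. if P x then f x else g x)"
  by (rule rf_cong[OF rf_ifzero[OF assms(1)[unfolded rp_def] assms(3,2)]]) simp

lemma rp_less: "rf f \<Longrightarrow> rf g \<Longrightarrow> rp (\<lambda>x. f x < g x)"
  unfolding rp_def
  by (rule rf_cong[OF rf_ifzero[OF rf_diff[of g f] rf_const[of 0] rf_const[of 1]]]) auto

lemma rp_not: "rp P \<Longrightarrow> rp (\<lambda>x. \<not> P x)"
  unfolding rp_def[of "\<lambda>x. \<not> P x"] by (rule rf_cong[OF rf_If[OF _ rf_const[of 0] rf_const[of 1]]]) auto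

lemma rp_imp: "rp P \<Longrightarrow> rp Q \<Longrightarrow> rp (\<lambda>x. P x \<longrightarrow> Q x)"
  unfolding rp_def[of "\<lambda>x. P x \<longrightarrow> Q x"]
  by (rule rf_cong[OF rf_If[of P "\<lambda>x. if Q x then 1 else 0" "\<lambda>x. 1", OF _ _ rf_const]]) (auto simp: rp_def)

lemma rp_conj: "rp P \<Longrightarrow> rp Q \<Longrightarrow> rp (\<lambda>x. P x \<and> Q x)"
  using rp_not[OF rp_imp[OF _ rp_not], of P Q] by simp

lemma rp_eq:
  assumes "rf f" "rf g"
  shows "rp (\<lambda>x. f x = g x)"
  using rp_conj[OF rp_not[OF rp_less[OF assms]] rp_not[OF rp_less[OF assms(2,1)]]]
  by (simp add: not_less order.antisym eq_iff conj_commute)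

lemma rp_all:
  assumes P: "rp (\<lambda>p. P (pfst p) (psnd p))" and b: "rf b"
  shows "rp (\<lambda>x. \<forall>y<b x. P x y)"
proof -
  \<comment> \<open>The value starts at 1 and stays 0 from the first counterexample on.\<close>
  let ?g = "\<lambda>x y r. if P x y then r else (0::nat)"
  have "rp (\<lambda>p. P (pfst (prod_encode (pfst p, pfst (psnd p)))) (psnd (prod_encode (pfst p, pfst (psnd p)))))"
    using rf_comp[OF P[unfolded rp_def], of "\<lambda>p. prod_encode (pfst p, pfst (psnd p))"]
    unfolding rp_def by (simp add: rf_pair rf_pfst rf_psnd rf_id)
  then have "rf (\<lambda>p. ?g (pfst p) (pfst (psnd p)) (psnd (psnd p)))"
    by (intro rf_If rf_psnd rf_id rf_const) simp
  then have "rf (\<lambda>x. rec_nat 1 (?g x) (b x))" by (intro rf_rec rf_const b)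
  moreover have "rec_nat 1 (?g x) n = (if \<forall>y<n. P x y then 1 else 0)" for x n
    by (induction n) (auto simp: less_Suc_eq)
  ultimately show ?thesis unfolding rp_def by simp
qed

lemma rp_ex:
  assumes P: "rp (\<lambda>p. P (pfst p) (psnd p))" and b: "rf b"
  shows "rp (\<lambda>x. \<exists>y<b x. P x y)"
  using rp_not[OF rp_all[of "\<lambda>x y. \<not> P x y", OF rp_not[OF P] b]] by simp

lemmas rf_basic = rf_const rf_id rf_pfst rf_psnd rf_Suc rf_add rf_diff rf_pair rf_If
  rp_less rp_eq rp_not rp_imp rp_conj

lemma rf_mult:
  assumes "rf f" "rf g"
  shows "rf (\<lambda>x. f x * g x)"
proof -
  have "rec_nat 0 (\<lambda>y r. r + b) a = a * b" for a b :: nat by (induction a) auto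
  moreover have "rf (\<lambda>x. rec_nat 0 (\<lambda>y r. r + g x) (f x))"
    by (intro rf_rec rf_basic assms rf_comp[OF assms(2)])
  ultimately show ?thesis by simp
qed

lemma rf_power:
  assumes "rf f" "rf g"
  shows "rf (\<lambda>x. f x ^ g x)"
proof -
  have "rec_nat 1 (\<lambda>y r. r * b) a = b ^ a" for a b :: nat by (induction a) auto
  moreover have "rf (\<lambda>x. rec_nat 1 (\<lambda>y r. r * f x) (g x))"
    by (intro rf_rec rf_basic rf_mult assms rf_comp[OF assms(1)])
  ultimately show ?thesis by simp
qed

lemma rf_fact:
  assumes "rf f"
  shows "rf (\<lambda>x. fact (f x))"
proof -
  have "rec_nat 1 (\<lambda>y r. Suc y * r) a = fact a" for a :: nat by (induction a) auto
  moreover have "rf (\<lambda>x. rec_nat 1 (\<lambda>y r. Suc y * r) (f x))"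
    by (intro rf_rec rf_basic rf_mult assms)
  ultimately show ?thesis by simp
qed

lemma rf_mod:
  assumes "rf f" "rf g"
  shows "rf (\<lambda>x. f x mod g x)"
proof -
  \<comment> \<open>A counter that wraps around at \<open>b\<close>; for \<open>b = 0\<close> it
    never does, in agreement with \<open>a mod 0 = a\<close>.\<close>
  have "rec_nat 0 (\<lambda>y r. if Suc r = b then 0 else Suc r) a = a mod b" for a b :: nat
    by (induction a) (simp_all add: mod_Suc)
  moreover have "rf (\<lambda>x. rec_nat 0 (\<lambda>y r. if Suc r = g x then 0 else Suc r) (f x))"
    by (intro rf_rec rf_basic assms rf_comp[OF assms(2)])
  ultimately show ?thesis by simp
qed

lemma rf_div:
  assumes "rf f" "rf g"
  shows "rf (\<lambda>x. f x div g x)"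
proof -
  \<comment> \<open>It counts the positive multiples of \<open>b\<close> up to \<open>a\<close>; for
    \<open>b = 0\<close> there are none, in agreement with \<open>a div 0 = 0\<close>.\<close>
  have "rec_nat 0 (\<lambda>y r. if Suc y mod b = 0 then Suc r else r) a = a div b" for a b :: nat
    by (induction a) (simp_all add: div_Suc)
  moreover have "rf (\<lambda>x. rec_nat 0 (\<lambda>y r. if Suc y mod g x = 0 then Suc r else r) (f x))"
    by (intro rf_rec rf_basic rf_mod assms rf_comp[OF assms(2)])
  ultimately show ?thesis by simp
qed

section \<open>Computing with codes of lists\<close>

definition code_hd :: "nat \<Rightarrow> nat" where "code_hd c = pfst (c - 1)"
definition code_tl :: "nat \<Rightarrow> nat" where "code_tl c = psnd (c - 1)"
definition code_drop :: "nat \<Rightarrow> nat \<Rightarrow> nat" where "code_drop c i = rec_nat c (\<lambda>y r. code_tl r) i"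
definition code_nth :: "nat \<Rightarrow> nat \<Rightarrow> nat" where "code_nth c i = code_hd (code_drop c i)"
definition code_length :: "nat \<Rightarrow> nat" where "code_length c = (LEAST i. code_drop c i = 0)"

lemma code_drop: "code_drop (list_encode xs) i = list_encode (drop i xs)"
proof (induction i)
  case 0
  then show ?case by (simp add: code_drop_def)
next
  case (Suc i)
  \<comment> \<open>Thus the tail of the code 0 is again 0, as it must be for the empty
    list.\<close>
  have "psnd 0 = 0" using psnd_encode[of 0 0] by (simp add: prod_encode_def)
  then have "code_tl (list_encode ys) = list_encode (tl ys)" for ys
    by (cases ys) (simp_all add: code_tl_def)
  moreover have "code_drop (list_encode xs) (Suc i) = code_tl (code_drop (list_encode xs) i)"
    by (simp add: code_drop_def)
  ultimately show ?case using Suc by (simp only: tl_drop drop_Suc)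
qed

lemma code_nth: "i < length xs \<Longrightarrow> code_nth (list_encode xs) i = xs ! i"
  by (simp add: code_nth_def code_drop Cons_nth_drop_Suc[symmetric] code_hd_def)

lemma list_encode_0: "list_encode xs = 0 \<longleftrightarrow> xs = []"
  by (cases xs) auto

lemma code_length: "code_length (list_encode xs) = length xs"
  unfolding code_length_def code_drop list_encode_0
  by (rule Least_equality) auto

lemma rf_code_drop:
  assumes "rf f" "rf g"
  shows "rf (\<lambda>x. code_drop (f x) (g x))"
  unfolding code_drop_def code_tl_def by (intro rf_rec rf_basic assms)

lemma rf_code_nth: "rf f \<Longrightarrow> rf g \<Longrightarrow> rf (\<lambda>x. code_nth (f x) (g x))"
  unfolding code_nth_def code_hd_def by (intro rf_basic rf_code_drop)

lemma rf_code_length: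
  assumes "rf f"
  shows "rf (\<lambda>x. code_length (f x))"
proof -
  have "\<exists>y. code_drop x y = 0" for x
    using code_drop[of "list_decode x" "length (list_decode x)"]
    by (intro exI[of _ "length (list_decode x)"]) simp
  then have "rf (\<lambda>x. LEAST i. code_drop x i = 0)"
    by (intro rf_Least rf_code_drop rf_basic)
  then show ?thesis using rf_comp[OF _ assms] unfolding code_length_def by blast
qed

text \<open>Recursion prepends, so the arguments are taken from the top down to give an ascending
  list.\<close>

definition code_map :: "(nat \<Rightarrow> nat) \<Rightarrow> nat \<Rightarrow> nat" where
  "code_map f n = rec_nat 0 (\<lambda>i r. Suc (prod_encode (f (n - Suc i), r))) n"

text \<open>The list comes out in descending order; it will hold final states, whose order does not
  affect the language, and \<open>block_dfa\<close> lists them in the same order.\<close>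

definition code_filter :: "(nat \<Rightarrow> bool) \<Rightarrow> nat \<Rightarrow> nat" where
  "code_filter P n = rec_nat 0 (\<lambda>i r. if P i then Suc (prod_encode (i, r)) else r) n"

lemma code_map: "code_map f n = list_encode (map f [0..<n])"
proof -
  have "rec_nat 0 (\<lambda>i r. Suc (prod_encode (f (n - Suc i), r))) k = list_encode (map f [n - k..<n])" if "k \<le> n" for k
    using that
  proof (induction k)
    case (Suc k)
    then have "[n - Suc k..<n] = (n - Suc k) # [n - k..<n]"
      by (subst upt_conv_Cons) (auto simp: Suc_diff_Suc)
    then show ?case using Suc by simp
  qed simp
  then show ?thesis unfolding code_map_def by (metis diff_self_eq_0 order_refl)
qed

lemma code_filter: "code_filter P n = list_encode (rev (filter P [0..<n]))"
  unfolding code_filter_def by (induction n) auto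

lemma rf_code_map:
  assumes f: "rf (\<lambda>p. f (pfst p) (psnd p))" and n: "rf n"
  shows "rf (\<lambda>x. code_map (f x) (n x))"
proof -
  have "rf (\<lambda>p. f (pfst (prod_encode (pfst p, n (pfst p) - Suc (pfst (psnd p)))))
      (psnd (prod_encode (pfst p, n (pfst p) - Suc (pfst (psnd p))))))"
    by (rule rf_comp[OF f]) (intro rf_basic rf_comp[OF n])
  then show ?thesis
    unfolding code_map_def by (intro rf_rec rf_basic n) simp_all
qed

lemma rf_code_filter:
  assumes P: "rp (\<lambda>p. P (pfst p) (psnd p))" and n: "rf n"
  shows "rf (\<lambda>x. code_filter (P x) (n x))"
proof -
  have "rp (\<lambda>p. P (pfst (prod_encode (pfst p, pfst (psnd p)))) (psnd (prod_encode (pfst p, pfst (psnd p)))))"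
    using rf_comp[OF P[unfolded rp_def], of "\<lambda>p. prod_encode (pfst p, pfst (psnd p))"]
    unfolding rp_def by (simp add: rf_pair rf_pfst rf_psnd rf_id)
  then show ?thesis
    unfolding code_filter_def by (intro rf_rec rf_basic n) simp_all
qed

lemmas rf_intros = rf_basic rf_mult rf_power rf_fact rf_mod rf_div rf_code_nth rf_code_length

section \<open>The decision procedure\<close>

definition letter_count :: "nat \<Rightarrow> nat" where "letter_count c = code_length (code_nth c 0)"
definition state_count :: "nat \<Rightarrow> nat" where "state_count c = code_length (code_nth c 1)"

text \<open>
  An automaton with \<open>m\<close> states has at most \<open>m\<^sup>m\<close> transitions, hence \<open>2\<close> to the \<open>m\<^sup>m\<close> sets of transitions,
  and the factorial of this number is a multiple of all periods of the powers of such a set.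
\<close>

definition stable_length :: "nat \<Rightarrow> nat" where
  "stable_length c = fact (2 ^ (state_count c ^ state_count c))"

text \<open>
  The words of length \<open>k\<close> over an alphabet with \<open>a\<close> letters are numbered by their base \<open>a\<close> digits
  (first letter first), so that they correspond to the numbers below \<open>a\<^sup>k\<close>.
\<close>

definition run_code :: "nat \<Rightarrow> nat \<Rightarrow> nat \<Rightarrow> nat \<Rightarrow> nat" where
  "run_code c k w q = rec_nat q (\<lambda>i r. code_nth (code_nth (code_nth c 1) r)
     (w div letter_count c ^ i mod letter_count c)) k"

definition final_code :: "nat \<Rightarrow> nat \<Rightarrow> bool" where
  "final_code c q \<longleftrightarrow> (\<exists>i<code_length (code_nth c 3). code_nth (code_nth c 3) i = q)"

text \<open>The nested pairs are \<open>list_encode\<close> of the four fields of an automaton,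
  unfolded so that recursiveness is visible. Its letters number the words of length
  \<open>N\<close>; \<open>k\<close> and \<open>l\<close> are the lengths of the contexts numbered
  \<open>y\<close> and \<open>z\<close>.\<close>

definition block_code :: "nat \<Rightarrow> nat \<Rightarrow> nat \<Rightarrow> nat \<Rightarrow> nat \<Rightarrow> nat \<Rightarrow> nat" where
  "block_code c u k y l z = (let N = stable_length c; n = letter_count c ^ stable_length c in
     Suc (prod_encode (code_map (\<lambda>i. i) n,
     Suc (prod_encode (code_map (\<lambda>q. code_map (\<lambda>x. run_code c N x (run_code c N u q)) n) (state_count c),
     Suc (prod_encode (run_code c k y (code_nth c 2),
     Suc (prod_encode (code_filter (\<lambda>q. final_code c (run_code c l z (run_code c N u q))) (state_count c), 0)))))))))"

text \<open>\<open>u\<close> runs through the words of length \<open>N\<close> with idempotent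
  transition. Contexts shorter than \<open>2 * N\<close> represent all contexts by
  \<open>short_representative\<close>, so only finitely many questions are put to
  \<open>f\<close>.\<close>

definition decision :: "(nat \<Rightarrow> nat) \<Rightarrow> nat \<Rightarrow> bool" where
  "decision f c \<longleftrightarrow> (\<forall>u<letter_count c ^ stable_length c.
     (\<forall>q<state_count c. run_code c (stable_length c) u (run_code c (stable_length c) u q) =
        run_code c (stable_length c) u q) \<longrightarrow>
     (\<forall>k<2 * stable_length c. \<forall>l<2 * stable_length c.
        \<forall>y<letter_count c ^ k. \<forall>z<letter_count c ^ l. f (block_code c u k y l z) = 1))"

lemma rf_counts:
  assumes "rf f"
  shows "rf (\<lambda>x. letter_count (f x))" "rf (\<lambda>x. state_count (f x))" "rf (\<lambda>x. stable_length (f x))"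
  unfolding letter_count_def state_count_def stable_length_def by (intro rf_intros assms)+

lemma rf_run_code:
  assumes "rf c" "rf k" "rf w" "rf q"
  shows "rf (\<lambda>x. run_code (c x) (k x) (w x) (q x))"
  unfolding run_code_def
  by (intro rf_rec rf_intros rf_counts assms rf_comp[OF assms(1)] rf_comp[OF assms(3)])

lemma rp_final_code:
  assumes "rf c" "rf q"
  shows "rp (\<lambda>x. final_code (c x) (q x))"
  unfolding final_code_def by (intro rp_ex rf_intros assms rf_comp[OF assms(1)] rf_comp[OF assms(2)])

lemma rf_block_code:
  assumes "rf c" "rf u" "rf k" "rf y" "rf l" "rf z"
  shows "rf (\<lambda>x. block_code (c x) (u x) (k x) (y x) (l x) (z x))"
  unfolding block_code_def Let_def
  by (intro rf_code_map rf_code_filter rf_intros rf_counts rf_run_code rp_final_code assms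
      rf_comp[OF assms(1)] rf_comp[OF assms(2)] rf_comp[OF assms(5)] rf_comp[OF assms(6)])

lemma rp_decision:
  assumes "rf f"
  shows "rp (decision f)"
  unfolding decision_def[abs_def]
  by (intro rp_all rf_intros rf_counts rf_run_code rf_block_code rf_comp[OF assms])

lemma dfa_code_nth:
  "code_nth (dfa_code D) 0 = list_encode (letters D)"
  "code_nth (dfa_code D) 1 = list_encode (map list_encode (trans D))"
  "code_nth (dfa_code D) 2 = init D"
  "code_nth (dfa_code D) 3 = list_encode (finals D)"
  unfolding dfa_code_def by (subst code_nth; simp)+

lemma dfa_code_counts:
  "letter_count (dfa_code D) = length (letters D)" "state_count (dfa_code D) = length (trans D)"
  by (simp_all only: letter_count_def state_count_def dfa_code_nth code_length length_map)

lemma final_code_iff: "final_code (dfa_code D) q \<longleftrightarrow> q \<in> set (finals D)"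
  unfolding final_code_def dfa_code_nth code_length in_set_conv_nth
  by (intro ex_cong1 conj_cong refl) (simp add: code_nth)

definition letter_word :: "dfa \<Rightarrow> nat \<Rightarrow> nat \<Rightarrow> word" where
  "letter_word D k w = map (\<lambda>i. letters D ! (w div length (letters D) ^ i mod length (letters D))) [0..<k]"

text \<open>Prepending the letter of index \<open>j\<close> turns the number \<open>w\<close> into
  \<open>j + a * w\<close>, for \<open>a\<close> letters. The empty alphabet is covered: then only
  \<open>k = 0\<close> has a number below \<open>a ^ k\<close>, and it denotes the empty
  word.\<close>

lemma letter_word_image:
  "letter_word D k ` {..<length (letters D) ^ k} = words_of_length (set (letters D)) k"
proof
  let ?a = "length (letters D)"
  show "letter_word D k ` {..<?a ^ k} \<subseteq> words_of_length (set (letters D)) k"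
  proof (rule image_subsetI)
    fix w assume "w \<in> {..<?a ^ k}"
    then have "k = 0 \<or> 0 < ?a" by (cases k) auto
    then show "letter_word D k w \<in> words_of_length (set (letters D)) k"
      by (auto simp: letter_word_def in_words_of_length in_lists_conv_set intro!: nth_mem)
  qed
  have "\<exists>w<?a ^ length v. letter_word D (length v) w = v" if "v \<in> lists (set (letters D))" for v
    using that
  proof (induction v)
    case Nil
    then show ?case by (auto simp: letter_word_def)
  next
    case (Cons b v)
    obtain w where w: "w < ?a ^ length v" "letter_word D (length v) w = v" using Cons.IH by blast
    obtain j where j: "j < ?a" "letters D ! j = b" using Cons.hyps(1) by (auto simp: in_set_conv_nth)
    have "j + ?a * w < ?a * Suc w" using j(1) by simp
    also have "\<dots> \<le> ?a ^ length (b # v)" using w(1) mult_le_mono2[of "Suc w" "?a ^ length v" ?a] by simp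
    finally have lt: "j + ?a * w < ?a ^ length (b # v)" .
    have "?a \<noteq> 0" using j(1) by auto
    then have d: "(j + ?a * w) div ?a = w" "j mod ?a = j"
      using div_mult_self2[of ?a j w] j(1) by simp_all
    have "letter_word D (length (b # v)) (j + ?a * w) =
        letters D ! ((j + ?a * w) mod ?a) # map (\<lambda>i. letters D ! ((j + ?a * w) div ?a ^ Suc i mod ?a)) [0..<length v]"
      unfolding letter_word_def length_Cons map_upt_Suc by simp
    also have "\<dots> = b # letter_word D (length v) w"
      unfolding letter_word_def using j(2) by (simp add: div_mult2_eq d)
    finally show ?case using lt w(2) by metis
  qed
  then show "words_of_length (set (letters D)) k \<subseteq> letter_word D k ` {..<?a ^ k}"
    unfolding in_words_of_length subset_iff by (metis imageI lessThan_iff in_words_of_length)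
qed

lemma dfa_step_nth:
  assumes "wf_dfa D" "q < length (trans D)" "j < length (letters D)"
  shows "dfa_step D q (letters D ! j) = trans D ! q ! j"
proof -
  have "length (trans D ! q) = length (letters D)" "distinct (letters D)"
    using assms(1) nth_mem[OF assms(2)] unfolding wf_dfa_def by auto
  then show ?thesis using assms(3) by (simp add: dfa_step_def map_of_zip_nth)
qed

lemma run_code:
  assumes D: "wf_dfa D" and q: "q < length (trans D)" and w: "w < length (letters D) ^ k"
  shows "run_code (dfa_code D) k w q = foldl (dfa_step D) q (letter_word D k w)"
proof -
  let ?a = "length (letters D)"
  have "run_code (dfa_code D) j w q = foldl (dfa_step D) q (letter_word D j w)" if "j \<le> k" for j
    using that
  proof (induction j)
    case 0
    then show ?case by (simp add: run_code_def letter_word_def)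
  next
    case (Suc j)
    then have a: "0 < ?a" using w by (cases "?a = 0") (auto simp: power_0_left split: if_splits)
    let ?i = "w div ?a ^ j mod ?a"
    have i: "?i < ?a" using a by simp
    have "letter_word D j w \<in> lists (set (letters D))"
      using a by (auto simp: letter_word_def in_lists_conv_set intro!: nth_mem)
    then have r: "foldl (dfa_step D) q (letter_word D j w) < length (trans D)" (is "?r < _")
      using run_lt[OF D _ q] by blast
    have row: "length (trans D ! ?r) = ?a" using D nth_mem[OF r] unfolding wf_dfa_def by auto
    have "run_code (dfa_code D) (Suc j) w q =
        code_nth (code_nth (list_encode (map list_encode (trans D))) (run_code (dfa_code D) j w q)) ?i"
      unfolding run_code_def dfa_code_nth dfa_code_counts by simp
    also have "\<dots> = trans D ! ?r ! ?i" using Suc r row i by (simp add: code_nth)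
    also have "\<dots> = foldl (dfa_step D) q (letter_word D (Suc j) w)"
      using dfa_step_nth[OF D r i] by (simp add: letter_word_def)
    finally show ?case .
  qed
  then show ?thesis by blast
qed

lemma dfa_code_make:
  "dfa_code \<lparr>letters = a, trans = t, init = i, finals = e\<rparr> =
    list_encode [list_encode a, list_encode (map list_encode t), i, list_encode e]"
  by (simp add: dfa_code_def)

text \<open>The states of \<open>D\<close> are kept: the letter \<open>c\<close> acts as the block
  \<open>u @ x c\<close>, the left context moves the initial state, and the closing \<open>u\<close>
  together with the right context is absorbed into the final states.\<close>

definition block_dfa :: "dfa \<Rightarrow> word \<Rightarrow> (letter \<Rightarrow> word) \<Rightarrow> nat \<Rightarrow> word \<Rightarrow> word \<Rightarrow> dfa" where
  "block_dfa D u x n y z = \<lparr>letters = [0..<n],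
     trans = map (\<lambda>q. map (\<lambda>c. foldl (dfa_step D) q (u @ x c)) [0..<n]) [0..<length (trans D)],
     init = foldl (dfa_step D) (init D) y,
     finals = rev (filter (\<lambda>q. foldl (dfa_step D) q (u @ z) \<in> set (finals D)) [0..<length (trans D)])\<rparr>"

lemma wf_block_dfa:
  assumes D: "wf_dfa D" and "u \<in> lists (set (letters D))" "y \<in> lists (set (letters D))"
    and x: "\<forall>c<n. x c \<in> lists (set (letters D))"
  shows "wf_dfa (block_dfa D u x n y z)"
proof -
  have "init D < length (trans D)" using D by (simp add: wf_dfa_def)
  then have "foldl (dfa_step D) (init D) y < length (trans D)" using run_lt[OF D assms(3)] by blast
  moreover have "foldl (dfa_step D) q (u @ x c) < length (trans D)" if "q < length (trans D)" "c < n" for q c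
    using that assms(2) x by (intro run_lt[OF D]) auto
  ultimately show ?thesis unfolding wf_dfa_def block_dfa_def by auto
qed

lemma block_dfa_lang:
  assumes D: "wf_dfa D" and u: "u \<in> lists (set (letters D))" and y: "y \<in> lists (set (letters D))"
    and z: "z \<in> lists (set (letters D))"
    and x: "\<forall>c<n. x c \<in> lists (set (letters D))"
  shows "dfa_lang (block_dfa D u x n y z) = block_lang (dfa_lang D) y z u x {..<n}"
proof -
  let ?D = "block_dfa D u x n y z" and ?m = "length (trans D)"
  have step: "dfa_step ?D q c = foldl (dfa_step D) q (u @ x c)" if "q < ?m" "c < n" for q c
  proof -
    have "dfa_step ?D q ([0..<n] ! c) = foldl (dfa_step D) q (u @ x c)"
      using that unfolding dfa_step_def block_dfa_def by (simp add: map_of_zip_nth del: nth_upt)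
        (simp add: map_of_zip_nth)
    then show ?thesis using that by simp
  qed
  have lt: "foldl (dfa_step D) q (u @ x c) < ?m" if "q < ?m" "c < n" for q c
    using that u x by (intro run_lt[OF D]) auto
  have run: "foldl (dfa_step ?D) q cs < ?m \<and>
      foldl (dfa_step D) (foldl (dfa_step ?D) q cs) u = foldl (dfa_step D) q (blocks u x cs)"
    if "q < ?m" "cs \<in> lists {..<n}" for q cs
    using that(2,1)
  proof (induction cs arbitrary: q)
    case (Cons c cs)
    then show ?case using step lt by simp
  qed simp
  have i: "foldl (dfa_step D) (init D) y < ?m" using run_lt[OF D y] D by (simp add: wf_dfa_def)
  have "foldl (dfa_step ?D) (init ?D) cs \<in> set (finals ?D) \<longleftrightarrow> y @ blocks u x cs @ z \<in> dfa_lang D"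
    if cs: "cs \<in> lists {..<n}" for cs
  proof -
    let ?q = "foldl (dfa_step D) (init D) y"
    have "blocks u x cs \<in> lists (set (letters D))" using blocks_in_lists[OF u _ cs] x by auto
    then have "y @ blocks u x cs @ z \<in> dfa_lang D \<longleftrightarrow>
        foldl (dfa_step D) (foldl (dfa_step D) ?q (blocks u x cs)) z \<in> set (finals D)"
      using y z by (simp add: dfa_lang_def)
    also have "\<dots> \<longleftrightarrow> foldl (dfa_step D) (foldl (dfa_step ?D) ?q cs) (u @ z) \<in> set (finals D)"
      using run[OF i cs] by simp
    also have "\<dots> \<longleftrightarrow> foldl (dfa_step ?D) (init ?D) cs \<in> set (finals ?D)"
      using run[OF i cs] by (simp add: block_dfa_def)
    finally show ?thesis by simp
  qed
  moreover have "set (letters ?D) = {..<n}" by (auto simp: block_dfa_def)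
  ultimately show ?thesis unfolding dfa_lang_def[of ?D] block_lang_def by auto
qed

lemma stable_length_dfa_code:
  "stable_length (dfa_code D) = fact (2 ^ (length (trans D) ^ length (trans D)))"
  by (simp only: stable_length_def dfa_code_counts)

lemma block_code:
  assumes D: "wf_dfa D" and N: "N = stable_length (dfa_code D)" and n: "n = length (letters D) ^ N"
    and u: "u < n" and y: "y < length (letters D) ^ k" and z: "z < length (letters D) ^ l"
  shows "block_code (dfa_code D) u k y l z =
    dfa_code (block_dfa D (letter_word D N u) (letter_word D N) n (letter_word D k y) (letter_word D l z))"
proof -
  let ?m = "length (trans D)"
    and ?D = "block_dfa D (letter_word D N u) (letter_word D N) n (letter_word D k y) (letter_word D l z)"
  have lw: "letter_word D j w \<in> lists (set (letters D))" if "w < length (letters D) ^ j" for j w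
  proof -
    have "letter_word D j w \<in> letter_word D j ` {..<length (letters D) ^ j}" using that by simp
    then show ?thesis unfolding letter_word_image by (simp add: in_words_of_length)
  qed
  have i: "init D < ?m" using D by (simp add: wf_dfa_def)
  have ru: "run_code (dfa_code D) N u q = foldl (dfa_step D) q (letter_word D N u)"
    "foldl (dfa_step D) q (letter_word D N u) < ?m" if "q < ?m" for q
    using run_code[OF D that] run_lt[OF D lw that] u n by auto
  have "map (\<lambda>q. code_map (\<lambda>x. run_code (dfa_code D) N x (run_code (dfa_code D) N u q)) n) [0..<?m] =
      map list_encode (map (\<lambda>q. map (\<lambda>c. foldl (dfa_step D) q (letter_word D N u @ letter_word D N c)) [0..<n]) [0..<?m])"
    unfolding map_map
  proof (rule map_cong[OF refl])
    fix q assume "q \<in> set [0..<?m]"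
    then have q: "q < ?m" by simp
    have "map (\<lambda>x. run_code (dfa_code D) N x (run_code (dfa_code D) N u q)) [0..<n] =
        map (\<lambda>c. foldl (dfa_step D) q (letter_word D N u @ letter_word D N c)) [0..<n]"
      using ru[OF q] run_code[OF D ru(2)[OF q]] n by (intro map_cong) auto
    then show "code_map (\<lambda>x. run_code (dfa_code D) N x (run_code (dfa_code D) N u q)) n =
        (list_encode \<circ> (\<lambda>q. map (\<lambda>c. foldl (dfa_step D) q (letter_word D N u @ letter_word D N c)) [0..<n])) q"
      by (simp only: code_map o_apply)
  qed
  moreover have "filter (\<lambda>q. final_code (dfa_code D) (run_code (dfa_code D) l z (run_code (dfa_code D) N u q))) [0..<?m] =
      filter (\<lambda>q. foldl (dfa_step D) q (letter_word D N u @ letter_word D l z) \<in> set (finals D)) [0..<?m]"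
    by (rule filter_cong[OF refl]) (use ru run_code[OF D _ z] in \<open>simp add: final_code_iff\<close>)
  ultimately show ?thesis
    unfolding block_code_def Let_def N[symmetric] dfa_code_counts n[symmetric] dfa_code_nth
      code_map[of _ ?m] code_filter run_code[OF D i y]
    by (simp add: dfa_code_make block_dfa_def code_map)
      (rule arg_cong[of _ _ list_encode], rule map_cong[OF refl], simp)
qed

lemma block_lang_cong:
  assumes D: "wf_dfa D" and A: "A = set (letters D)"
    and y: "y \<in> lists A" "y' \<in> lists A" "transition D y = transition D y'"
    and z: "z \<in> lists A" "z' \<in> lists A" "transition D z = transition D z'"
    and u: "u \<in> lists A" and x: "\<forall>c\<in>C. x c \<in> lists A"
  shows "block_lang (dfa_lang D) y z u x C = block_lang (dfa_lang D) y' z' u x C"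
  unfolding block_lang_def
proof (rule Collect_cong, rule conj_cong[OF refl])
  fix cs assume "cs \<in> lists C"
  then have b: "blocks u x cs \<in> lists A" using blocks_in_lists[OF u x] by blast
  interpret tr: word_quotient A "transition D" using transition_word_quotient[OF D] A by simp
  have "transition D (y @ blocks u x cs @ z) = transition D (y' @ blocks u x cs @ z')"
    using y z b by (intro tr.append_cong) auto
  moreover have "init D < length (trans D)" using D by (simp add: wf_dfa_def)
  ultimately show "y @ blocks u x cs @ z \<in> dfa_lang D \<longleftrightarrow> y' @ blocks u x cs @ z' \<in> dfa_lang D"
    using y z b A by (simp add: dfa_lang_def transition_eq_iff)
qed

text \<open>\<open>stable_local_monoids_iff\<close> is applied to the transition map and the
  factorial exponent, so all data come directly from \<open>D\<close>. The languages it asks about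
  are those of the block automata, on which \<open>f\<close> is correct.\<close>

lemma decision_correct:
  assumes V: "variety V" and cor: "corresponds F V" and D: "wf_dfa D"
    and f: "\<And>D. wf_dfa D \<Longrightarrow> f (dfa_code D) = (if definable F (set (letters D)) (dfa_lang D) then 1 else 0)"
  shows "decision f (dfa_code D) \<longleftrightarrow> stable_local_monoids_in (set (letters D)) (dfa_lang D) V"
proof -
  define A where "A = set (letters D)"
  define N where "N = stable_length (dfa_code D)"
  define n where "n = length (letters D) ^ N"
  let ?L = "dfa_lang D" and ?m = "length (trans D)" and ?a = "length (letters D)" and ?w = "letter_word D"
  let ?R = "\<lambda>u y z. var_recognizable V {..<n} (block_lang ?L y z u (?w N) {..<n})"
  have reg: "regular_lang A ?L" using D unfolding regular_lang_def A_def by blast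
  interpret tr: word_quotient A "transition D" using transition_word_quotient[OF D] by (simp add: A_def)
  have N: "0 < N" "transition D ` words_of_length A N = transition D ` words_of_length A (2 * N)"
    using tr.stable_fact card_transitions[OF D] unfolding N_def stable_length_dfa_code A_def by simp_all
  have img: "?w k ` {..<?a ^ k} = words_of_length A k" for k
    using letter_word_image unfolding A_def .
  have lw: "?w k v \<in> words_of_length A k" "?w k v \<in> lists A" if "v < ?a ^ k" for k v
  proof -
    have "?w k v \<in> ?w k ` {..<?a ^ k}" using that by simp
    then show "?w k v \<in> words_of_length A k" unfolding img .
    then show "?w k v \<in> lists A" by (simp add: in_words_of_length)
  qed
  have "stable_local_monoids_in A ?L V \<longleftrightarrow> (\<forall>u\<in>words_of_length A N. transition D (u @ u) = transition D u \<longrightarrow>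
      (\<forall>y\<in>lists A. \<forall>z\<in>lists A. ?R u y z))"
  proof (rule stable_local_monoids_iff[OF V reg tr.word_quotient_axioms _ N])
    show "syn_morphism A ?L u = syn_morphism A ?L v"
      if "u \<in> lists A" "v \<in> lists A" "transition D u = transition D v" for u v
      using transition_eq_imp_syn_eq[OF D] that unfolding A_def by blast
    show "?w N ` {..<n} = words_of_length A N" using img unfolding n_def .
  qed simp
  also have "\<dots> \<longleftrightarrow> (\<forall>u<n. transition D (?w N u @ ?w N u) = transition D (?w N u) \<longrightarrow>
      (\<forall>y\<in>lists A. \<forall>z\<in>lists A. ?R (?w N u) y z))"
    unfolding img[symmetric] n_def[symmetric] by blast
  also have "\<dots> \<longleftrightarrow> decision f (dfa_code D)"
    unfolding decision_def dfa_code_counts N_def[symmetric] n_def[symmetric]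
  proof (intro all_cong1 imp_cong refl)
    fix u assume u: "u < n"
    then have uA: "?w N u \<in> lists A" using lw(2) by (simp add: n_def)
    have xA: "\<forall>c<n. ?w N c \<in> lists A" using lw(2) by (simp add: n_def)
    have run: "run_code (dfa_code D) N u q = foldl (dfa_step D) q (?w N u)"
      "foldl (dfa_step D) q (?w N u) < ?m" if "q < ?m" for q
      using run_code[OF D that, of u N] run_lt[OF D _ that] uA u by (auto simp: n_def A_def)
    show "transition D (?w N u @ ?w N u) = transition D (?w N u) \<longleftrightarrow>
      (\<forall>q<?m. run_code (dfa_code D) N u (run_code (dfa_code D) N u q) = run_code (dfa_code D) N u q)"
      unfolding transition_eq_iff using run by simp
    \<comment> \<open>Here recognizability by \<open>V\<close> becomes definability in
      \<open>F\<close>, which \<open>f\<close> decides.\<close>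
    have R: "?R (?w N u) (?w k y) (?w l z) \<longleftrightarrow> f (block_code (dfa_code D) u k y l z) = 1"
      if "y < ?a ^ k" "z < ?a ^ l" for k l y z
    proof -
      let ?D = "block_dfa D (?w N u) (?w N) n (?w k y) (?w l z)"
      have "wf_dfa ?D" using wf_block_dfa[OF D] uA xA lw(2)[OF that(1)] unfolding A_def by blast
      moreover have "dfa_lang ?D = block_lang ?L (?w k y) (?w l z) (?w N u) (?w N) {..<n}"
        using block_dfa_lang[OF D] uA xA lw(2)[OF that(1)] lw(2)[OF that(2)] unfolding A_def by blast
      moreover have "set (letters ?D) = {..<n}" by (auto simp: block_dfa_def)
      moreover have "definable F {..<n} (block_lang ?L (?w k y) (?w l z) (?w N u) (?w N) {..<n}) \<longleftrightarrow>
          ?R (?w N u) (?w k y) (?w l z)"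
        by (rule definable_iff_var_recognizable[OF cor]) (auto simp: block_lang_def)
      ultimately show ?thesis
        unfolding block_code[OF D N_def n_def u that] using f[of ?D] by simp
    qed
    show "(\<forall>y\<in>lists A. \<forall>z\<in>lists A. ?R (?w N u) y z) \<longleftrightarrow>
      (\<forall>k<2 * N. \<forall>l<2 * N. \<forall>y<?a ^ k. \<forall>z<?a ^ l. f (block_code (dfa_code D) u k y l z) = 1)"
    proof (intro iffI allI impI ballI)
      fix k l y z assume "\<forall>y\<in>lists A. \<forall>z\<in>lists A. ?R (?w N u) y z" "y < ?a ^ k" "z < ?a ^ l"
      then show "f (block_code (dfa_code D) u k y l z) = 1" using R lw(2) by blast
    next
      fix y z assume *: "\<forall>k<2 * N. \<forall>l<2 * N. \<forall>y<?a ^ k. \<forall>z<?a ^ l. f (block_code (dfa_code D) u k y l z) = 1"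
        and yz: "y \<in> lists A" "z \<in> lists A"
      \<comment> \<open>An arbitrary context is replaced by a short numbered one with the same
        transition, which leaves the block language unchanged.\<close>
      have short: "\<exists>k v. k < 2 * N \<and> v < ?a ^ k \<and> transition D v' = transition D (?w k v)" if v': "v' \<in> lists A" for v'
      proof -
        obtain v where v: "v \<in> lists A" "length v < 2 * N" "transition D v = transition D v'"
          using tr.short_representative[OF N(2,1) v'] by blast
        then have "v \<in> ?w (length v) ` {..<?a ^ length v}" unfolding img by (simp add: in_words_of_length)
        then show ?thesis using v by (metis imageE lessThan_iff)
      qed
      obtain k i where k: "k < 2 * N" "i < ?a ^ k" "transition D y = transition D (?w k i)" using short[OF yz(1)] by blast
      obtain l j where l: "l < 2 * N" "j < ?a ^ l" "transition D z = transition D (?w l j)" using short[OF yz(2)] by blast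
      have "?R (?w N u) (?w k i) (?w l j)" using R[OF k(2) l(2)] * k l by blast
      moreover have "block_lang ?L y z (?w N u) (?w N) {..<n} = block_lang ?L (?w k i) (?w l j) (?w N u) (?w N) {..<n}"
        by (rule block_lang_cong[OF D A_def]) (use yz k l lw(2) uA xA in auto)
      ultimately show "?R (?w N u) y z" by simp
    qed
  qed
  finally show ?thesis unfolding A_def by simp
qed

text \<open>The procedure for \<open>F\<close> is called on finitely many automata computed from the
  input, and the answers are combined by bounded quantifiers; no algorithm for membership in
  \<open>V\<close> enters.\<close>

lemma decidable_enrichment:
  assumes V: "variety V" and cor: "corresponds F V" and dec: "decidable_fragment F"
    and G: "\<And>A L. regular_lang A L \<Longrightarrow> definable G A L \<longleftrightarrow> stable_local_monoids_in A L V"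
  shows "decidable_fragment G"
proof -
  obtain f where f: "recursive 1 f" "\<And>D. wf_dfa D \<Longrightarrow>
      f [dfa_code D] = (if definable F (set (letters D)) (dfa_lang D) then 1 else 0)"
    using dec unfolding decidable_fragment_def by blast
  let ?f = "\<lambda>x. f [x]"
  have "recursive 1 (\<lambda>xs. f [hd xs])"
    by (rule recursive.ext[OF f(1)]) (auto simp: length_Suc_conv)
  then have "rf ?f" by (simp add: rf_def)
  from rp_decision[OF this] have "recursive 1 (\<lambda>xs. if decision ?f (hd xs) then 1 else 0)"
    unfolding rp_def rf_def .
  moreover have "(if decision ?f (hd [dfa_code D]) then 1 else 0) =
      (if definable G (set (letters D)) (dfa_lang D) then 1 else (0::nat))" if D: "wf_dfa D" for D
  proof -
    have "regular_lang (set (letters D)) (dfa_lang D)" using D unfolding regular_lang_def by blast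
    then show ?thesis using decision_correct[OF V cor D, of ?f] f(2) G by simp
  qed
  ultimately show ?thesis unfolding decidable_fragment_def by blast
qed

theorem theorem7:
  fixes F :: "form set" and \<sigma> :: "predicate set" and V :: "nat monoid set"
  assumes "numerical_signature \<sigma>"
    and "fragment F \<sigma>"
    and "local_variety V"
    and "corresponds F V"
  shows "(\<forall>A L s. regular_lang A L \<and> s = lang_stability_index A L \<longrightarrow>
            (definable (enrich F \<sigma> (local_preds \<union> all_MOD_preds)) A L \<longleftrightarrow>
             definable (enrich F \<sigma> (local_preds \<union> MOD_preds s)) A L) \<and>
            (definable (enrich F \<sigma> (local_preds \<union> MOD_preds s)) A L \<longleftrightarrow>
             stable_local_monoids_in A L V)) \<and>
         (decidable_fragment F \<longrightarrow>
          decidable_fragment (enrich F \<sigma> (local_preds \<union> all_MOD_preds)))"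
proof -
  have V: "variety V" using assms(3) by (simp add: local_variety_def)
  let ?all = "enrich F \<sigma> (local_preds \<union> all_MOD_preds)"
    and ?s = "\<lambda>A L. enrich F \<sigma> (local_preds \<union> MOD_preds (lang_stability_index A L))"
  have 12: "definable (?s A L) A L \<Longrightarrow> definable ?all A L" if "regular_lang A L" for A L
  proof -
    have "0 < lang_stability_index A L"
      unfolding lang_stability_index_def by (rule word_quotient.stability_index(1)[OF syn_word_quotient[OF that]])
    then have "MOD_preds (lang_stability_index A L) \<subseteq> all_MOD_preds"
      unfolding all_MOD_preds_def by (intro UN_upper) simp
    then have "?s A L \<subseteq> ?all" by (intro enrich_mono) blast
    then show "definable (?s A L) A L \<Longrightarrow> definable ?all A L" unfolding definable_def by blast
  qed
  have 13: "definable ?all A L \<Longrightarrow> stable_local_monoids_in A L V" if "regular_lang A L" for A L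
    by (rule definable_imp_stable_local_monoids[OF assms(1,2) V assms(4) that])
  have 32: "stable_local_monoids_in A L V \<Longrightarrow> definable (?s A L) A L" if "regular_lang A L" for A L
    by (rule stable_local_monoids_imp_definable[OF assms that])
  have iff: "definable ?all A L \<longleftrightarrow> stable_local_monoids_in A L V" if "regular_lang A L" for A L
    using 12[OF that] 13[OF that] 32[OF that] by blast
  have "decidable_fragment ?all" if "decidable_fragment F"
    by (rule decidable_enrichment[OF V assms(4) that iff])
  moreover have "(definable ?all A L \<longleftrightarrow> definable (?s A L) A L) \<and>
      (definable (?s A L) A L \<longleftrightarrow> stable_local_monoids_in A L V)" if "regular_lang A L" for A L
    using 12[OF that] 13[OF that] 32[OF that] by blast
  ultimately show ?thesis by simp
qed

end
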